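(* Let $\mathfrak{S}$ denote the space of all functions $m\in C^\infty(\mathbb{R}^d\setminus\{0\})$ such that for every multi-index $\alpha$ there is $C_\alpha<\infty$ with $|\partial^\alpha m(\xi)|\le C_\alpha|\xi|^{-|\alpha|}$ for all $\xi\neq 0$. Equip $\mathfrak{S}$ with the Fréchet space topology given by the norms $$\|m\|_{(j)}=\sup_{|\alpha|\le j}\sup_{\xi\in\mathbb{R}^d\setminus\{0\}}|\xi|^{|\alpha|}|\partial^\alpha_\xi m(\xi)|,\qquad j=0,1,2,\dots$$ For $m\in\mathfrak{S}$ define the dyadic maximal operator $$M_m f(x)=\sup_{k\in\mathbb{Z}}\big|\mathcal{F}^{-1}[m(2^k\cdot)\widehat f\,](x)\big|.$$ Let $\mathcal{S}_0$ be the space of Schwartz functions on $\mathbb{R}^d$ whose Fourier transforms have compact support in $\mathbb{R}^d\setminus\{0\}$, and let $\mathfrak{S}^M$ be the set of all $m\in\mathfrak{S}$ for which there exists some $p\in(1,\infty)$ with $$\sup\{\|M_m f\|_p:\ f\in\mathcal{S}_0,\ \|f\|_p\le 1\}<\infty.$$ Then $\mathfrak{S}^M$ is of first category in $\mathfrak{S}$ in the sense of Baire.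
   Context: $\mathcal{F}^{-1}$ denotes the inverse Fourier transform on $\mathbb{R}^d$ and $\widehat f$ the Fourier transform of $f$. *)

theory Defs
  imports "HOL-Analysis.Analysis"
begin

type_synonym 'n vec = "real ^ 'n"

definition fourier :: "('n::finite vec \<Rightarrow> complex) \<Rightarrow> 'n vec \<Rightarrow> complex" where
  "fourier f \<xi> = (\<integral>x. f x * cis (- 2 * pi * (x \<bullet> \<xi>)) \<partial>lborel)"

definition inv_fourier :: "('n::finite vec \<Rightarrow> complex) \<Rightarrow> 'n vec \<Rightarrow> complex" where
  "inv_fourier g x = (\<integral>\<xi>. g \<xi> * cis (2 * pi * (x \<bullet> \<xi>)) \<partial>lborel)"

text \<open>Partial derivative in coordinate direction i, and iterated partial derivatives
  along a list of coordinate directions (a multi-index written as a list).\<close>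
definition partial :: "'n::finite \<Rightarrow> ('n vec \<Rightarrow> complex) \<Rightarrow> 'n vec \<Rightarrow> complex" where
  "partial i g \<xi> = vector_derivative (\<lambda>t. g (\<xi> + t *\<^sub>R axis i 1)) (at 0)"

fun pderivs :: "'n::finite list \<Rightarrow> ('n vec \<Rightarrow> complex) \<Rightarrow> 'n vec \<Rightarrow> complex" where
  "pderivs [] g = g"
| "pderivs (i # is) g = partial i (pderivs is g)"

definition smooth_on :: "'n::finite vec set \<Rightarrow> ('n vec \<Rightarrow> complex) \<Rightarrow> bool" where
  "smooth_on S g \<longleftrightarrow> (\<forall>is. continuous_on S (pderivs is g) \<and>
      (\<forall>i. \<forall>\<xi>\<in>S. (\<lambda>t. pderivs is g (\<xi> + t *\<^sub>R axis i 1)) differentiable (at 0)))"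

text \<open>The symbol class \<open>\<SS>\<close> (Mikhlin-type multipliers). Values at 0 are irrelevant;
  we normalise m 0 = 0 so that elements of the space are uniquely represented.\<close>
definition mult_space :: "('n::finite vec \<Rightarrow> complex) set" where
  "mult_space = {m. smooth_on (- {0}) m \<and> m 0 = 0 \<and>
      (\<forall>is. \<exists>C. \<forall>\<xi>. \<xi> \<noteq> 0 \<longrightarrow> norm (pderivs is m \<xi>) \<le> C * norm \<xi> powr (- real (length is)))}"

definition snorm :: "nat \<Rightarrow> ('n::finite vec \<Rightarrow> complex) \<Rightarrow> real" where
  "snorm j m = Sup {norm \<xi> ^ length is * norm (pderivs is m \<xi>) | is \<xi>. length is \<le> j \<and> \<xi> \<noteq> 0}"

definition mult_topology :: "('n::finite vec \<Rightarrow> complex) topology" where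
  "mult_topology = topology_generated_by
     {{m' \<in> mult_space. snorm j (m' - m) < \<epsilon>} | m j \<epsilon>. m \<in> mult_space \<and> \<epsilon> > 0}"

definition nowhere_dense_in :: "'a topology \<Rightarrow> 'a set \<Rightarrow> bool" where
  "nowhere_dense_in X N \<longleftrightarrow> N \<subseteq> topspace X \<and> X interior_of (X closure_of N) = {}"

definition first_category_in :: "'a topology \<Rightarrow> 'a set \<Rightarrow> bool" where
  "first_category_in X A \<longleftrightarrow> (\<exists>N :: nat \<Rightarrow> 'a set. (\<forall>n. nowhere_dense_in X (N n)) \<and> A \<subseteq> (\<Union>n. N n))"

definition schwartz :: "('n::finite vec \<Rightarrow> complex) set" where
  "schwartz = {f. smooth_on UNIV f \<and>
      (\<forall>is. \<forall>N::nat. bounded (range (\<lambda>x. (1 + norm x) ^ N *\<^sub>R pderivs is f x)))}"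

definition schwartz0 :: "('n::finite vec \<Rightarrow> complex) set" where
  "schwartz0 = {f \<in> schwartz. \<exists>K. compact K \<and> K \<subseteq> - {0} \<and> (\<forall>\<xi>. \<xi> \<notin> K \<longrightarrow> fourier f \<xi> = 0)}"

definition dyadic_max :: "('n::finite vec \<Rightarrow> complex) \<Rightarrow> ('n vec \<Rightarrow> complex) \<Rightarrow> 'n vec \<Rightarrow> ennreal" where
  "dyadic_max m f x = (SUP k::int. ennreal (norm
      (inv_fourier (\<lambda>\<xi>. m ((2::real) powr real_of_int k *\<^sub>R \<xi>) * fourier f \<xi>) x)))"

definition enn_powr :: "ennreal \<Rightarrow> real \<Rightarrow> ennreal" where
  "enn_powr a p = (if a = top then top else ennreal (enn2real a powr p))"

definition Lp_pow :: "real \<Rightarrow> ('n::finite vec \<Rightarrow> ennreal) \<Rightarrow> ennreal" where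
  "Lp_pow p g = (\<integral>\<^sup>+ x. enn_powr (g x) p \<partial>lborel)"

text \<open>\<SS>^M: multipliers whose dyadic maximal operator is L^p bounded on S_0 for some p.
  sup{\<parallel>M f\<parallel>_p : \<parallel>f\<parallel>_p \<le> 1} < \<infinity> is written with p-th powers.\<close>
definition mult_space_M :: "('n::finite vec \<Rightarrow> complex) set" where
  "mult_space_M = {m \<in> mult_space. \<exists>p. 1 < p \<and> (\<exists>C::real. \<forall>f \<in> schwartz0.
      Lp_pow p (\<lambda>x. ennreal (norm (f x))) \<le> 1 \<longrightarrow> Lp_pow p (dyadic_max m f) \<le> ennreal C)}"

end

theory Submission
  imports Defs "HOL-Probability.Probability" "HOL-Complex_Analysis.Great_Picard"
begin

text \<open>
  With a fixed band-limited window \<open>0 \<le> g \<le> 1\<close> and \<open>e\<^sub>i(x) = exp (2\<pi>i 2\<^sup>i x\<^sub>a)\<close>, the test functions are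
  \<open>f = g \<cdot> (e\<^sub>0 + \<dots> + e\<^sub>n\<^sub>-\<^sub>1)\<close>. The \<open>e\<^sub>i\<close> are orthogonal in \<open>L\<^sup>2(g)\<close>, so \<open>\<integral> \<bar>f\<bar> \<le> sqrt n \<cdot> \<integral> g\<close>, and
  \<open>\<bar>f\<bar> \<le> n\<close> yields \<open>\<integral> \<bar>f\<bar> powr p \<le> n powr (p - 1/2) \<cdot> \<integral> g\<close> for all \<open>p > 1\<close>.
  A sum \<open>b\<close> of bumps at the frequencies \<open>2\<^sup>l\<close> acts on \<open>f\<close>, after dilation by \<open>2\<^sup>j\<close>, by selecting the
  terms with \<open>i + j \<in> L\<close>. If \<open>L\<close> contains every subset pattern of \<open>{0..<n}\<close> in some block, the supremum
  over \<open>j\<close> is at least of order \<open>n g\<close> pointwise, since some subset sum of \<open>n\<close> unimodular numbers has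
  modulus at least \<open>n/4\<close>. The symbol norms of \<open>b\<close> are bounded uniformly in \<open>L\<close>, because the bumps are disjoint.

  Given \<open>m\<^sub>0\<close> and a ball around it, the perturbation \<open>m\<^sub>0 + \<delta> b\<close> lies in the ball. By Arzela-Ascoli the
  blocks can be placed where the dilates of \<open>m\<^sub>0\<close> act on \<open>f\<close> in nearly the same way, so comparison
  with the block of the empty pattern removes \<open>m\<^sub>0\<close>. The resulting lower bound is stable under
  perturbations that are small in the supremum norm, and it beats any prescribed constant for all
  \<open>p \<le> r\<close> at once if \<open>n\<close> is large.
\<close>

text \<open>The gap between n^p and n^(p - 1/2) is \<open>sqrt n\<close> whatever p is, so one wave
  train serves all exponents up to r; p costs only a power of the amplitude \<delta>. The obstacle
  is the given symbol: its dilates need not be small compared with \<delta> and could cancel the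
  selected subset sum. Only differences of two dilates can be made small, and a lower bound for such
  a difference still forces one of the two to be large. The choices are made in the order \<delta>
  (from the ball), n (from r and \<delta>), blocks and stability radius (from the symbol and n).
  This order is possible because the symbol norms of the lacunary sum see neither n nor the blocks.
  Window and bumps are tensor products, so inversion on the line carries over to every dimension.
  The lengths fit together as follows: a bump of radius 1/16 yields a window with spectrum of radius
  1/8; the plateau of the cutoff covers exactly this radius; its support radius 1/4 puts the dilates
  over [3/4, 5/4] 2^l, and these intervals are disjoint since 5/4 < 2 * 3/4.\<close>

section \<open>Smooth functions of one variable\<close>

text \<open>Derivatives are carried as data and not computed by an operator, so that those of
  products, dilations and linear images can be written down. The predicate \<open>P\<close> records
  what all of them share, such as support, decay or boundedness.\<close>

definition tower :: "((real \<Rightarrow> 'a::real_normed_vector) \<Rightarrow> bool) \<Rightarrow> (nat \<Rightarrow> real \<Rightarrow> 'a) \<Rightarrow> bool" where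
  "tower P D \<longleftrightarrow> (\<forall>k. P (D k)) \<and> (\<forall>k t. (D k has_vector_derivative D (Suc k) t) (at t))"

lemma towerI:
  assumes "\<And>k. P (D k)" "\<And>k t. (D k has_vector_derivative D (Suc k) t) (at t)"
  shows "tower P D"
  using assms by (auto simp: tower_def)

lemma towerD:
  assumes "tower P D"
  shows "P (D k)" "(D k has_vector_derivative D (Suc k) t) (at t)"
  using assms by (auto simp: tower_def)

lemma tower_continuous: "tower P D \<Longrightarrow> continuous_on S (D k)"
  by (meson towerD(2) continuous_at_imp_continuous_on has_vector_derivative_continuous)

text \<open>The \<open>k\<close>-th derivative of \<open>D i \<cdot> E j\<close>; recursion over \<open>k\<close> avoids the binomial coefficients.\<close>
fun leibniz :: "(nat \<Rightarrow> real \<Rightarrow> 'a::real_normed_algebra) \<Rightarrow> (nat \<Rightarrow> real \<Rightarrow> 'a) \<Rightarrow> nat \<Rightarrow> nat \<Rightarrow> nat \<Rightarrow> real \<Rightarrow> 'a" where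
  "leibniz D E 0 i j = (\<lambda>t. D i t * E j t)"
| "leibniz D E (Suc k) i j = (\<lambda>t. leibniz D E k i (Suc j) t + leibniz D E k (Suc i) j t)"

lemma leibniz_deriv:
  assumes "tower P D" "tower Q E"
  shows "(leibniz D E k i j has_vector_derivative leibniz D E (Suc k) i j t) (at t)"
proof (induction k arbitrary: i j)
  case 0
  show ?case using has_vector_derivative_mult[OF towerD(2)[OF assms(1), of i t] towerD(2)[OF assms(2), of j t]]
    by simp
next
  case (Suc k)
  show ?case
    using has_vector_derivative_add[OF Suc.IH[of i "Suc j"] Suc.IH[of "Suc i" j]] by simp
qed

text \<open>Every \<open>leibniz D E k i j\<close> is a sum of products of members of the two
  towers, so closure under products and sums is enough to propagate the predicate.\<close>

lemma tower_mult:
  assumes "tower P D" "tower Q E"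
    and prod: "\<And>u v. P u \<Longrightarrow> Q v \<Longrightarrow> R (\<lambda>t. u t * v t)"
    and add: "\<And>u v. R u \<Longrightarrow> R v \<Longrightarrow> R (\<lambda>t. u t + v t)"
  shows "tower R (\<lambda>k. leibniz D E k 0 0)"
proof (rule towerI)
  fix k t
  have "R (leibniz D E k i j)" for i j
    by (induction k arbitrary: i j) (auto intro!: prod add towerD(1)[OF assms(1)] towerD(1)[OF assms(2)])
  then show "R (leibniz D E k 0 0)" .
  show "(leibniz D E k 0 0 has_vector_derivative leibniz D E (Suc k) 0 0 t) (at t)"
    by (rule leibniz_deriv[OF assms(1,2)])
qed

lemma tower_affine:
  fixes D :: "nat \<Rightarrow> real \<Rightarrow> 'a::real_normed_vector"
  assumes "tower P D" "\<And>k. Q (\<lambda>t. c ^ k *\<^sub>R D k (c * t + d))"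
  shows "tower Q (\<lambda>k t. c ^ k *\<^sub>R D k (c * t + d))"
proof (rule towerI)
  fix k t
  have "((\<lambda>t. c * t + d) has_vector_derivative c) (at t)"
    by (auto intro!: derivative_eq_intros)
  from vector_diff_chain_at[OF this towerD(2)[OF assms(1)]]
  have "((\<lambda>t. D k (c * t + d)) has_vector_derivative c *\<^sub>R D (Suc k) (c * t + d)) (at t)"
    by (simp add: o_def)
  then have "((\<lambda>t. c ^ k *\<^sub>R D k (c * t + d)) has_vector_derivative c ^ k *\<^sub>R c *\<^sub>R D (Suc k) (c * t + d)) (at t)"
    by (auto intro!: derivative_eq_intros)
  then show "((\<lambda>t. c ^ k *\<^sub>R D k (c * t + d)) has_vector_derivative c ^ Suc k *\<^sub>R D (Suc k) (c * t + d)) (at t)"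
    by (simp add: mult.commute)
qed (rule assms(2))

lemma tower_linear:
  assumes "tower P D" "bounded_linear f" "\<And>k. Q (\<lambda>t. f (D k t))"
  shows "tower Q (\<lambda>k t. f (D k t))"
  using assms(3) by (intro towerI bounded_linear.has_vector_derivative[OF assms(2)] towerD(2)[OF assms(1)])

section \<open>Smooth bumps and plateaus on the line\<close>

definition vanishes_off :: "real \<Rightarrow> (real \<Rightarrow> 'a::zero) \<Rightarrow> bool" where
  "vanishes_off c u \<longleftrightarrow> (\<forall>t. \<bar>t\<bar> > c \<longrightarrow> u t = 0)"

text \<open>The functions p(1/t) exp(-1/t), extended by zero. They are closed under differentiation:
  for t > 0 the derivative belongs to the polynomial u^2 (p - p') in u = 1/t.\<close>

definition flat_exp :: "real poly \<Rightarrow> real \<Rightarrow> real" where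
  "flat_exp p t = (if t > 0 then poly p (1 / t) * exp (- (1 / t)) else 0)"

lemma poly_exp_tendsto_0: "((\<lambda>u::real. poly p u * exp (- u)) \<longlongrightarrow> 0) at_top"
proof -
  have "((\<lambda>u. \<Sum>i\<le>degree p. coeff p i * (u ^ i / exp u)) \<longlongrightarrow> (\<Sum>i\<le>degree p. coeff p i * 0)) at_top"
    by (intro tendsto_sum tendsto_mult tendsto_const tendsto_power_div_exp_0)
  then show ?thesis
    by (simp add: poly_altdef sum_distrib_right exp_minus divide_inverse mult.assoc)
qed

lemma flat_exp_deriv:
  "(flat_exp p has_vector_derivative flat_exp (monom 1 2 * (p - pderiv p)) t) (at t)"
proof -
  consider "t > 0" | "t < 0" | "t = 0" by linarith
  then show ?thesis
  proof cases
    case 1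
    have "((\<lambda>t. poly p (1 / t) * exp (- (1 / t))) has_real_derivative
        flat_exp (monom 1 2 * (p - pderiv p)) t) (at t)"
      using 1 by (auto intro!: derivative_eq_intros DERIV_chain'[OF _ poly_DERIV, of "\<lambda>t. 1 / t"]
          simp: flat_exp_def poly_monom field_simps power2_eq_square)
    then have "(flat_exp p has_real_derivative flat_exp (monom 1 2 * (p - pderiv p)) t) (at t)"
      by (rule has_field_derivative_transform_within_open[where S="{0<..}"]) (use 1 in \<open>auto simp: flat_exp_def\<close>)
    then show ?thesis by (simp add: has_real_derivative_iff_has_vector_derivative)
  next
    case 2
    have "((\<lambda>_. 0) has_vector_derivative (0::real)) (at t)" by simp
    then show ?thesis
      by (rule has_vector_derivative_transform_within_open[where S="{..<0}", THEN back_subst[of "\<lambda>d. (_ has_vector_derivative d) _"]])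
         (use 2 in \<open>auto simp: flat_exp_def\<close>)
  next
    case 3
    have r: "((\<lambda>h. flat_exp p h / h) \<longlongrightarrow> 0) (at_right 0)"
    proof -
      \<comment> \<open>Dividing by h multiplies the polynomial in u = 1/h by u, hence
        \<open>pCons 0 p\<close>; the limit is then that of a polynomial times exp(-u) at
        infinity.\<close>
      have "((\<lambda>h::real. poly (pCons 0 p) (1 / h) * exp (- (1 / h))) \<longlongrightarrow> 0) (at_right 0)"
        by (rule filterlim_compose[OF poly_exp_tendsto_0]) (use filterlim_inverse_at_top_right in \<open>simp add: inverse_eq_divide\<close>)
      then show ?thesis
        by (rule Lim_transform_eventually) (auto simp: flat_exp_def eventually_at_filter)
    qed
    have l: "((\<lambda>h. flat_exp p h / h) \<longlongrightarrow> 0) (at_left 0)"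
      by (rule Lim_transform_eventually[OF tendsto_const]) (auto simp: flat_exp_def eventually_at_filter)
    have "((\<lambda>h. (flat_exp p (0 + h) - flat_exp p 0) / h) \<longlongrightarrow> 0) (at 0)"
      using filterlim_split_at[OF l r] by (simp add: flat_exp_def)
    then have "(flat_exp p has_real_derivative 0) (at 0)"
      by (simp add: DERIV_def)
    then show ?thesis using 3 by (simp add: has_real_derivative_iff_has_vector_derivative flat_exp_def)
  qed
qed

lemma flat_exp_tower:
  "tower (\<lambda>u. \<forall>t\<le>0. u t = 0) (\<lambda>k. flat_exp (((\<lambda>p. monom 1 2 * (p - pderiv p)) ^^ k) 1))"
proof (rule towerI)
  fix k t
  show "(flat_exp (((\<lambda>p. monom 1 2 * (p - pderiv p)) ^^ k) 1) has_vector_derivative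
      flat_exp (((\<lambda>p. monom 1 2 * (p - pderiv p)) ^^ Suc k) 1) t) (at t)"
    using flat_exp_deriv by simp
qed (auto simp: flat_exp_def)

lemma compact_integrable:
  fixes u :: "real \<Rightarrow> 'a::euclidean_space"
  assumes "continuous_on UNIV u" "vanishes_off c u"
  shows "integrable lborel u"
proof -
  have "(\<lambda>t. indicator {-c..c} t *\<^sub>R u t) = u"
    using assms(2) by (force simp: vanishes_off_def indicator_def fun_eq_iff)
  then show ?thesis
    using borel_integrable_compact[of "{-c..c}" u] assms(1) by (auto intro: continuous_on_subset)
qed

definition is_bump :: "real \<Rightarrow> (nat \<Rightarrow> real \<Rightarrow> real) \<Rightarrow> bool" where
  "is_bump c D \<longleftrightarrow> tower (vanishes_off c) D \<and> (\<forall>t. D 0 t \<ge> 0) \<and> (LINT t|lborel. D 0 t) = 1"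

text \<open>The product exp(-1/(t + c)) exp(-1/(c - t)) is smooth and positive on (-c, c). Its
  integral cannot vanish, since the interval has positive length, so it can be normalised.\<close>

lemma bump_exists:
  assumes c: "c > 0"
  shows "\<exists>D. is_bump c D"
proof -
  define F where "F = (\<lambda>k. flat_exp (((\<lambda>p. monom 1 2 * (p - pderiv p)) ^^ k) 1))"
  have F: "tower (\<lambda>u. \<forall>t\<le>0. u t = 0) F" unfolding F_def by (rule flat_exp_tower)
  have Z: "F k t = 0" if "t \<le> 0" for k t using towerD(1)[OF F] that by blast
  have F0: "F 0 t = (if t > 0 then exp (- (1/t)) else 0)" for t by (simp add: F_def flat_exp_def)
  have A: "tower (\<lambda>u. \<forall>t< -c. u t = 0) (\<lambda>k t. 1 ^ k *\<^sub>R F k (1 * t + c))"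
    by (rule tower_affine[OF F]) (auto intro!: Z)
  have B: "tower (\<lambda>u. \<forall>t>c. u t = 0) (\<lambda>k t. (-1) ^ k *\<^sub>R F k ((-1) * t + c))"
    by (rule tower_affine[OF F]) (auto intro!: Z)
  define G where "G = (\<lambda>k. leibniz (\<lambda>k t. 1 ^ k *\<^sub>R F k (1 * t + c)) (\<lambda>k t. (-1) ^ k *\<^sub>R F k ((-1) * t + c)) k 0 0)"
  have G: "tower (vanishes_off c) G"
    unfolding G_def by (rule tower_mult[OF A B]) (auto simp: vanishes_off_def abs_real_def split: if_splits)
  have G0: "G 0 t = F 0 (t + c) * F 0 (c - t)" for t by (simp add: G_def)
  have Gint: "integrable lborel (G 0)"
    by (rule compact_integrable[OF tower_continuous[OF G] towerD(1)[OF G]])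
  have Gnn: "G 0 t \<ge> 0" for t by (simp add: G0 F0)
  define I where "I = (LINT t|lborel. G 0 t)"
  have "I \<noteq> 0"
  proof
    assume "I = 0"
    then have ae: "AE t in lborel. G 0 t = 0"
      using integral_nonneg_eq_0_iff_AE[OF Gint] Gnn by (simp add: I_def)
    have op: "open {t. G 0 t \<noteq> 0}"
      by (intro open_Collect_neq tower_continuous[OF G] continuous_on_const)
    have "emeasure lborel {t. G 0 t \<noteq> 0} = 0"
      using AE_iff_measurable[of "{t. G 0 t \<noteq> 0}" lborel "\<lambda>t. G 0 t = 0"] op ae by simp
    moreover have "{-c<..<c} \<subseteq> {t. G 0 t \<noteq> 0}" by (auto simp: G0 F0)
    ultimately have "emeasure lborel {-c<..<c} \<le> 0"
      using emeasure_mono[of "{-c<..<c}" "{t. G 0 t \<noteq> 0}" lborel] op by simp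
    then show False using c by (simp add: ennreal_eq_0_iff)
  qed
  have "I \<ge> 0" unfolding I_def by (rule integral_nonneg_AE) (simp add: Gnn)
  have "is_bump c (\<lambda>k t. (1 / I) * G k t)"
    unfolding is_bump_def
  proof (intro conjI allI)
    show "tower (vanishes_off c) (\<lambda>k t. 1 / I * G k t)"
      using towerD(1)[OF G] by (intro tower_linear[OF G bounded_linear_mult_right]) (auto simp: vanishes_off_def)
    show "0 \<le> 1 / I * G 0 t" for t using Gnn \<open>I \<ge> 0\<close> by simp
    show "(LINT t|lborel. 1 / I * G 0 t) = 1" using \<open>I \<noteq> 0\<close> by (simp add: I_def)
  qed
  then show ?thesis by blast
qed

text \<open>The antiderivative S of a bump of radius 1/16 is a smooth step from 0 to 1. In S(t +
  3/16) S(3/16 - t) both factors are 1 for |t| <= 1/8, and one of them vanishes for |t| >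
  1/4.\<close>

lemma plateau_exists:
  "\<exists>D :: nat \<Rightarrow> real \<Rightarrow> complex. tower (vanishes_off (1/4)) D \<and> (\<forall>t. \<bar>t\<bar> \<le> 1/8 \<longrightarrow> D 0 t = 1)"
proof -
  obtain b where b: "is_bump (1/16) b" using bump_exists[of "1/16"] by auto
  have bt: "tower (vanishes_off (1/16)) b" using b by (simp add: is_bump_def)
  have b0: "b k t = 0" if "\<bar>t\<bar> > 1/16" for k t
    using towerD(1)[OF bt] that by (auto simp: vanishes_off_def)
  have int: "integrable lborel (b 0)"
    by (rule compact_integrable[OF tower_continuous[OF bt] towerD(1)[OF bt]])
  define S where "S t = (LINT s|lborel. indicator {..t} s *\<^sub>R b 0 s)" for t
  \<comment> \<open>The bump vanishes below -1/16, so a finite lower limit is harmless and the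
    fundamental theorem on an interval becomes available.\<close>
  have Sdiff: "S t = integral {-c..t} (b 0)" if "c \<ge> 1/16" "t \<ge> -c" for c t
  proof -
    have "S t = (LINT s:{-c..t}|lborel. b 0 s)"
      unfolding S_def set_lebesgue_integral_def
    proof (rule Bochner_Integration.integral_cong[OF refl])
      fix s
      have "s < -c \<Longrightarrow> b 0 s = 0" by (rule b0) (use that in linarith)
      then show "indicator {..t} s *\<^sub>R b 0 s = indicator {-c..t} s *\<^sub>R b 0 s"
        by (auto simp: indicator_def)
    qed
    also have "\<dots> = integral {-c..t} (b 0)"
    proof (rule set_borel_integral_eq_integral(2))
      show "set_integrable lborel {-c..t} (b 0)"
        unfolding set_integrable_def using int by (intro integrable_mult_indicator) auto
    qed
    finally show ?thesis .
  qed
  have Sd: "(S has_vector_derivative b 0 t) (at t)" for t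
  proof -
    \<comment> \<open>The margin 1 makes t an interior point of the interval and keeps the support
      to the right of -c.\<close>
    define c where "c = \<bar>t\<bar> + 1"
    have "((\<lambda>u. integral {-c..u} (b 0)) has_vector_derivative b 0 t) (at t within {-c..c})"
      by (rule integral_has_vector_derivative) (auto simp: c_def intro: tower_continuous[OF bt])
    then have "((\<lambda>u. integral {-c..u} (b 0)) has_vector_derivative b 0 t) (at t within {-c<..<c})"
      by (rule has_vector_derivative_within_subset) auto
    then have "((\<lambda>u. integral {-c..u} (b 0)) has_vector_derivative b 0 t) (at t)"
      by (subst (asm) has_vector_derivative_within_open) (auto simp: c_def)
    then show ?thesis
      by (rule has_vector_derivative_transform_within_open[where S="{-c<..<c}"])
         (use Sdiff[of c] in \<open>auto simp: c_def\<close>)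
  qed
  have S0: "S t = 0" if "t < -(1/16)" for t
  proof -
    have "b 0 s = 0" if "s \<le> t" for s by (rule b0) (use that \<open>t < -(1/16)\<close> in linarith)
    then have "(\<lambda>s. indicator {..t} s *\<^sub>R b 0 s) = (\<lambda>s. 0)" by (auto simp: indicator_def)
    then show ?thesis by (simp add: S_def)
  qed
  have S1: "S t = 1" if "t \<ge> 1/16" for t
  proof -
    have "S t = (LINT s|lborel. b 0 s)"
      unfolding S_def
    proof (rule Bochner_Integration.integral_cong[OF refl])
      fix s
      have "t < s \<Longrightarrow> b 0 s = 0" by (rule b0) (use that in linarith)
      then show "indicator {..t} s *\<^sub>R b 0 s = b 0 s"
        by (auto simp: indicator_def)
    qed
    then show ?thesis using b by (simp add: is_bump_def)
  qed
  \<comment> \<open>Prepending the antiderivative shifts the tower of the bump by one place.\<close>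
  define F where "F k = (case k of 0 \<Rightarrow> S | Suc k \<Rightarrow> b k)" for k
  have F: "tower (\<lambda>u. \<forall>t< -(1/16). u t = 0) F"
    by (rule towerI) (auto simp: F_def S0 b0 Sd towerD(2)[OF bt] split: nat.splits)
  have Fz: "F k t = 0" if "t < -(1/16)" for k t using towerD(1)[OF F] that by blast
  have A: "tower (\<lambda>u. \<forall>t< -(1/4). u t = 0) (\<lambda>k t. 1 ^ k *\<^sub>R F k (1 * t + 3/16))"
    by (rule tower_affine[OF F]) (auto intro!: Fz)
  have B: "tower (\<lambda>u. \<forall>t>1/4. u t = 0) (\<lambda>k t. (-1) ^ k *\<^sub>R F k ((-1) * t + 3/16))"
    by (rule tower_affine[OF F]) (auto intro!: Fz)
  define G where "G = (\<lambda>k. leibniz (\<lambda>k t. 1 ^ k *\<^sub>R F k (1 * t + 3/16)) (\<lambda>k t. (-1) ^ k *\<^sub>R F k ((-1) * t + 3/16)) k 0 0)"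
  have G: "tower (vanishes_off (1/4)) G"
    unfolding G_def by (rule tower_mult[OF A B]) (auto simp: vanishes_off_def abs_real_def split: if_splits)
  have G1: "G 0 t = 1" if "\<bar>t\<bar> \<le> 1/8" for t
    using that by (simp add: G_def F_def S1)
  have "tower (vanishes_off (1/4)) (\<lambda>k t. complex_of_real (G k t))"
    using towerD(1)[OF G] by (intro tower_linear[OF G bounded_linear_of_real]) (auto simp: vanishes_off_def)
  then show ?thesis using G1 by (intro exI[of _ "\<lambda>k t. complex_of_real (G k t)"]) auto
qed

lemma integrable_mult_bounded:
  fixes u v :: "'a \<Rightarrow> 'b::{real_normed_algebra, second_countable_topology, banach}"
  assumes "integrable M u" "v \<in> borel_measurable M" "\<And>x. norm (v x) \<le> C"
  shows "integrable M (\<lambda>x. u x * v x)"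
proof (rule Bochner_Integration.integrable_bound)
  show "integrable M (\<lambda>x. C * norm (u x))" using assms(1) by auto
  show "(\<lambda>x. u x * v x) \<in> borel_measurable M" using assms by auto
  have "C \<ge> 0" using assms(3) norm_ge_zero order_trans by blast
  then show "AE x in M. norm (u x * v x) \<le> norm (C * norm (u x))"
    using assms(3) by (auto intro!: AE_I2 order_trans[OF norm_mult_ineq] simp: mult.commute[of C] mult_left_mono)
qed

section \<open>Fourier inversion on the real line\<close>

lemma cis_measurable [measurable]: "cis \<in> borel_measurable borel"
  by (intro borel_measurable_continuous_onI continuous_on_cis continuous_on_id)

text \<open>The integrand is dominated by the product of the two integrable moduli. The kernels in
  question are complex exponentials, of modulus 1.\<close>

lemma Fubini_kernel:
  fixes u v :: "real \<Rightarrow> complex" and K :: "real \<Rightarrow> real \<Rightarrow> complex"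
  assumes u: "integrable lborel u" and v: "integrable lborel v"
    and K: "(\<lambda>(x, y). K x y) \<in> borel_measurable (borel \<Otimes>\<^sub>M borel)" "\<And>x y. norm (K x y) \<le> 1"
  shows "(LINT y|lborel. LINT x|lborel. u x * (v y * K x y)) = (LINT x|lborel. u x * (LINT y|lborel. v y * K x y))"
proof -
  note [measurable] = borel_measurable_integrable[OF u] borel_measurable_integrable[OF v] K(1)
  have K1: "K x \<in> borel_measurable borel" for x
    using measurable_compose[OF measurable_Pair1' K(1), of x] by simp
  have Kl: "(\<lambda>(x, y). K x y) \<in> borel_measurable (lborel \<Otimes>\<^sub>M lborel)"
    using K(1) by (simp cong: measurable_cong_sets sets_pair_measure_cong)
  have iv: "integrable lborel (\<lambda>y. v y * K x y)" for x
    by (rule integrable_mult_bounded[OF v _ K(2)]) (use K1 in simp)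
  have m: "(\<lambda>(x, y). u x * (v y * K x y)) \<in> borel_measurable (lborel \<Otimes>\<^sub>M lborel)"
    using Kl by (auto simp: split_beta)
  have "integrable (lborel \<Otimes>\<^sub>M lborel) (\<lambda>(x, y). u x * (v y * K x y))"
  proof (rule lborel_pair.Fubini_integrable[OF m])
    have "integrable lborel (\<lambda>x. norm (u x) * (LINT y|lborel. norm (v y)))" using u by auto
    then show "integrable lborel (\<lambda>x. LINT y|lborel. norm (case (x, y) of (x, y) \<Rightarrow> u x * (v y * K x y)))"
    proof (rule Bochner_Integration.integrable_bound)
      show "(\<lambda>x. LINT y|lborel. norm (case (x, y) of (x, y) \<Rightarrow> u x * (v y * K x y))) \<in> borel_measurable lborel"
        using m by (intro lborel.borel_measurable_lebesgue_integral) (auto simp: split_beta)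
      have le: "(LINT y|lborel. norm (u x) * (norm (v y) * norm (K x y))) \<le> norm (u x) * (LINT y|lborel. norm (v y))" for x
      proof -
        have "(LINT y|lborel. norm (u x) * (norm (v y) * norm (K x y))) \<le> (LINT y|lborel. norm (u x) * norm (v y))"
        proof (rule integral_mono)
          show "integrable lborel (\<lambda>y. norm (u x) * (norm (v y) * norm (K x y)))"
            using integrable_norm[OF iv[of x]] by (simp add: norm_mult)
          show "integrable lborel (\<lambda>y. norm (u x) * norm (v y))" using v by simp
          show "norm (u x) * (norm (v y) * norm (K x y)) \<le> norm (u x) * norm (v y)" for y
            by (intro mult_left_mono mult_left_le K(2)) auto
        qed
        then show ?thesis by simp
      qed
      then show "AE x in lborel. norm (LINT y|lborel. norm (case (x, y) of (x, y) \<Rightarrow> u x * (v y * K x y)))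
            \<le> norm (norm (u x) * (LINT y|lborel. norm (v y)))"
        by (intro AE_I2) (simp add: norm_mult abs_mult)
    qed
    show "AE x in lborel. integrable lborel (\<lambda>y. case (x, y) of (x, y) \<Rightarrow> u x * (v y * K x y))"
      using iv by auto
  qed
  from lborel_pair.Fubini_integral[OF this] show ?thesis by simp
qed

text \<open>The sign convention is that of \<open>inv_fourier\<close>; the forward transform is
  obtained by reflecting the argument.\<close>

definition ift :: "(real \<Rightarrow> complex) \<Rightarrow> real \<Rightarrow> complex" where
  "ift u x = (LINT t|lborel. u t * cis (2 * pi * (x * t)))"

lemma ift_integrand: "integrable lborel u \<Longrightarrow> integrable lborel (\<lambda>t. u t * cis (2 * pi * (x * t)))"
  by (rule integrable_mult_bounded[where C=1]) auto

lemma ift_measurable: "u \<in> borel_measurable borel \<Longrightarrow> ift u \<in> borel_measurable borel"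
  unfolding ift_def by (rule lborel.borel_measurable_lebesgue_integral) auto

lemma ift_bound: "integrable lborel u \<Longrightarrow> norm (ift u x) \<le> (LINT t|lborel. norm (u t))"
  unfolding ift_def
  by (rule order_trans[OF integral_norm_bound]) (simp add: norm_mult)

text \<open>After the substitution x = y / \<epsilon> the integral is the characteristic function of
  the standard normal distribution.\<close>

lemma gauss_ift:
  assumes "\<epsilon> > 0"
  shows "ift (\<lambda>x. exp (- ((\<epsilon> * x)\<^sup>2 / 2))) a = sqrt (2 * pi) / \<epsilon> * exp (- ((2 * pi * a / \<epsilon>)\<^sup>2 / 2))"
proof -
  have "ift (\<lambda>x. exp (- ((\<epsilon> * x)\<^sup>2 / 2))) a
      = (1 / \<epsilon>) *\<^sub>R (LINT y|lborel. exp (- ((\<epsilon> * (0 + 1 / \<epsilon> * y))\<^sup>2 / 2)) * cis (2 * pi * (a * (0 + 1 / \<epsilon> * y))))"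
    unfolding ift_def using assms by (subst lborel_integral_real_affine[where c="1/\<epsilon>" and t=0]) auto
  also have "(LINT y|lborel. exp (- ((\<epsilon> * (0 + 1 / \<epsilon> * y))\<^sup>2 / 2)) * cis (2 * pi * (a * (0 + 1 / \<epsilon> * y))))
      = (LINT y|lborel. sqrt (2 * pi) * (std_normal_density y *\<^sub>R iexp (2 * pi * a / \<epsilon> * y)))"
    using assms by (intro Bochner_Integration.integral_cong) (auto simp: std_normal_density_def cis_conv_exp scaleR_conv_of_real field_simps)
  also have "\<dots> = sqrt (2 * pi) * (LINT y|lborel. std_normal_density y *\<^sub>R iexp (2 * pi * a / \<epsilon> * y))"
    by (rule integral_mult_right_zero)
  also have "(LINT y|lborel. std_normal_density y *\<^sub>R iexp (2 * pi * a / \<epsilon> * y)) = char std_normal_distribution (2 * pi * a / \<epsilon>)"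
    unfolding char_def by (subst integral_density) (auto simp: normal_density_nonneg)
  finally show ?thesis by (simp add: char_std_normal_distribution scaleR_conv_of_real)
qed

lemma gauss_integrable:
  assumes "\<epsilon> > 0"
  shows "integrable lborel (\<lambda>x. complex_of_real (exp (- ((\<epsilon> * x)\<^sup>2 / 2))))"
proof -
  have "integrable lborel (\<lambda>x. sqrt (2 * pi) * std_normal_density (0 + \<epsilon> * x))"
    using assms lborel_integrable_real_affine[of std_normal_density \<epsilon> 0] integrable_normal_density[of 1 0] by auto
  then have "integrable lborel (\<lambda>x. exp (- ((\<epsilon> * x)\<^sup>2 / 2)))"
    by (simp add: std_normal_density_def)
  then show ?thesis by auto
qed

text \<open>The Gaussian factor makes Fubini applicable and moves the transform from
  \<open>u\<close> to the Gaussian, where it is explicit. The result is the mean of \<open>u\<close>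
  around \<xi> at Gaussian scale \<epsilon> / (2 pi).\<close>

lemma gauss_multiplication:
  assumes u: "integrable lborel u" and "\<epsilon> > 0"
  shows "(LINT x|lborel. ift u x * cis (- 2 * pi * (x * \<xi>)) * exp (- ((\<epsilon> * x)\<^sup>2 / 2)))
       = (LINT y|lborel. std_normal_density y *\<^sub>R u (\<xi> + \<epsilon> / (2 * pi) * y))"
proof -
  let ?g = "\<lambda>x. complex_of_real (exp (- ((\<epsilon> * x)\<^sup>2 / 2)))"
  let ?K = "\<lambda>\<eta> x. cis (2 * pi * (x * (\<eta> - \<xi>)))"
  have "(LINT x|lborel. ift u x * cis (- 2 * pi * (x * \<xi>)) * ?g x)
      = (LINT x|lborel. LINT \<eta>|lborel. u \<eta> * (?g x * ?K \<eta> x))"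
  proof (rule Bochner_Integration.integral_cong[OF refl])
    fix x
    have "ift u x * cis (- 2 * pi * (x * \<xi>)) * ?g x
        = (LINT \<eta>|lborel. u \<eta> * cis (2 * pi * (x * \<eta>)) * (cis (- 2 * pi * (x * \<xi>)) * ?g x))"
      unfolding ift_def mult.assoc[of "integral\<^sup>L _ _"] by (rule integral_mult_left_zero[symmetric])
    also have "\<dots> = (LINT \<eta>|lborel. u \<eta> * (?g x * ?K \<eta> x))"
    proof (rule Bochner_Integration.integral_cong[OF refl])
      fix \<eta>
      have "cis (2 * pi * (x * \<eta>)) * cis (- 2 * pi * (x * \<xi>)) = ?K \<eta> x"
        by (simp add: cis_mult algebra_simps)
      then show "u \<eta> * cis (2 * pi * (x * \<eta>)) * (cis (- 2 * pi * (x * \<xi>)) * ?g x) = u \<eta> * (?g x * ?K \<eta> x)"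
      proof -
        assume *: "cis (2 * pi * (x * \<eta>)) * cis (- 2 * pi * (x * \<xi>)) = ?K \<eta> x"
        have "u \<eta> * cis (2 * pi * (x * \<eta>)) * (cis (- 2 * pi * (x * \<xi>)) * ?g x)
            = u \<eta> * (?g x * (cis (2 * pi * (x * \<eta>)) * cis (- 2 * pi * (x * \<xi>))))"
          by (simp only: mult_ac)
        then show ?thesis unfolding * .
      qed
    qed
    finally show "ift u x * cis (- 2 * pi * (x * \<xi>)) * ?g x = (LINT \<eta>|lborel. u \<eta> * (?g x * ?K \<eta> x))" .
  qed
  also have "\<dots> = (LINT \<eta>|lborel. u \<eta> * (LINT x|lborel. ?g x * ?K \<eta> x))"
  proof (rule Fubini_kernel[OF u gauss_integrable[OF assms(2)]])
    show "(\<lambda>(\<eta>, x). ?K \<eta> x) \<in> borel_measurable (borel \<Otimes>\<^sub>M borel)" by measurable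
  qed simp
  also have "\<dots> = (LINT \<eta>|lborel. u \<eta> * (sqrt (2 * pi) / \<epsilon> * exp (- ((2 * pi * (\<eta> - \<xi>) / \<epsilon>)\<^sup>2 / 2))))"
    using gauss_ift[OF assms(2)] by (simp add: ift_def mult.commute[of _ "_ - \<xi>"])
  also have "\<dots> = (\<epsilon> / (2 * pi)) *\<^sub>R (LINT y|lborel. u (\<xi> + \<epsilon> / (2 * pi) * y) *
      (sqrt (2 * pi) / \<epsilon> * exp (- ((2 * pi * ((\<xi> + \<epsilon> / (2 * pi) * y) - \<xi>) / \<epsilon>)\<^sup>2 / 2))))"
    using assms(2) by (subst lborel_integral_real_affine[where c="\<epsilon> / (2 * pi)" and t=\<xi>]) auto
  also have "\<dots> = (LINT y|lborel. (\<epsilon> / (2 * pi)) *\<^sub>R (u (\<xi> + \<epsilon> / (2 * pi) * y) *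
      (sqrt (2 * pi) / \<epsilon> * exp (- ((2 * pi * ((\<xi> + \<epsilon> / (2 * pi) * y) - \<xi>) / \<epsilon>)\<^sup>2 / 2)))))"
    by simp
  also have "\<dots> = (LINT y|lborel. std_normal_density y *\<^sub>R u (\<xi> + \<epsilon> / (2 * pi) * y))"
  proof (rule Bochner_Integration.integral_cong[OF refl])
    fix y
    have 1: "2 * pi * ((\<xi> + \<epsilon> / (2 * pi) * y) - \<xi>) / \<epsilon> = y" using assms(2) by simp
    \<comment> \<open>The Jacobian of the substitution times the constant of
      \<open>gauss_ift\<close> is the constant of the normal density.\<close>
    have "\<epsilon> / (2 * pi) * (sqrt (2 * pi) / \<epsilon>) = sqrt (2 * pi) / (2 * pi)" using assms(2) by simp
    also have "\<dots> = 1 / sqrt (2 * pi)"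
    proof -
      have "sqrt (2 * pi) * sqrt (2 * pi) = 1 * (2 * pi)" by (subst real_sqrt_mult_self) simp
      then show ?thesis by (subst frac_eq_eq) auto
    qed
    finally have 2: "\<epsilon> / (2 * pi) * (sqrt (2 * pi) / \<epsilon>) = 1 / sqrt (2 * pi)" .
    have "(\<epsilon> / (2 * pi)) *\<^sub>R (u (\<xi> + \<epsilon> / (2 * pi) * y) * (sqrt (2 * pi) / \<epsilon> * exp (- (y\<^sup>2 / 2))))
        = (\<epsilon> / (2 * pi) * (sqrt (2 * pi) / \<epsilon>) * exp (- (y\<^sup>2 / 2))) *\<^sub>R u (\<xi> + \<epsilon> / (2 * pi) * y)"
      by (simp add: scaleR_conv_of_real)
    also have "\<dots> = std_normal_density y *\<^sub>R u (\<xi> + \<epsilon> / (2 * pi) * y)"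
      unfolding 2 by (simp add: std_normal_density_def)
    finally show "(\<epsilon> / (2 * pi)) *\<^sub>R (u (\<xi> + \<epsilon> / (2 * pi) * y) *
      (sqrt (2 * pi) / \<epsilon> * exp (- ((2 * pi * ((\<xi> + \<epsilon> / (2 * pi) * y) - \<xi>) / \<epsilon>)\<^sup>2 / 2))))
      = std_normal_density y *\<^sub>R u (\<xi> + \<epsilon> / (2 * pi) * y)" unfolding 1 .
  qed
  finally show ?thesis .
qed

text \<open>Let the Gaussian width tend to 0 in \<open>gauss_multiplication\<close>. The left side
  is dominated by \<open>norm (ift u x)\<close>, the right side by C times the normal density, where
  continuity of \<open>u\<close> gives the pointwise limit.\<close>

theorem ift_inversion:
  assumes cont: "continuous_on UNIV u" and bdd: "\<And>t. norm (u t) \<le> C"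
    and u: "integrable lborel u" and U: "integrable lborel (ift u)"
  shows "ift (ift u) (- \<xi>) = u \<xi>"
proof -
  let ?\<epsilon> = "\<lambda>k. inverse (real (Suc k))"
  have um[measurable]: "u \<in> borel_measurable borel" using u by auto
  have Um[measurable]: "ift u \<in> borel_measurable borel" using U by auto
  have "(\<lambda>k. LINT x|lborel. ift u x * cis (- 2 * pi * (x * \<xi>)) * exp (- ((?\<epsilon> k * x)\<^sup>2 / 2)))
      \<longlonglongrightarrow> (LINT x|lborel. ift u x * cis (- 2 * pi * (x * \<xi>)))"
  proof (rule integral_dominated_convergence[where w="\<lambda>x. norm (ift u x)"])
    show "AE x in lborel. (\<lambda>k. ift u x * cis (- 2 * pi * (x * \<xi>)) * complex_of_real (exp (- ((?\<epsilon> k * x)\<^sup>2 / 2))))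
        \<longlonglongrightarrow> ift u x * cis (- 2 * pi * (x * \<xi>))"
    proof (rule AE_I2)
      fix x
      have "(\<lambda>k. ift u x * cis (- 2 * pi * (x * \<xi>)) * complex_of_real (exp (- ((?\<epsilon> k * x)\<^sup>2 / 2))))
        \<longlonglongrightarrow> ift u x * cis (- 2 * pi * (x * \<xi>)) * complex_of_real (exp (- ((0 * x)\<^sup>2 / 2)))"
        by (intro tendsto_intros LIMSEQ_inverse_real_of_nat) auto
      then show "(\<lambda>k. ift u x * cis (- 2 * pi * (x * \<xi>)) * complex_of_real (exp (- ((?\<epsilon> k * x)\<^sup>2 / 2))))
        \<longlonglongrightarrow> ift u x * cis (- 2 * pi * (x * \<xi>))" by simp
    qed
  qed (use U in \<open>auto simp: norm_mult mult_left_le\<close>)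
  moreover have "(\<lambda>k. LINT y|lborel. std_normal_density y *\<^sub>R u (\<xi> + ?\<epsilon> k / (2 * pi) * y))
      \<longlonglongrightarrow> (LINT y|lborel. std_normal_density y *\<^sub>R u \<xi>)"
  proof (rule integral_dominated_convergence[where w="\<lambda>y. std_normal_density y * C"])
    show "AE y in lborel. (\<lambda>k. std_normal_density y *\<^sub>R u (\<xi> + ?\<epsilon> k / (2 * pi) * y)) \<longlonglongrightarrow> std_normal_density y *\<^sub>R u \<xi>"
    proof (rule AE_I2)
      fix y
      have "(\<lambda>k. \<xi> + ?\<epsilon> k / (2 * pi) * y) \<longlonglongrightarrow> \<xi> + 0 / (2 * pi) * y"
        by (intro tendsto_intros LIMSEQ_inverse_real_of_nat) auto
      then have "(\<lambda>k. u (\<xi> + ?\<epsilon> k / (2 * pi) * y)) \<longlonglongrightarrow> u \<xi>"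
        using cont by (intro isCont_tendsto_compose[of _ u]) (auto simp: continuous_on_eq_continuous_at)
      then show "(\<lambda>k. std_normal_density y *\<^sub>R u (\<xi> + ?\<epsilon> k / (2 * pi) * y)) \<longlonglongrightarrow> std_normal_density y *\<^sub>R u \<xi>"
        by (intro tendsto_intros)
    qed
  qed (auto simp: normal_density_nonneg bdd mult_left_mono)
  moreover have "(LINT y|lborel. std_normal_density y *\<^sub>R u \<xi>) = u \<xi>" by simp
  moreover have "(LINT x|lborel. ift u x * cis (- 2 * pi * (x * \<xi>)) * exp (- ((?\<epsilon> k * x)\<^sup>2 / 2)))
      = (LINT y|lborel. std_normal_density y *\<^sub>R u (\<xi> + ?\<epsilon> k / (2 * pi) * y))" for k
    by (rule gauss_multiplication[OF u]) simp
  ultimately have "(LINT x|lborel. ift u x * cis (- 2 * pi * (x * \<xi>))) = u \<xi>"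
    by (auto dest: LIMSEQ_unique)
  then show ?thesis by (simp add: ift_def[of "ift u"] mult.commute mult.left_commute)
qed

section \<open>A nonnegative band-limited window\<close>

text \<open>Decay of a single function only; the one-dimensional Schwartz class is expressed by
  \<open>tower rapid\<close>.\<close>

definition rapid :: "(real \<Rightarrow> complex) \<Rightarrow> bool" where
  "rapid u \<longleftrightarrow> (\<forall>N. \<exists>C. \<forall>t. (1 + \<bar>t\<bar>) ^ N * norm (u t) \<le> C)"

lemma rapid_add: "rapid u \<Longrightarrow> rapid v \<Longrightarrow> rapid (\<lambda>t. u t + v t)"
  unfolding rapid_def
proof
  fix N assume "\<forall>N. \<exists>C. \<forall>t. (1 + \<bar>t\<bar>) ^ N * norm (u t) \<le> C" "\<forall>N. \<exists>C. \<forall>t. (1 + \<bar>t\<bar>) ^ N * norm (v t) \<le> C"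
  then obtain C D where C: "\<And>t. (1 + \<bar>t\<bar>) ^ N * norm (u t) \<le> C" and D: "\<And>t. (1 + \<bar>t\<bar>) ^ N * norm (v t) \<le> D"
    by metis
  have "(1 + \<bar>t\<bar>) ^ N * norm (u t + v t) \<le> C + D" for t
  proof -
    have "(1 + \<bar>t\<bar>) ^ N * norm (u t + v t) \<le> (1 + \<bar>t\<bar>) ^ N * (norm (u t) + norm (v t))"
      by (intro mult_left_mono norm_triangle_ineq) auto
    then show ?thesis using C[of t] D[of t] by (simp add: distrib_left)
  qed
  then show "\<exists>C. \<forall>t. (1 + \<bar>t\<bar>) ^ N * norm (u t + v t) \<le> C" by blast
qed

lemma rapid_mult_bounded:
  assumes "rapid u" "\<And>t. norm (v t) \<le> B"
  shows "rapid (\<lambda>t. u t * v t)"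
  unfolding rapid_def
proof
  fix N
  obtain C where C: "\<And>t. (1 + \<bar>t\<bar>) ^ N * norm (u t) \<le> C" using assms(1) by (auto simp: rapid_def)
  have "(1 + \<bar>t\<bar>) ^ N * norm (u t * v t) \<le> C * B" for t
  proof -
    have "0 \<le> (1 + \<bar>t\<bar>) ^ N * norm (u t)" by simp
    then have "C \<ge> 0" using C[of t] by linarith
    have "(1 + \<bar>t\<bar>) ^ N * norm (u t) * norm (v t) \<le> C * B"
      by (rule mult_mono[OF C assms(2) \<open>C \<ge> 0\<close>]) simp
    then show ?thesis by (simp add: norm_mult mult.assoc)
  qed
  then show "\<exists>C. \<forall>t. (1 + \<bar>t\<bar>) ^ N * norm (u t * v t) \<le> C" by blast
qed

lemma rapid_bounded:
  assumes "rapid u" obtains C where "\<And>t. norm (u t) \<le> C"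
  using assms unfolding rapid_def by (metis mult_1 power_0)

lemma rapid_integrable:
  assumes "rapid u" "u \<in> borel_measurable borel"
  shows "integrable lborel u"
proof -
  obtain C where C: "\<And>t. (1 + \<bar>t\<bar>) ^ 2 * norm (u t) \<le> C" using assms by (auto simp: rapid_def)
  have 1: "integrable lborel (\<lambda>x::real. C * inverse (1 + x\<^sup>2))"
    using integrable_inverse_1_plus_square by (simp add: set_integrable_def)
  show ?thesis
  proof (rule Bochner_Integration.integrable_bound[OF 1])
    show "AE x in lborel. norm (u x) \<le> norm (C * inverse (1 + x\<^sup>2))"
    proof (rule AE_I2)
      fix x :: real
      have "(1 + x\<^sup>2) * norm (u x) \<le> (1 + \<bar>x\<bar>) ^ 2 * norm (u x)"
        by (rule mult_right_mono) (auto simp: power2_eq_square algebra_simps)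
      then have "norm (u x) * (1 + x\<^sup>2) \<le> C" using C[of x] by (simp add: mult.commute)
      then have "norm (u x) \<le> C / (1 + x\<^sup>2)"
        by (subst pos_le_divide_eq) (auto intro: add_pos_nonneg)
      then show "norm (u x) \<le> norm (C * inverse (1 + x\<^sup>2))"
        by (simp add: divide_inverse)
    qed
  qed (use assms in auto)
qed

section \<open>Smoothness and decay of transforms of test functions\<close>

lemma cis_linear_deriv: "((\<lambda>x. cis (a * x)) has_vector_derivative \<i> * a * cis (a * x)) (at x)"
proof -
  have "((\<lambda>x. exp (\<i> * a * complex_of_real x)) has_vector_derivative \<i> * a * exp (\<i> * a * complex_of_real x)) (at x)"
    by (rule has_vector_derivative_real_field) (auto intro!: derivative_eq_intros)
  then show ?thesis by (simp add: cis_conv_exp mult.assoc)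
qed

text \<open>Compact support turns the transform into an integral over a fixed interval, where
  differentiation under the integral sign applies.\<close>

lemma ift_has_vector_derivative:
  assumes cont: "continuous_on UNIV u" and off: "vanishes_off c u"
  shows "(ift u has_vector_derivative ift (\<lambda>t. (2 * pi * \<i> * t) * u t) x) (at x)"
proof -
  have eq: "ift v x = integral (cbox (-c) c) (\<lambda>t. v t * cis (2 * pi * (x * t)))"
    if v: "continuous_on UNIV v" "vanishes_off c v" for v x
  proof -
    have "continuous_on UNIV (\<lambda>t. v t * cis (2 * pi * (x * t)))"
      using v by (intro continuous_intros continuous_on_cis) auto
    then have "set_integrable lborel (cbox (-c) c) (\<lambda>t. v t * cis (2 * pi * (x * t)))"
      unfolding set_integrable_def
      by (intro borel_integrable_compact) (auto intro: continuous_on_subset)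
    note set_borel_integral_eq_integral(2)[OF this]
    moreover have "ift v x = (LINT t:cbox (-c) c|lborel. v t * cis (2 * pi * (x * t)))"
      unfolding ift_def set_lebesgue_integral_def
      by (rule Bochner_Integration.integral_cong) (use v(2) in \<open>force simp: vanishes_off_def indicator_def\<close>)+
    ultimately show ?thesis by simp
  qed
  have u': "continuous_on UNIV (\<lambda>t. (2 * pi * \<i> * t) * u t)" "vanishes_off c (\<lambda>t. (2 * pi * \<i> * t) * u t)"
    using assms by (auto intro!: continuous_intros simp: vanishes_off_def)
  have "((\<lambda>x. integral (cbox (-c) c) (\<lambda>t. u t * cis (2 * pi * (x * t)))) has_vector_derivative
     integral (cbox (-c) c) (\<lambda>t. (2 * pi * \<i> * t) * u t * cis (2 * pi * (x * t)))) (at x within UNIV)"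
  proof (rule leibniz_rule_vector_derivative)
    fix x t :: real
    have "((\<lambda>x. u t * cis (2 * pi * t * x)) has_vector_derivative u t * (\<i> * (2 * pi * t) * cis (2 * pi * t * x))) (at x)"
      using cis_linear_deriv[of "2 * pi * t" x] by (intro has_vector_derivative_mult_right) simp
    then show "((\<lambda>x. u t * cis (2 * pi * (x * t))) has_vector_derivative (2 * pi * \<i> * t) * u t * cis (2 * pi * (x * t))) (at x within UNIV)"
      by (simp add: mult_ac)
    show "(\<lambda>t. u t * cis (2 * pi * (x * t))) integrable_on cbox (- c) c"
      by (intro integrable_continuous continuous_intros continuous_on_cis continuous_on_subset[OF cont]) auto
  next
    show "continuous_on (UNIV \<times> cbox (- c) c) (\<lambda>(x, t). (2 * pi * \<i> * t) * u t * cis (2 * pi * (x * t)))"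
      unfolding split_beta
      by (intro continuous_intros continuous_on_cis continuous_on_compose2[OF cont]) auto
  qed auto
  then show ?thesis
    unfolding eq[OF u', symmetric] eq[OF assms, symmetric] .
qed

lemma integral_deriv_zero:
  fixes F F' :: "real \<Rightarrow> complex"
  assumes "\<And>t. (F has_vector_derivative F' t) (at t)" "continuous_on UNIV F'"
    and "vanishes_off c F" "vanishes_off c F'"
  shows "(LINT t|lborel. F' t) = 0"
proof -
  let ?d = "\<bar>c\<bar> + 1"
  have "(LINT t|lborel. indicator {-?d..?d} t *\<^sub>R F' t) = F ?d - F (- ?d)"
    by (rule integral_FTC_Icc) (use assms in \<open>auto intro: has_vector_derivative_at_within continuous_on_subset\<close>)
  also have "\<dots> = 0" using assms(3) by (auto simp: vanishes_off_def)
  also have "(\<lambda>t. indicator {-?d..?d} t *\<^sub>R F' t) = F'"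
    using assms(4) by (force simp: vanishes_off_def indicator_def fun_eq_iff)
  finally show ?thesis .
qed

text \<open>Integration by parts: the derivative of the compactly supported function
  \<open>D k t * cis (2 * pi * (x * t))\<close> integrates to zero.\<close>

lemma ift_parts:
  assumes D: "tower (vanishes_off c) D"
  shows "ift (D (Suc k)) x = - (2 * pi * \<i> * x) * ift (D k) x"
proof -
  let ?e = "\<lambda>t. cis (2 * pi * (x * t))"
  have cont: "continuous_on UNIV (D k)" for k by (rule tower_continuous[OF D])
  have int: "integrable lborel (\<lambda>t. D k t * ?e t)" for k
    by (intro ift_integrand compact_integrable[OF cont towerD(1)[OF D]])
  have e': "(?e has_vector_derivative (2 * pi * \<i> * x) * ?e t) (at t)" for t
    using cis_linear_deriv[of "2 * pi * x" t] by (simp add: mult_ac)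
  have "(LINT t|lborel. D k t * ((2 * pi * \<i> * x) * ?e t) + D (Suc k) t * ?e t) = 0"
  proof (rule integral_deriv_zero[where F="\<lambda>t. D k t * ?e t" and c=c])
    show "((\<lambda>t. D k t * ?e t) has_vector_derivative D k t * ((2 * pi * \<i> * x) * ?e t) + D (Suc k) t * ?e t) (at t)" for t
      by (rule has_vector_derivative_mult[OF towerD(2)[OF D] e'])
    show "continuous_on UNIV (\<lambda>t. D k t * ((2 * pi * \<i> * x) * ?e t) + D (Suc k) t * ?e t)"
      by (intro continuous_intros cont continuous_on_cis)
    show "vanishes_off c (\<lambda>t. D k t * ?e t)" 
      using towerD(1)[OF D, of k] by (auto simp: vanishes_off_def)
    show "vanishes_off c (\<lambda>t. D k t * ((2 * pi * \<i> * x) * ?e t) + D (Suc k) t * ?e t)"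
      using towerD(1)[OF D, of k] towerD(1)[OF D, of "Suc k"] by (auto simp: vanishes_off_def)
  qed
  moreover have "(\<lambda>t. D k t * ((2 * pi * \<i> * x) * ?e t) + D (Suc k) t * ?e t)
      = (\<lambda>t. (2 * pi * \<i> * x) * (D k t * ?e t) + D (Suc k) t * ?e t)"
    by (simp add: fun_eq_iff scaleR_conv_of_real mult_ac)
  moreover have "(LINT t|lborel. (2 * pi * \<i> * x) * (D k t * ?e t) + D (Suc k) t * ?e t)
      = (2 * pi * \<i> * x) * ift (D k) x + ift (D (Suc k)) x"
    unfolding ift_def using int by (subst Bochner_Integration.integral_add) (auto intro!: integrable_mult_right)
  ultimately show ?thesis by (simp add: add_eq_0_iff)
qed

text \<open>Each derivative of the tower yields a factor of modulus 2 pi |x| >= |x|, so every moment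
  of the transform is bounded by an L^1 norm; the binomial theorem assembles the moments into the
  weight (1 + |x|)^N.\<close>

lemma rapid_ift:
  assumes D: "tower (vanishes_off c) D"
  shows "rapid (ift (D 0))"
  unfolding rapid_def
proof
  fix N
  let ?M = "\<lambda>k. LINT t|lborel. norm (D k t)"
  have int: "integrable lborel (D k)" for k
    by (rule compact_integrable[OF tower_continuous[OF D] towerD(1)[OF D]])
  have pow: "ift (D k) x = (- (2 * pi * \<i> * x)) ^ k * ift (D 0) x" for k x
    by (induction k) (simp_all add: ift_parts[OF D])
  have mom: "\<bar>x\<bar> ^ k * norm (ift (D 0) x) \<le> ?M k" for k x
  proof -
    have "\<bar>x\<bar> ^ k \<le> (2 * pi * \<bar>x\<bar>) ^ k"
    proof (rule power_mono)
      have "1 * \<bar>x\<bar> \<le> (2 * pi) * \<bar>x\<bar>"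
        by (rule mult_right_mono) (use pi_ge_two in linarith, simp)
      then show "\<bar>x\<bar> \<le> 2 * pi * \<bar>x\<bar>" by simp
    qed simp
    then have "\<bar>x\<bar> ^ k * norm (ift (D 0) x) \<le> (2 * pi * \<bar>x\<bar>) ^ k * norm (ift (D 0) x)"
      by (rule mult_right_mono) simp
    also have "\<dots> = norm (ift (D k) x)"
      unfolding pow[of k] norm_mult norm_power norm_minus_cancel by simp
    also have "\<dots> \<le> ?M k" by (rule ift_bound[OF int])
    finally show ?thesis .
  qed
  have "(1 + \<bar>x\<bar>) ^ N * norm (ift (D 0) x) \<le> (\<Sum>k\<le>N. of_nat (N choose k) * ?M k)" for x
  proof -
    have "(1 + \<bar>x\<bar>) ^ N = (\<Sum>k\<le>N. of_nat (N choose k) * \<bar>x\<bar> ^ k)"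
      using binomial_ring[of "\<bar>x\<bar>" 1 N] by (simp add: add.commute)
    then have "(1 + \<bar>x\<bar>) ^ N * norm (ift (D 0) x) = (\<Sum>k\<le>N. of_nat (N choose k) * (\<bar>x\<bar> ^ k * norm (ift (D 0) x)))"
      by (simp add: sum_distrib_right mult.assoc)
    also have "\<dots> \<le> (\<Sum>k\<le>N. of_nat (N choose k) * ?M k)"
      by (intro sum_mono mult_left_mono mom) auto
    finally show ?thesis .
  qed
  then show "\<exists>C. \<forall>x. (1 + \<bar>x\<bar>) ^ N * norm (ift (D 0) x) \<le> C" by blast
qed

text \<open>The linear factor has the tower a t, a, 0, 0, ...; this product is what differentiation
  under the transform produces.\<close>

lemma tower_times_id:
  fixes D :: "nat \<Rightarrow> real \<Rightarrow> complex"
  assumes D: "tower (vanishes_off c) D"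
  shows "\<exists>E. tower (vanishes_off c) E \<and> E 0 = (\<lambda>t. a * t * D 0 t)"
proof -
  define L :: "nat \<Rightarrow> real \<Rightarrow> complex" where
    "L k t = (if k = 0 then a * t else if k = 1 then a else 0)" for k t
  have L0: "L 0 = (\<lambda>t. a * t)" "L (Suc k) = (\<lambda>t. if k = 0 then a else 0)" for k
    by (auto simp: fun_eq_iff L_def)
  have L: "tower (\<lambda>_. True) L"
  proof (rule towerI)
    fix k t
    have "((\<lambda>t. a * complex_of_real t) has_vector_derivative a * complex_of_real 1) (at t)"
      by (intro has_vector_derivative_mult_right has_vector_derivative_of_real DERIV_ident)
    then show "(L k has_vector_derivative L (Suc k) t) (at t)"
      by (cases k) (simp_all add: L0)
  qed simp
  have "tower (vanishes_off c) (\<lambda>k. leibniz L D k 0 0)"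
    by (rule tower_mult[OF L D]) (auto simp: vanishes_off_def)
  moreover have "leibniz L D 0 0 0 = (\<lambda>t. a * t * D 0 t)" by (simp add: L_def)
  ultimately show ?thesis by (intro exI conjI)
qed

text \<open>The k-th derivative is the transform of (2 pi i t)^k \<open>D 0 t\<close>. This is again
  the head of a compactly supported tower, so \<open>rapid_ift\<close> applies to every
  derivative.\<close>

lemma ift_tower:
  assumes D: "tower (vanishes_off c) D"
  shows "\<exists>G. tower rapid G \<and> G 0 = ift (D 0)"
proof -
  define u where "u k = (\<lambda>t. (2 * pi * \<i> * complex_of_real t) ^ k * D 0 t)" for k
  have ex: "\<exists>E. tower (vanishes_off c) E \<and> E 0 = u k" for k
  proof (induction k)
    case 0
    show ?case using D by (auto simp: u_def)
  next
    case (Suc k)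
    then obtain E where E: "tower (vanishes_off c) E" "E 0 = u k" by blast
    have "(\<lambda>t. 2 * pi * \<i> * complex_of_real t * E 0 t) = u (Suc k)"
      by (simp add: E(2) u_def mult.assoc)
    then show ?case using tower_times_id[OF E(1), of "2 * pi * \<i>"] by metis
  qed
  have "tower rapid (\<lambda>k. ift (u k))"
  proof (rule towerI)
    fix k t
    from ex[of k] obtain E where E: "tower (vanishes_off c) E" "E 0 = u k" by blast
    show "rapid (ift (u k))" using rapid_ift[OF E(1)] E(2) by simp
    have "(\<lambda>t. 2 * pi * \<i> * complex_of_real t * E 0 t) = u (Suc k)"
      by (simp add: E(2) u_def mult.assoc)
    moreover have "(ift (E 0) has_vector_derivative ift (\<lambda>t. 2 * pi * \<i> * complex_of_real t * E 0 t) t) (at t)"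
      by (rule ift_has_vector_derivative[OF tower_continuous[OF E(1)] towerD(1)[OF E(1)]])
    ultimately show "(ift (u k) has_vector_derivative ift (u (Suc k)) t) (at t)"
      using E(2) by simp
  qed
  moreover have "ift (u 0) = ift (D 0)" by (simp add: u_def)
  ultimately show ?thesis by (intro exI conjI)
qed

text \<open>Nonnegativity lets the window act as a weight, the value 1 at the origin gives a lower
  bound on a small ball, and the spectral radius 1/8 matches the plateau in
  \<open>plateau_exists\<close>.\<close>

definition band_window :: "(nat \<Rightarrow> real \<Rightarrow> complex) \<Rightarrow> bool" where
  "band_window D \<longleftrightarrow> tower rapid D \<and> (\<forall>t. \<exists>r. 0 \<le> r \<and> r \<le> 1 \<and> D 0 t = complex_of_real r) \<and> D 0 0 = 1
     \<and> vanishes_off (1/8) (ift (D 0))"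

text \<open>
  The squared modulus of the inverse transform of a bump is nonnegative, and its spectrum is a
  correlation of the bump with itself, hence still compactly supported.
\<close>
lemma band_window_exists: "\<exists>D. band_window D"
proof -
  obtain b where b: "is_bump (1/16) b" using bump_exists[of "1/16"] by auto
  have bt: "tower (vanishes_off (1/16)) b" using b by (simp add: is_bump_def)
  define \<psi> where "\<psi> = (\<lambda>t. complex_of_real (b 0 t))"
  have pt: "tower (vanishes_off (1/16)) (\<lambda>k t. complex_of_real (b k t))"
    using towerD(1)[OF bt] by (intro tower_linear[OF bt bounded_linear_of_real]) (auto simp: vanishes_off_def)
  have p0: "\<psi> t = 0" if "\<bar>t\<bar> > 1/16" for t
    using towerD(1)[OF pt, of 0] that by (auto simp: vanishes_off_def \<psi>_def)
  have pc: "continuous_on UNIV \<psi>" unfolding \<psi>_def by (rule tower_continuous[OF pt])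
  have pint: "integrable lborel \<psi>"
    by (rule compact_integrable[OF pc, of "1/16"]) (simp add: vanishes_off_def p0)
  obtain G where G: "tower rapid G" "G 0 = ift \<psi>"
    using ift_tower[OF pt] by (auto simp: \<psi>_def)
  have Gm: "G k \<in> borel_measurable borel" for k
    by (rule borel_measurable_continuous_onI[OF tower_continuous[OF G(1)]])
  have Gint: "integrable lborel (ift \<psi>)"
    using rapid_integrable[OF towerD(1)[OF G(1)] Gm, of 0] G(2) by simp
  have pbd: "\<exists>C. \<forall>t. norm (\<psi> t) \<le> C"
  proof -
    have "bounded (\<psi> ` {-1..1})"
      by (intro compact_imp_bounded compact_continuous_image continuous_on_subset[OF pc]) auto
    then obtain C where "\<forall>x\<in>\<psi> ` {-1..1}. norm x \<le> C" unfolding bounded_iff by blast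
    then have C: "\<And>t. t \<in> {-1..1} \<Longrightarrow> norm (\<psi> t) \<le> C" by blast
    have "norm (\<psi> t) \<le> max C 0" for t
    proof (cases "t \<in> {-1..1}")
      case True then show ?thesis using C[of t] by simp
    next
      case False then show ?thesis using p0[of t] by (auto simp: abs_real_def)
    qed
    then show ?thesis by blast
  qed
  then obtain C where C: "\<And>t. norm (\<psi> t) \<le> C" by blast
  have inv: "ift (ift \<psi>) (- \<xi>) = \<psi> \<xi>" for \<xi>
    by (rule ift_inversion[OF pc C pint Gint])
  \<comment> \<open>The unit mass of the bump bounds its transform by 1, with value exactly 1 at the
    origin.\<close>
  have G1: "norm (G 0 t) \<le> 1" for t
  proof -
    have "(LINT t|lborel. norm (\<psi> t)) = 1" using b by (simp add: \<psi>_def is_bump_def)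
    then show ?thesis using ift_bound[OF pint, of t] G(2) by simp
  qed
  have G00: "G 0 0 = 1"
    using b by (simp add: G(2) ift_def \<psi>_def is_bump_def cis_zero)
  have cG: "tower (\<lambda>u. \<exists>B. \<forall>t. norm (u t) \<le> B) (\<lambda>k t. cnj (G k t))"
  proof (rule tower_linear[OF G(1)])
    show "\<exists>B. \<forall>t. norm (cnj (G k t)) \<le> B" for k
      using rapid_bounded[OF towerD(1)[OF G(1), of k]] by auto
  qed (rule bounded_linear_cnj)
  define D where "D = (\<lambda>k. leibniz G (\<lambda>k t. cnj (G k t)) k 0 0)"
  have D: "tower rapid D"
    unfolding D_def by (rule tower_mult[OF G(1) cG]) (auto intro: rapid_mult_bounded rapid_add)
  have D0: "D 0 t = complex_of_real ((norm (G 0 t))\<^sup>2)" for t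
    by (simp add: D_def complex_norm_square[symmetric])
  have Dift: "D 0 t = ift \<psi> t * cnj (ift \<psi> t)" for t
    using G(2) by (simp add: D_def)
  have cnjG: "cnj (ift \<psi> t) = (LINT \<eta>|lborel. \<psi> \<eta> * cis (- 2 * pi * (t * \<eta>)))" for t
  proof -
    have "cnj (ift \<psi> t) = (LINT \<eta>|lborel. cnj (\<psi> \<eta> * cis (2 * pi * (t * \<eta>))))"
      unfolding ift_def by (rule Bochner_Integration.integral_cnj[symmetric])
    also have "\<dots> = (LINT \<eta>|lborel. \<psi> \<eta> * cis (- 2 * pi * (t * \<eta>)))"
      by (rule Bochner_Integration.integral_cong) (auto simp: \<psi>_def cis_cnj)
    finally show ?thesis .
  qed
  \<comment> \<open>Write only the conjugate factor as an integral, exchange the order of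
    integration, and apply inversion to the remaining factor: the result is the correlation of the
    bump with itself.\<close>
  have spec: "ift (D 0) \<xi> = (LINT \<eta>|lborel. \<psi> \<eta> * \<psi> (\<eta> - \<xi>))" for \<xi>
  proof -
    have "ift (D 0) \<xi> = (LINT t|lborel. ift \<psi> t * (LINT \<eta>|lborel. \<psi> \<eta> * cis (2 * pi * (t * (\<xi> - \<eta>)))))"
      unfolding ift_def[of "D 0"]
    proof (rule Bochner_Integration.integral_cong[OF refl])
      fix t
      have "cnj (ift \<psi> t) * cis (2 * pi * (\<xi> * t)) = (LINT \<eta>|lborel. \<psi> \<eta> * cis (- 2 * pi * (t * \<eta>)) * cis (2 * pi * (\<xi> * t)))"
        unfolding cnjG by (rule integral_mult_left_zero[symmetric])
      also have "\<dots> = (LINT \<eta>|lborel. \<psi> \<eta> * cis (2 * pi * (t * (\<xi> - \<eta>))))"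
        by (rule Bochner_Integration.integral_cong) (auto simp: mult.assoc cis_mult algebra_simps)
      finally show "D 0 t * cis (2 * pi * (\<xi> * t)) = ift \<psi> t * (LINT \<eta>|lborel. \<psi> \<eta> * cis (2 * pi * (t * (\<xi> - \<eta>))))"
        by (simp add: Dift mult.assoc)
    qed
    also have "\<dots> = (LINT \<eta>|lborel. LINT t|lborel. ift \<psi> t * (\<psi> \<eta> * cis (2 * pi * (t * (\<xi> - \<eta>)))))"
    proof (rule Fubini_kernel[OF Gint pint, symmetric])
      show "(\<lambda>(t, \<eta>). cis (2 * pi * (t * (\<xi> - \<eta>)))) \<in> borel_measurable (borel \<Otimes>\<^sub>M borel)" by measurable
    qed simp
    also have "\<dots> = (LINT \<eta>|lborel. \<psi> \<eta> * \<psi> (\<eta> - \<xi>))"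
    proof (rule Bochner_Integration.integral_cong[OF refl])
      fix \<eta>
      have "(LINT t|lborel. ift \<psi> t * (\<psi> \<eta> * cis (2 * pi * (t * (\<xi> - \<eta>)))))
          = (LINT t|lborel. \<psi> \<eta> * (ift \<psi> t * cis (2 * pi * (- (\<eta> - \<xi>) * t))))"
        by (rule Bochner_Integration.integral_cong) (auto simp: algebra_simps)
      also have "\<dots> = \<psi> \<eta> * ift (ift \<psi>) (- (\<eta> - \<xi>))"
        unfolding ift_def[of "ift \<psi>"] by (rule integral_mult_right_zero)
      finally show "(LINT t|lborel. ift \<psi> t * (\<psi> \<eta> * cis (2 * pi * (t * (\<xi> - \<eta>))))) = \<psi> \<eta> * \<psi> (\<eta> - \<xi>)"
        by (simp only: inv)
    qed
    finally show ?thesis .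
  qed
  have "vanishes_off (1/8) (ift (D 0))"
    unfolding vanishes_off_def
  proof (intro allI impI)
    fix \<xi> :: real assume "1/8 < \<bar>\<xi>\<bar>"
    \<comment> \<open>Two points of the support of the bump differ by at most 1/8.\<close>
    then have "\<bar>\<eta>\<bar> > 1/16 \<or> \<bar>\<eta> - \<xi>\<bar> > 1/16" for \<eta> by linarith
    then have "\<psi> \<eta> = 0 \<or> \<psi> (\<eta> - \<xi>) = 0" for \<eta>
      using p0[of \<eta>] p0[of "\<eta> - \<xi>"] by blast
    then have "(\<lambda>\<eta>. \<psi> \<eta> * \<psi> (\<eta> - \<xi>)) = (\<lambda>\<eta>. 0)"
      by (auto simp: fun_eq_iff)
    then show "ift (D 0) \<xi> = 0" unfolding spec by (simp only: integral_zero)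
  qed
  moreover have "\<exists>r. 0 \<le> r \<and> r \<le> 1 \<and> D 0 t = complex_of_real r" for t
    using G1[of t] by (intro exI[of _ "(norm (G 0 t))\<^sup>2"]) (auto simp: D0 power_le_one)
  moreover have "D 0 0 = 1" by (simp add: D0 G00)
  ultimately show ?thesis using D unfolding band_window_def by blast
qed

lemma band_window_integrable: "band_window D \<Longrightarrow> integrable lborel (D 0)"
  unfolding band_window_def
  by (metis rapid_integrable towerD(1) borel_measurable_continuous_onI tower_continuous)

lemma band_window_spectrum_integrable:
  assumes "band_window D" shows "integrable lborel (ift (D 0))"
proof -
  have 1: "integrable lborel (\<lambda>x::real. indicator {-1/8..1/8} x * (LINT t|lborel. norm (D 0 t)))" by simp
  show ?thesis
  proof (rule Bochner_Integration.integrable_bound[OF 1])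
    show "ift (D 0) \<in> borel_measurable lborel"
      using ift_measurable[of "D 0"] band_window_integrable[OF assms] by auto
    show "AE x in lborel. norm (ift (D 0) x) \<le> norm (indicator {-1/8..1/8} x * (LINT t|lborel. norm (D 0 t)))"
    proof (rule AE_I2)
      fix x :: real
      show "norm (ift (D 0) x) \<le> norm (indicator {-1/8..1/8} x * (LINT t|lborel. norm (D 0 t)))"
        using ift_bound[OF band_window_integrable[OF assms], of x] assms
        by (auto simp: band_window_def vanishes_off_def indicator_def abs_real_def split: if_splits)
    qed
  qed
qed

lemma band_window_inversion:
  assumes "band_window D" shows "ift (ift (D 0)) (- t) = D 0 t"
proof (rule ift_inversion[where C=1])
  show "continuous_on UNIV (D 0)" using assms by (auto simp: band_window_def intro: tower_continuous)
  show "norm (D 0 t) \<le> 1" for t using assms by (auto simp: band_window_def dest!: spec[of _ t])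
qed (use assms in \<open>auto intro: band_window_integrable band_window_spectrum_integrable\<close>)

section \<open>Partial derivatives and Schwartz functions\<close>

text \<open>Tensor products reduce integrals, transforms and partial derivatives to one variable;
  exponentials x -> exp(2 pi i x . \<xi>) are themselves of this form.\<close>

definition tens :: "('n::finite \<Rightarrow> real \<Rightarrow> complex) \<Rightarrow> 'n vec \<Rightarrow> complex" where
  "tens u x = (\<Prod>s\<in>UNIV. u s (x $ s))"

lemma tens_integral:
  fixes u :: "'n::finite \<Rightarrow> real \<Rightarrow> complex"
  assumes int: "\<And>s. integrable lborel (u s)"
  shows "integrable lborel (tens u)" "(LINT x|lborel. tens u x) = (\<Prod>s\<in>UNIV. LINT t|lborel. u s t)"
proof -
  interpret product_sigma_finite "\<lambda>b::'n vec. lborel :: real measure" ..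
  \<comment> \<open>The product measure is indexed by basis vectors; \<open>ix\<close> recovers the
    coordinate from its unit vector.\<close>
  define ix where "ix b = (THE s. b = (axis s 1 :: 'n vec))" for b
  have ix: "ix (axis s 1) = s" for s :: 'n
    unfolding ix_def by (rule the_equality) (auto simp: axis_eq_axis)
  have B: "(Basis :: 'n vec set) = (\<lambda>s. axis s 1) ` UNIV" by (auto simp: Basis_vec_def)
  have inj: "inj_on (\<lambda>s::'n. axis s (1::real)) UNIV" by (auto simp: inj_on_def axis_eq_axis)
  let ?M = "\<Pi>\<^sub>M b\<in>(Basis :: 'n vec set). (lborel :: real measure)"
  let ?h = "\<lambda>f. \<Sum>b\<in>(Basis :: 'n vec set). f b *\<^sub>R b"
  have comp: "?h f $ s = f (axis s 1)" for f s
    using inner_sum_left_Basis[of "axis s 1 :: 'n vec" f] by (simp add: inner_axis B)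
  have eq: "tens u (?h f) = (\<Prod>b\<in>Basis. u (ix b) (f b))" for f
  proof -
    have "tens u (?h f) = (\<Prod>s\<in>UNIV. u s (f (axis s 1)))" unfolding tens_def comp ..
    also have "\<dots> = (\<Prod>b\<in>Basis. u (ix b) (f b))"
      unfolding B by (subst prod.reindex[OF inj]) (simp add: ix)
    finally show ?thesis .
  qed
  have m: "?h \<in> measurable ?M borel" by measurable
  have um: "u s \<in> borel_measurable borel" for s using int[of s] by auto
  have mt: "tens u \<in> borel_measurable borel"
    unfolding tens_def using um by (intro borel_measurable_prod) (auto intro!: measurable_compose[OF _ um])
  show "integrable lborel (tens u)"
    by (subst lborel_eq, subst integrable_distr_eq[OF m mt], unfold eq, rule product_integrable_prod) (auto intro: int)
  have "(LINT x|lborel. tens u x) = (LINT f|?M. tens u (?h f))"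
    by (subst lborel_eq) (rule integral_distr[OF m mt])
  also have "\<dots> = (\<Prod>b\<in>Basis. LINT t|lborel. u (ix b) t)"
    unfolding eq by (rule product_integral_prod) (auto intro: int)
  also have "\<dots> = (\<Prod>s\<in>UNIV. LINT t|lborel. u s t)"
    unfolding B by (subst prod.reindex[OF inj]) (simp add: ix)
  finally show "(LINT x|lborel. tens u x) = (\<Prod>s\<in>UNIV. LINT t|lborel. u s t)" .
qed

lemma cis_sum: "finite A \<Longrightarrow> cis (\<Sum>i\<in>A. f i) = (\<Prod>i\<in>A. cis (f i))"
  by (induction A rule: finite_induct) (auto simp: cis_zero simp flip: cis_mult)

lemma tens_mult_cis:
  "tens u x * cis (2 * pi * (x \<bullet> \<xi>)) = tens (\<lambda>s t. u s t * cis (2 * pi * (\<xi> $ s * t))) x"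
proof -
  have "2 * pi * (x \<bullet> \<xi>) = (\<Sum>s\<in>UNIV. 2 * pi * (\<xi> $ s * x $ s))"
    by (simp add: inner_vec_def sum_distrib_left mult.commute)
  then show ?thesis by (simp add: tens_def cis_sum prod.distrib)
qed

lemma inv_fourier_tens:
  assumes "\<And>s. integrable lborel (u s)"
  shows "inv_fourier (tens u) x = tens (\<lambda>s. ift (u s)) x"
proof -
  have "inv_fourier (tens u) x = (LINT \<xi>|lborel. tens (\<lambda>s t. u s t * cis (2 * pi * (x $ s * t))) \<xi>)"
    unfolding inv_fourier_def
    by (rule Bochner_Integration.integral_cong) (auto simp: inner_commute[of x] tens_mult_cis)
  then show ?thesis
    using tens_integral(2)[of "\<lambda>s t. u s t * cis (2 * pi * (x $ s * t))"] assms
    by (simp add: ift_integrand tens_def ift_def)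
qed

lemma fourier_eq_inv_fourier: "fourier f \<xi> = inv_fourier f (- \<xi>)"
  by (simp add: fourier_def inv_fourier_def inner_commute)

section \<open>Explicit families of iterated partial derivatives\<close>

definition pd_family :: "'n::finite vec set \<Rightarrow> ('n list \<Rightarrow> 'n vec \<Rightarrow> complex) \<Rightarrow> bool" where
  "pd_family S D \<longleftrightarrow> (\<forall>is i. \<forall>\<xi>\<in>S. ((\<lambda>t. D is (\<xi> + t *\<^sub>R axis i 1)) has_vector_derivative D (i # is) \<xi>) (at 0))"

lemma eventually_line:
  fixes \<xi> :: "'n::finite vec"
  assumes "open S" "\<xi> \<in> S"
  shows "\<forall>\<^sub>F t in nhds (0::real). \<xi> + t *\<^sub>R axis i 1 \<in> S"
proof -
  have "((\<lambda>t::real. \<xi> + t *\<^sub>R axis i 1) \<longlongrightarrow> \<xi> + 0 *\<^sub>R axis i 1) (nhds 0)"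
    by (intro tendsto_intros filterlim_ident)
  then show ?thesis using assms by (auto dest: topological_tendstoD)
qed

lemma pd_family_cong:
  assumes "pd_family S D" "open S" "\<And>is \<xi>. \<xi> \<in> S \<Longrightarrow> D is \<xi> = E is \<xi>"
  shows "pd_family S E"
  unfolding pd_family_def
proof (intro allI ballI)
  fix "is" i \<xi> assume x: "\<xi> \<in> S"
  have "((\<lambda>t. D is (\<xi> + t *\<^sub>R axis i 1)) has_vector_derivative D (i # is) \<xi>) (at 0)"
    using assms(1) x by (auto simp: pd_family_def)
  moreover have "\<forall>\<^sub>F t in nhds 0. D is (\<xi> + t *\<^sub>R axis i 1) = E is (\<xi> + t *\<^sub>R axis i 1)"
    using eventually_line[OF assms(2) x] by eventually_elim (rule assms(3))
  ultimately show "((\<lambda>t. E is (\<xi> + t *\<^sub>R axis i 1)) has_vector_derivative E (i # is) \<xi>) (at 0)"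
    using has_vector_derivative_cong_ev[of UNIV "\<lambda>t. D is (\<xi> + t *\<^sub>R axis i 1)" "\<lambda>t. E is (\<xi> + t *\<^sub>R axis i 1)" 0] assms(3)[OF x]
    by simp
qed

text \<open>An explicit family is easy to verify, while \<open>pderivs\<close> is awkward to
  evaluate; this identifies the two. The induction needs all points of an open set, because a
  derivative at \<xi> uses the previous one on a short coordinate segment through \<xi>.\<close>

lemma pd_family_pderivs:
  assumes "pd_family S D" "open S" "\<And>\<xi>. \<xi> \<in> S \<Longrightarrow> f \<xi> = D [] \<xi>" "\<xi> \<in> S"
  shows "pderivs is f \<xi> = D is \<xi>"
  using assms(4)
proof (induction "is" arbitrary: \<xi>)
  case Nil
  then show ?case using assms(3) by simp
next
  case (Cons i "is")
  have "((\<lambda>t. D is (\<xi> + t *\<^sub>R axis i 1)) has_vector_derivative D (i # is) \<xi>) (at 0)"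
    using assms(1) Cons.prems by (auto simp: pd_family_def)
  moreover have "\<forall>\<^sub>F t in nhds 0. D is (\<xi> + t *\<^sub>R axis i 1) = pderivs is f (\<xi> + t *\<^sub>R axis i 1)"
    using eventually_line[OF assms(2) Cons.prems] by eventually_elim (rule Cons.IH[symmetric])
  ultimately have "((\<lambda>t. pderivs is f (\<xi> + t *\<^sub>R axis i 1)) has_vector_derivative D (i # is) \<xi>) (at 0)"
    using has_vector_derivative_cong_ev[of UNIV "\<lambda>t. D is (\<xi> + t *\<^sub>R axis i 1)" "\<lambda>t. pderivs is f (\<xi> + t *\<^sub>R axis i 1)" 0]
      Cons.IH[OF Cons.prems] by simp
  then show ?case by (simp add: partial_def vector_derivative_at)
qed

lemma smooth_on_pd_family:
  assumes "smooth_on S f" shows "pd_family S (\<lambda>is. pderivs is f)"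
  using assms unfolding pd_family_def smooth_on_def
  by (auto simp: partial_def vector_derivative_works)

lemma pd_family_smooth_on:
  assumes "pd_family S D" "open S" "\<And>\<xi>. \<xi> \<in> S \<Longrightarrow> f \<xi> = D [] \<xi>" "\<And>is. continuous_on S (D is)"
  shows "smooth_on S f"
  unfolding smooth_on_def
proof (intro allI conjI ballI)
  fix "is"
  have eq: "pderivs is f \<xi> = D is \<xi>" if "\<xi> \<in> S" for "is" \<xi>
    by (rule pd_family_pderivs[OF assms(1-3) that])
  then show "continuous_on S (pderivs is f)"
    using assms(4)[of "is"] by (simp cong: continuous_on_cong)
  have "pd_family S (\<lambda>is. pderivs is f)"
    by (rule pd_family_cong[OF assms(1,2)]) (simp add: eq)
  then show "(\<lambda>t. pderivs is f (\<xi> + t *\<^sub>R axis i 1)) differentiable at 0" if "\<xi> \<in> S" for i \<xi>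
    using that by (auto simp: pd_family_def intro: differentiableI_vector)
qed

lemma pd_family_lincomb:
  assumes "\<And>j. j \<in> J \<Longrightarrow> pd_family S (D j)"
  shows "pd_family S (\<lambda>is \<xi>. \<Sum>j\<in>J. c j * D j is \<xi>)"
  using assms unfolding pd_family_def
  by (auto intro!: has_vector_derivative_sum has_vector_derivative_mult_right)

lemma pd_family_scale:
  assumes "pd_family UNIV D"
  shows "pd_family UNIV (\<lambda>is \<xi>. complex_of_real (r ^ length is) * D is (r *\<^sub>R \<xi>))"
  unfolding pd_family_def
proof (intro allI ballI)
  fix "is" i \<xi>
  have "((\<lambda>t. D is (r *\<^sub>R \<xi> + t *\<^sub>R axis i 1)) has_vector_derivative D (i # is) (r *\<^sub>R \<xi>)) (at (r * 0))"
    using assms by (simp add: pd_family_def)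
  moreover have "((\<lambda>t. r * t) has_vector_derivative r) (at 0)"
    by (auto intro!: derivative_eq_intros)
  ultimately have "((\<lambda>t. D is (r *\<^sub>R \<xi> + (r * t) *\<^sub>R axis i 1)) has_vector_derivative r *\<^sub>R D (i # is) (r *\<^sub>R \<xi>)) (at 0)"
    using vector_diff_chain_at[of "\<lambda>t. r * t" r 0 "\<lambda>t. D is (r *\<^sub>R \<xi> + t *\<^sub>R axis i 1)"] by (simp add: o_def)
  then have "((\<lambda>t. complex_of_real (r ^ length is) * D is (r *\<^sub>R (\<xi> + t *\<^sub>R axis i 1))) has_vector_derivative
      complex_of_real (r ^ length is) * (r *\<^sub>R D (i # is) (r *\<^sub>R \<xi>))) (at 0)"
    by (intro has_vector_derivative_mult_right) (simp add: scaleR_add_right)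
  then show "((\<lambda>t. complex_of_real (r ^ length is) * D is (r *\<^sub>R (\<xi> + t *\<^sub>R axis i 1))) has_vector_derivative
      complex_of_real (r ^ length (i # is)) * D (i # is) (r *\<^sub>R \<xi>)) (at 0)"
    by (simp add: scaleR_conv_of_real mult_ac)
qed

text \<open>Each factor depends on one coordinate, so a direction i raises only the order of the
  i-th factor; hence only the number of occurrences in the list matters.\<close>

lemma pd_family_tens:
  fixes U :: "'n::finite \<Rightarrow> nat \<Rightarrow> real \<Rightarrow> complex"
  assumes "\<And>s. tower (P s) (U s)"
  shows "pd_family UNIV (\<lambda>is. tens (\<lambda>s. U s (count_list is s)))"
  unfolding pd_family_def
proof (intro allI ballI)
  fix "is" :: "'n list" and i :: "'n" and \<xi> :: "'n vec"
  let ?c = "count_list is"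
  have split: "tens v x = v i (x $ i) * (\<Prod>s\<in>UNIV - {i}. v s (x $ s))" for v x
    unfolding tens_def by (rule prod.remove) auto
  have "((\<lambda>t. U i (?c i) (\<xi> $ i + t)) has_vector_derivative U i (Suc (?c i)) (\<xi> $ i)) (at 0)"
  proof -
    have "((\<lambda>t. \<xi> $ i + t) has_vector_derivative 0 + 1) (at 0)"
      by (intro has_vector_derivative_add has_vector_derivative_const has_vector_derivative_id)
    from vector_diff_chain_at[OF this towerD(2)[OF assms]] show ?thesis by (simp add: o_def)
  qed
  then have "((\<lambda>t. U i (?c i) (\<xi> $ i + t) * (\<Prod>s\<in>UNIV - {i}. U s (?c s) (\<xi> $ s))) has_vector_derivative
      U i (Suc (?c i)) (\<xi> $ i) * (\<Prod>s\<in>UNIV - {i}. U s (?c s) (\<xi> $ s))) (at 0)"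
    by (rule has_vector_derivative_mult_left)
  moreover have "U i (?c i) (\<xi> $ i + t) * (\<Prod>s\<in>UNIV - {i}. U s (?c s) (\<xi> $ s))
      = tens (\<lambda>s. U s (?c s)) (\<xi> + t *\<^sub>R axis i 1)" for t
  proof -
    have "(\<Prod>s\<in>UNIV - {i}. U s (?c s) ((\<xi> + t *\<^sub>R axis i 1) $ s)) = (\<Prod>s\<in>UNIV - {i}. U s (?c s) (\<xi> $ s))"
      by (rule prod.cong) (auto simp: axis_def)
    then show ?thesis by (simp add: split axis_def)
  qed
  moreover have "U i (Suc (?c i)) (\<xi> $ i) * (\<Prod>s\<in>UNIV - {i}. U s (?c s) (\<xi> $ s))
      = tens (\<lambda>s. U s (count_list (i # is) s)) \<xi>"
  proof -
    have "(\<Prod>s\<in>UNIV - {i}. U s (count_list (i # is) s) (\<xi> $ s)) = (\<Prod>s\<in>UNIV - {i}. U s (?c s) (\<xi> $ s))"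
      by (rule prod.cong) auto
    then show ?thesis by (simp add: split)
  qed
  ultimately show "((\<lambda>t. tens (\<lambda>s. U s (?c s)) (\<xi> + t *\<^sub>R axis i 1)) has_vector_derivative
      tens (\<lambda>s. U s (count_list (i # is) s)) \<xi>) (at 0)" by simp
qed

lemma continuous_on_tens:
  assumes "\<And>s. continuous_on UNIV (u s)"
  shows "continuous_on S (tens u)"
proof -
  have "continuous_on S (\<lambda>x. u s (x $ s))" for s
    by (rule continuous_on_compose2[OF assms]) (auto intro: continuous_on_component continuous_on_id)
  then have "continuous_on S (\<lambda>x. \<Prod>s\<in>UNIV. u s (x $ s))"
    by (rule continuous_on_prod)
  then show ?thesis by (simp add: tens_def[abs_def])
qed

section \<open>Construction of Schwartz functions\<close>

lemma schwartzI:
  assumes D: "pd_family UNIV D" and f: "f = D []" and cont: "\<And>is. continuous_on UNIV (D is)"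
    and bd: "\<And>is N. \<exists>C. \<forall>x. (1 + norm x) ^ N * norm (D is x) \<le> C"
  shows "f \<in> schwartz"
proof -
  have "smooth_on UNIV f" by (rule pd_family_smooth_on[OF D]) (auto simp: f cont)
  moreover have "bounded (range (\<lambda>x. (1 + norm x) ^ N *\<^sub>R pderivs is f x))" for "is" N
  proof -
    obtain C where C: "\<And>x. (1 + norm x) ^ N * norm (D is x) \<le> C" using bd by blast
    have "pderivs is f x = D is x" for x by (rule pd_family_pderivs[OF D]) (auto simp: f)
    then show ?thesis using C by (intro boundedI[of _ C]) auto
  qed
  ultimately show ?thesis by (auto simp: schwartz_def)
qed

lemma schwartz_lincomb:
  assumes "finite J" "\<And>j. j \<in> J \<Longrightarrow> f j \<in> schwartz"
  shows "(\<lambda>x. \<Sum>j\<in>J. c j * f j x) \<in> schwartz"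
proof (rule schwartzI)
  show "pd_family UNIV (\<lambda>is x. \<Sum>j\<in>J. c j * pderivs is (f j) x)"
    by (rule pd_family_lincomb) (use assms in \<open>auto simp: schwartz_def intro: smooth_on_pd_family\<close>)
  show "continuous_on UNIV (\<lambda>x. \<Sum>j\<in>J. c j * pderivs is (f j) x)" for "is"
    using assms by (intro continuous_intros) (auto simp: schwartz_def smooth_on_def)
  fix "is" and N :: nat
  have "\<exists>C. \<forall>x. (1 + norm x) ^ N * norm (pderivs is (f j) x) \<le> C" if "j \<in> J" for j
  proof -
    have "bounded (range (\<lambda>x. (1 + norm x) ^ N *\<^sub>R pderivs is (f j) x))"
      using assms(2)[OF that] unfolding schwartz_def by blast
    then obtain C where "\<forall>y\<in>range (\<lambda>x. (1 + norm x) ^ N *\<^sub>R pderivs is (f j) x). norm y \<le> C"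
      unfolding bounded_iff by blast
    then show ?thesis by (intro exI[of _ C]) auto
  qed
  then obtain C where C: "\<And>j x. j \<in> J \<Longrightarrow> (1 + norm x) ^ N * norm (pderivs is (f j) x) \<le> C j"
    by metis
  have "(1 + norm x) ^ N * norm (\<Sum>j\<in>J. c j * pderivs is (f j) x) \<le> (\<Sum>j\<in>J. norm (c j) * C j)" for x
  proof -
    have "(1 + norm x) ^ N * norm (\<Sum>j\<in>J. c j * pderivs is (f j) x)
        \<le> (1 + norm x) ^ N * (\<Sum>j\<in>J. norm (c j * pderivs is (f j) x))"
      by (intro mult_left_mono norm_sum) auto
    also have "\<dots> = (\<Sum>j\<in>J. norm (c j) * ((1 + norm x) ^ N * norm (pderivs is (f j) x)))"
      by (simp add: sum_distrib_left norm_mult mult_ac)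
    also have "\<dots> \<le> (\<Sum>j\<in>J. norm (c j) * C j)"
      by (intro sum_mono mult_left_mono C) auto
    finally show ?thesis .
  qed
  then show "\<exists>C. \<forall>x. (1 + norm x) ^ N * norm (\<Sum>j\<in>J. c j * pderivs is (f j) x) \<le> C" by blast
qed simp

text \<open>Used to split the weight 1 + |x| into one weight per coordinate, so that decay of the
  factors gives decay of their tensor product.\<close>

lemma one_plus_sum_le_prod:
  fixes f :: "'a \<Rightarrow> real"
  assumes "finite A" "\<And>x. f x \<ge> 0"
  shows "1 + sum f A \<le> (\<Prod>x\<in>A. 1 + f x)"
  using assms(1)
proof (induction A rule: finite_induct)
  case (insert a A)
  have "1 + sum f (insert a A) \<le> (1 + f a) * (1 + sum f A)"
    using insert.hyps assms(2) sum_nonneg[of A f] by (simp add: algebra_simps)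
  also have "\<dots> \<le> (1 + f a) * (\<Prod>x\<in>A. 1 + f x)"
    by (intro mult_left_mono insert.IH) (simp add: assms(2) add_nonneg_nonneg)
  finally show ?case using insert.hyps by simp
qed simp

lemma schwartz_tens:
  assumes "\<And>s. tower rapid (U s)"
  shows "tens (\<lambda>s. U s 0) \<in> schwartz"
proof (rule schwartzI)
  show "pd_family UNIV (\<lambda>is. tens (\<lambda>s. U s (count_list is s)))"
    by (rule pd_family_tens[OF assms])
  show "continuous_on UNIV (tens (\<lambda>s. U s (count_list is s)))" for "is"
    by (intro continuous_on_tens tower_continuous[OF assms])
  fix "is" :: "'a list" and N :: nat
  have "\<forall>s. \<exists>C. \<forall>t. (1 + \<bar>t\<bar>) ^ N * norm (U s (count_list is s) t) \<le> C"
    using towerD(1)[OF assms] by (auto simp: rapid_def)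
  then obtain C where C: "\<And>s t. (1 + \<bar>t\<bar>) ^ N * norm (U s (count_list is s) t) \<le> C s"
    by metis
  have "(1 + norm x) ^ N * norm (tens (\<lambda>s. U s (count_list is s)) x) \<le> (\<Prod>s\<in>UNIV. C s)" for x :: "'a vec"
  proof -
    have "norm x \<le> (\<Sum>s\<in>UNIV. \<bar>x $ s\<bar>)" by (rule norm_le_l1_cart)
    then have "1 + norm x \<le> 1 + (\<Sum>s\<in>UNIV. \<bar>x $ s\<bar>)" by simp
    also have "\<dots> \<le> (\<Prod>s\<in>UNIV. 1 + \<bar>x $ s\<bar>)" by (rule one_plus_sum_le_prod) auto
    finally have "(1 + norm x) ^ N \<le> (\<Prod>s\<in>UNIV. 1 + \<bar>x $ s\<bar>) ^ N" by (intro power_mono) auto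
    then have "(1 + norm x) ^ N * norm (tens (\<lambda>s. U s (count_list is s)) x)
        \<le> (\<Prod>s\<in>UNIV. 1 + \<bar>x $ s\<bar>) ^ N * norm (tens (\<lambda>s. U s (count_list is s)) x)"
      by (rule mult_right_mono) simp
    also have "\<dots> = (\<Prod>s\<in>UNIV. (1 + \<bar>x $ s\<bar>) ^ N * norm (U s (count_list is s) (x $ s)))"
      by (simp add: tens_def prod_norm prod_power_distrib prod.distrib)
    also have "\<dots> \<le> (\<Prod>s\<in>UNIV. C s)"
      by (intro prod_mono) (auto simp: C)
    finally show ?thesis .
  qed
  then show "\<exists>C. \<forall>x. (1 + norm x) ^ N * norm (tens (\<lambda>s. U s (count_list is s)) x) \<le> C" by blast
qed simp

section \<open>The topology of the symbol space\<close>

abbreviation weighted :: "'n::finite list \<Rightarrow> ('n vec \<Rightarrow> complex) \<Rightarrow> 'n vec \<Rightarrow> real" where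
  "weighted is m \<xi> \<equiv> norm \<xi> ^ length is * norm (pderivs is m \<xi>)"

lemma mult_space_iff:
  "m \<in> mult_space \<longleftrightarrow> smooth_on (- {0}) m \<and> m 0 = 0 \<and> (\<forall>is. \<exists>C. \<forall>\<xi>. \<xi> \<noteq> 0 \<longrightarrow> weighted is m \<xi> \<le> C)"
proof -
  have "norm (pderivs is m \<xi>) \<le> C * norm \<xi> powr (- real (length is)) \<longleftrightarrow> weighted is m \<xi> \<le> C"
    if "\<xi> \<noteq> 0" for "is" \<xi> C
  proof -
    have "norm \<xi> ^ length is > 0" using that by simp
    moreover have "norm \<xi> powr (- real (length is)) = inverse (norm \<xi> ^ length is)"
      using that by (simp add: powr_minus powr_realpow)
    ultimately show ?thesis by (simp add: pos_le_divide_eq mult.commute flip: divide_inverse)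
  qed
  then show ?thesis unfolding mult_space_def by auto
qed

lemma smooth_lincomb:
  assumes "smooth_on (- {0}) m1" "smooth_on (- {0}) m2"
  shows "smooth_on (- {0}) (\<lambda>\<xi>. m1 \<xi> + c * m2 \<xi>)"
    and "\<xi> \<noteq> 0 \<Longrightarrow> pderivs is (\<lambda>\<xi>. m1 \<xi> + c * m2 \<xi>) \<xi> = pderivs is m1 \<xi> + c * pderivs is m2 \<xi>"
proof -
  have 1: "pd_family (- {0}) (\<lambda>is \<xi>. pderivs is m1 \<xi> + c * pderivs is m2 \<xi>)"
    using smooth_on_pd_family[OF assms(1)] smooth_on_pd_family[OF assms(2)] unfolding pd_family_def
    by (auto intro!: has_vector_derivative_add has_vector_derivative_mult_right)
  have 2: "open (- {0 :: 'a vec})" by auto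
  show "smooth_on (- {0}) (\<lambda>\<xi>. m1 \<xi> + c * m2 \<xi>)"
    by (rule pd_family_smooth_on[OF 1 2]) (use assms in \<open>auto simp: smooth_on_def intro!: continuous_intros\<close>)
  show "pderivs is (\<lambda>\<xi>. m1 \<xi> + c * m2 \<xi>) \<xi> = pderivs is m1 \<xi> + c * pderivs is m2 \<xi>" if "\<xi> \<noteq> 0"
    by (rule pd_family_pderivs[OF 1 2]) (use that in auto)
qed

lemma weighted_lincomb:
  assumes "m1 \<in> mult_space" "m2 \<in> mult_space" "\<xi> \<noteq> 0"
  shows "weighted is (\<lambda>\<xi>. m1 \<xi> + c * m2 \<xi>) \<xi> \<le> weighted is m1 \<xi> + norm c * weighted is m2 \<xi>"
proof -
  have "weighted is (\<lambda>\<xi>. m1 \<xi> + c * m2 \<xi>) \<xi> = norm \<xi> ^ length is * norm (pderivs is m1 \<xi> + c * pderivs is m2 \<xi>)"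
    using assms by (simp add: smooth_lincomb mult_space_iff)
  also have "\<dots> \<le> norm \<xi> ^ length is * (norm (pderivs is m1 \<xi>) + norm (c * pderivs is m2 \<xi>))"
    by (intro mult_left_mono norm_triangle_ineq) auto
  finally show ?thesis by (simp add: distrib_left norm_mult mult.left_commute)
qed

lemma mult_space_lincomb:
  assumes "m1 \<in> mult_space" "m2 \<in> mult_space"
  shows "(\<lambda>\<xi>. m1 \<xi> + c * m2 \<xi>) \<in> mult_space"
  unfolding mult_space_iff
proof (intro conjI allI)
  fix "is"
  obtain C1 C2 where C: "\<And>\<xi>. \<xi> \<noteq> 0 \<Longrightarrow> weighted is m1 \<xi> \<le> C1" "\<And>\<xi>. \<xi> \<noteq> 0 \<Longrightarrow> weighted is m2 \<xi> \<le> C2"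
    using assms unfolding mult_space_iff by meson
  have "weighted is (\<lambda>\<xi>. m1 \<xi> + c * m2 \<xi>) \<xi> \<le> C1 + norm c * C2" if "\<xi> \<noteq> 0" for \<xi>
    by (rule order_trans[OF weighted_lincomb[OF assms that] add_mono[OF C(1)[OF that] mult_left_mono[OF C(2)[OF that]]]]) simp
  then show "\<exists>C. \<forall>\<xi>. \<xi> \<noteq> 0 \<longrightarrow> weighted is (\<lambda>\<xi>. m1 \<xi> + c * m2 \<xi>) \<xi> \<le> C" by blast
qed (use assms in \<open>auto simp: mult_space_iff smooth_lincomb\<close>)

lemma mult_space_diff: "m1 \<in> mult_space \<Longrightarrow> m2 \<in> mult_space \<Longrightarrow> m1 - m2 \<in> mult_space"
  using mult_space_lincomb[of m1 m2 "-1"] by (simp add: fun_diff_def)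

text \<open>The real supremum says something only for a set bounded above. There are finitely many
  lists of length at most j, so the separate constants have a maximum.\<close>

lemma snorm_upper:
  fixes m :: "'n::finite vec \<Rightarrow> complex"
  assumes m: "m \<in> mult_space" and "length is \<le> j" "\<xi> \<noteq> 0"
  shows "weighted is m \<xi> \<le> snorm j m"
  unfolding snorm_def
proof (rule cSup_upper)
  show "weighted is m \<xi> \<in> {weighted is m \<xi> |is \<xi>. length is \<le> j \<and> \<xi> \<noteq> 0}"
    using assms by blast
  obtain C where C: "\<And>is \<xi>. \<xi> \<noteq> 0 \<Longrightarrow> weighted is m \<xi> \<le> C is"
    using m unfolding mult_space_iff by metis
  have fin: "finite {is :: 'n list. length is \<le> j}"
    using finite_lists_length_le[of "UNIV :: 'n set" j] by simp
  have "weighted is m \<xi> \<le> Max (C ` {is. length is \<le> j})" if "length is \<le> j" "\<xi> \<noteq> 0" for "is" \<xi>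
    by (rule order_trans[OF C[OF that(2)]], rule Max_ge) (use fin that in auto)
  then show "bdd_above {weighted is m \<xi> |is \<xi>. length is \<le> j \<and> \<xi> \<noteq> 0}"
    by (intro bdd_aboveI) blast
qed

lemma snorm_least:
  fixes m :: "'n::finite vec \<Rightarrow> complex"
  assumes "\<And>is \<xi>. length is \<le> j \<Longrightarrow> \<xi> \<noteq> 0 \<Longrightarrow> weighted is m \<xi> \<le> C"
  shows "snorm j m \<le> C"
  unfolding snorm_def
proof (rule cSup_least)
  \<comment> \<open>An arbitrary nonzero vector, to see that the supremum is over a nonempty
    set.\<close>
  have "axis undefined 1 \<noteq> (0 :: 'n vec)" by (simp add: axis_eq_0_iff)
  then have "weighted [] m (axis undefined 1) \<in> {weighted is m \<xi> |is \<xi>. length is \<le> j \<and> \<xi> \<noteq> 0}"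
    by (intro CollectI exI[of _ "[]"] exI[of _ "axis undefined 1"]) auto
  then show "{weighted is m \<xi> |is \<xi>. length is \<le> j \<and> \<xi> \<noteq> 0} \<noteq> {}" by blast
qed (use assms in auto)

text \<open>The seminorms ignore the origin; there the normalisation \<open>m 0 = 0\<close> takes
  over.\<close>

lemma norm_le_snorm:
  assumes "m \<in> mult_space" shows "norm (m \<xi>) \<le> snorm 0 m"
proof (cases "\<xi> = 0")
  case True
  have "axis undefined 1 \<noteq> (0 :: 'a vec)" by (simp add: axis_eq_0_iff)
  then have "0 \<le> snorm 0 m"
    using snorm_upper[OF assms, of "[]" 0 "axis undefined 1"] by (auto intro: order_trans[OF norm_ge_zero])
  then show ?thesis using assms True by (simp add: mult_space_iff)
next
  case False
  then show ?thesis using snorm_upper[OF assms, of "[]" 0 \<xi>] by simp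
qed

lemma snorm_mono: "m \<in> mult_space \<Longrightarrow> j \<le> k \<Longrightarrow> snorm j m \<le> snorm k m"
  by (intro snorm_least snorm_upper) auto

lemma snorm_triangle:
  fixes m1 :: "'n::finite vec \<Rightarrow> complex"
  assumes "m1 \<in> mult_space" "m2 \<in> mult_space" "m3 \<in> mult_space"
  shows "snorm j (m3 - m1) \<le> snorm j (m3 - m2) + snorm j (m2 - m1)"
proof (rule snorm_least)
  fix "is" :: "'n list" and \<xi> :: "'n vec" assume *: "length is \<le> j" "\<xi> \<noteq> 0"
  have d: "m3 - m2 \<in> mult_space" "m2 - m1 \<in> mult_space" using assms by (auto intro: mult_space_diff)
  have "m3 - m1 = (\<lambda>\<xi>. (m3 - m2) \<xi> + 1 * (m2 - m1) \<xi>)" by auto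
  then have "weighted is (m3 - m1) \<xi> \<le> weighted is (m3 - m2) \<xi> + norm (1::complex) * weighted is (m2 - m1) \<xi>"
    using weighted_lincomb[OF d *(2), of "is" 1] by presburger
  also have "\<dots> \<le> snorm j (m3 - m2) + snorm j (m2 - m1)"
    using snorm_upper[OF d(1) *] snorm_upper[OF d(2) *] by simp
  finally show "weighted is (m3 - m1) \<xi> \<le> snorm j (m3 - m2) + snorm j (m2 - m1)" .
qed

lemma snorm_self:
  fixes m :: "'n::finite vec \<Rightarrow> complex"
  shows "snorm j (m - m) \<le> 0"
proof (rule snorm_least)
  fix "is" :: "'n list" and \<xi> :: "'n vec"
  have "pd_family UNIV (\<lambda>is \<xi>. 0)" by (auto simp: pd_family_def)
  then have "pderivs is (m - m) \<xi> = 0"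
    by (rule pd_family_pderivs) auto
  then show "weighted is (m - m) \<xi> \<le> 0" by simp
qed

lemma openin_mult_ball:
  "m \<in> mult_space \<Longrightarrow> \<epsilon> > 0 \<Longrightarrow> openin mult_topology {m' \<in> mult_space. snorm j (m' - m) < \<epsilon>}"
  unfolding mult_topology_def by (rule topology_generated_by_Basis) blast

lemma mult_ball_center: "m \<in> mult_space \<Longrightarrow> \<epsilon> > 0 \<Longrightarrow> m \<in> {m' \<in> mult_space. snorm j (m' - m) < \<epsilon>}"
  using snorm_self[of j m] by auto

lemma topspace_mult_topology:
  "topspace (mult_topology :: ('n::finite vec \<Rightarrow> complex) topology) = mult_space"
proof
  show "topspace mult_topology \<subseteq> (mult_space :: ('n vec \<Rightarrow> complex) set)"
    unfolding mult_topology_def topology_generated_by_topspace by auto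
  show "mult_space \<subseteq> topspace (mult_topology :: ('n vec \<Rightarrow> complex) topology)"
  proof
    fix m :: "'n vec \<Rightarrow> complex" assume m: "m \<in> mult_space"
    show "m \<in> topspace mult_topology"
      using openin_subset[OF openin_mult_ball[OF m zero_less_one, of 0]] mult_ball_center[OF m zero_less_one, of 0] by blast
  qed
qed

text \<open>Induction over the generation of open sets from balls. Intersections use the larger
  index and the smaller radius, by monotonicity of \<open>snorm\<close>; a ball with another centre
  contains one around each of its points by the triangle inequality.\<close>

lemma openin_mult_topologyD:
  fixes U :: "('n::finite vec \<Rightarrow> complex) set"
  assumes "openin mult_topology U" "m \<in> U"
  shows "\<exists>j. \<exists>\<epsilon>>0. \<forall>m'\<in>mult_space. snorm j (m' - m) < \<epsilon> \<longrightarrow> m' \<in> U"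
proof -
  have "generate_topology_on {{m' \<in> mult_space. snorm j (m' - m) < \<epsilon>} | m j \<epsilon>. m \<in> mult_space \<and> \<epsilon> > 0} U"
    using assms(1) unfolding mult_topology_def openin_topology_generated_by_iff .
  then show ?thesis using assms(2)
  proof (induction arbitrary: m)
    case Empty then show ?case by simp
  next
    case (Int U V)
    obtain j \<epsilon> where U: "\<epsilon> > 0" "\<And>m'. m' \<in> mult_space \<Longrightarrow> snorm j (m' - m) < \<epsilon> \<Longrightarrow> m' \<in> U"
      using Int.IH(1)[of m] Int.prems by blast
    obtain k \<delta> where V: "\<delta> > 0" "\<And>m'. m' \<in> mult_space \<Longrightarrow> snorm k (m' - m) < \<delta> \<Longrightarrow> m' \<in> V"
      using Int.IH(2)[of m] Int.prems by blast
    have "m \<in> mult_space"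
    proof -
      have "openin mult_topology U" using Int.hyps(1)
        unfolding mult_topology_def openin_topology_generated_by_iff .
      then show ?thesis using openin_subset topspace_mult_topology Int.prems by blast
    qed
    then have *: "m' \<in> U \<inter> V" if "m' \<in> mult_space" "snorm (max j k) (m' - m) < min \<epsilon> \<delta>" for m'
      using that U(2)[of m'] V(2)[of m'] snorm_mono[OF mult_space_diff[of m' m], of j "max j k"]
        snorm_mono[OF mult_space_diff[of m' m], of k "max j k"] by auto
    show ?case
    proof (intro exI[of _ "max j k"] exI[of _ "min \<epsilon> \<delta>"] conjI ballI impI)
      show "0 < min \<epsilon> \<delta>" using U(1) V(1) by simp
    qed (rule *)
  next
    case (UN K)
    then obtain V where "V \<in> K" "m \<in> V" by auto
    then show ?case using UN.IH[of V m] by blast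
  next
    case (Basis V)
    then obtain m0 j \<epsilon> where V: "V = {m' \<in> mult_space. snorm j (m' - m0) < \<epsilon>}" "m0 \<in> mult_space"
      by blast
    have m: "m \<in> mult_space" "snorm j (m - m0) < \<epsilon>" using Basis.prems V by auto
    have *: "m' \<in> V" if "m' \<in> mult_space" "snorm j (m' - m) < \<epsilon> - snorm j (m - m0)" for m'
      using snorm_triangle[OF V(2) m(1) that(1), of j] that V(1) by auto
    show ?case
    proof (intro exI[of _ j] exI[of _ "\<epsilon> - snorm j (m - m0)"] conjI ballI impI)
      show "0 < \<epsilon> - snorm j (m - m0)" using m by simp
    qed (rule *)
  qed
qed

text \<open>A symbol with a neighbourhood missing \<open>N\<close> is outside the closure, so the
  closure contains no ball. The avoiding neighbourhood is taken in \<open>snorm 0\<close>, because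
  the later lower bounds are stable under small sup-norm changes.\<close>

lemma nowhere_dense_in_mult_topologyI:
  assumes "N \<subseteq> mult_space"
    and "\<And>m j \<epsilon>. m \<in> mult_space \<Longrightarrow> \<epsilon> > 0 \<Longrightarrow> \<exists>m'\<in>mult_space. snorm j (m' - m) < \<epsilon> \<and>
            (\<exists>\<eta>>0. \<forall>m''\<in>mult_space. snorm 0 (m'' - m') < \<eta> \<longrightarrow> m'' \<notin> N)"
  shows "nowhere_dense_in mult_topology N"
  unfolding nowhere_dense_in_def
proof (intro conjI)
  show "N \<subseteq> topspace mult_topology" using assms(1) by (simp add: topspace_mult_topology)
  show "mult_topology interior_of (mult_topology closure_of N) = {}"
  proof (rule ccontr)
    assume "mult_topology interior_of (mult_topology closure_of N) \<noteq> {}"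
    then obtain m U where U: "openin mult_topology U" "m \<in> U" "U \<subseteq> mult_topology closure_of N"
      by (auto simp: interior_of_def)
    have m: "m \<in> mult_space" using openin_subset[OF U(1)] U(2) by (auto simp: topspace_mult_topology)
    obtain j \<epsilon> where e: "\<epsilon> > 0" "\<And>m'. m' \<in> mult_space \<Longrightarrow> snorm j (m' - m) < \<epsilon> \<Longrightarrow> m' \<in> U"
      using openin_mult_topologyD[OF U(1,2)] by blast
    obtain m' \<eta> where m': "m' \<in> mult_space" "snorm j (m' - m) < \<epsilon>" "\<eta> > 0"
      "\<And>m''. m'' \<in> mult_space \<Longrightarrow> snorm 0 (m'' - m') < \<eta> \<Longrightarrow> m'' \<notin> N"
      using assms(2)[OF m e(1), of j] by blast
    have "m' \<in> mult_topology closure_of N" using e(2)[OF m'(1,2)] U(3) by blast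
    then have "\<forall>T. m' \<in> T \<and> openin mult_topology T \<longrightarrow> (\<exists>y. y \<in> N \<and> y \<in> T)"
      unfolding in_closure_of by (rule conjunct2)
    from this[rule_format, OF conjI, OF mult_ball_center[OF m'(1,3)] openin_mult_ball[OF m'(1,3)], of 0]
    obtain y where "y \<in> N" "y \<in> mult_space" "snorm 0 (y - m') < \<eta>" by blast
    then show False using m'(4) by blast
  qed
qed

section \<open>Lacunary symbols\<close>

text \<open>Moving the profile to 1 in direction \<open>a\<close> places the product bump at the
  unit vector, so its dilate by 2^l sits at 2^l times that vector.\<close>

definition cutoff :: "(nat \<Rightarrow> real \<Rightarrow> complex) \<Rightarrow> 'n \<Rightarrow> 'n \<Rightarrow> nat \<Rightarrow> real \<Rightarrow> complex" where
  "cutoff w a s k t = w k (t - (if s = a then 1 else 0))"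

text \<open>All derivatives of the sum of dilated bumps at once; the scalar in front is the chain
  rule factor of the dilation.\<close>

definition lacunary_pd :: "(nat \<Rightarrow> real \<Rightarrow> complex) \<Rightarrow> 'n::finite \<Rightarrow> nat set \<Rightarrow> 'n list \<Rightarrow> 'n vec \<Rightarrow> complex" where
  "lacunary_pd w a L is \<xi> = (\<Sum>l\<in>L. complex_of_real (((1/2) ^ l) ^ length is) * tens (\<lambda>s. cutoff w a s (count_list is s)) ((1/2) ^ l *\<^sub>R \<xi>))"

definition lacunary :: "(nat \<Rightarrow> real \<Rightarrow> complex) \<Rightarrow> 'n::finite \<Rightarrow> nat set \<Rightarrow> 'n vec \<Rightarrow> complex" where
  "lacunary w a L = lacunary_pd w a L []"

lemma lacunary_alt: "lacunary w a L \<xi> = (\<Sum>l\<in>L. tens (\<lambda>s. cutoff w a s 0) ((1/2) ^ l *\<^sub>R \<xi>))"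
  by (simp add: lacunary_def lacunary_pd_def)

lemma cutoff_tower:
  assumes "tower (vanishes_off (1/4)) w"
  shows "tower (\<lambda>_. True) (cutoff w a s)"
proof -
  have "tower (\<lambda>_. True) (\<lambda>k t. 1 ^ k *\<^sub>R w k (1 * t + (- (if s = a then 1 else 0))))"
    by (rule tower_affine[OF assms]) simp
  moreover have "(\<lambda>k t. 1 ^ k *\<^sub>R w k (1 * t + (- (if s = a then 1 else 0)))) = cutoff w a s"
    by (auto simp: fun_eq_iff cutoff_def)
  ultimately show ?thesis by simp
qed

lemma tens_eq_0: "u s (x $ s) = 0 \<Longrightarrow> tens u x = 0"
  unfolding tens_def by (rule prod_zero) auto

lemma cutoff_eq_0:
  assumes "tower (vanishes_off (1/4)) w" "\<bar>t - (if s = a then 1 else 0)\<bar> > 1/4"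
  shows "cutoff w a s k t = 0"
  using towerD(1)[OF assms(1), of k] assms(2) by (auto simp: vanishes_off_def cutoff_def)

lemma tens_cutoff_eq_0:
  assumes "tower (vanishes_off (1/4)) w" "\<bar>x $ s - (if s = a then 1 else 0)\<bar> > 1/4"
  shows "tens (\<lambda>s. cutoff w a s (c s)) x = 0"
  by (rule tens_eq_0[of _ s]) (rule cutoff_eq_0[OF assms])

lemma pd_family_lac:
  assumes "tower (vanishes_off (1/4)) w"
  shows "pd_family UNIV (lacunary_pd w a L)"
proof -
  have 1: "pd_family UNIV (\<lambda>is. tens (\<lambda>s. cutoff w a s (count_list is s)))"
    by (rule pd_family_tens[OF cutoff_tower[OF assms]])
  have "pd_family UNIV (\<lambda>is \<xi>. \<Sum>l\<in>L. 1 * (complex_of_real (((1/2) ^ l) ^ length is) * tens (\<lambda>s. cutoff w a s (count_list is s)) ((1/2) ^ l *\<^sub>R \<xi>)))"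
    by (rule pd_family_lincomb) (rule pd_family_scale[OF 1])
  then show ?thesis by (simp add: lacunary_pd_def[abs_def])
qed

text \<open>At each \<xi> at most one summand is nonzero, since its \<open>a\<close>-coordinate must
  lie in [3/4, 5/4] 2^l. The weight is invariant under dilation, so that summand is bounded by the
  maximum for a single bump, independently of l and L.\<close>

lemma lacunary_pd_bound:
  fixes a :: "'n::finite"
  assumes w: "tower (vanishes_off (1/4)) w"
  shows "\<exists>C\<ge>0. \<forall>L. finite L \<longrightarrow> (\<forall>\<xi>. norm \<xi> ^ length is * norm (lacunary_pd w a L is \<xi>) \<le> C)"
proof -
  let ?c = "count_list is"
  let ?\<phi> = "tens (\<lambda>s. cutoff w a s (?c s))"
  \<comment> \<open>Outside this ball some coordinate exceeds 2 in modulus, by comparison with the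
    l^1 norm, and is then more than 1/4 away from both 0 and 1.\<close>
  let ?K = "cball 0 (2 * real CARD('n)) :: 'n vec set"
  have "continuous_on ?K (\<lambda>\<eta>. norm \<eta> ^ length is * norm (?\<phi> \<eta>))"
    by (intro continuous_intros continuous_on_tens tower_continuous[OF cutoff_tower[OF w]])
  then have "bounded ((\<lambda>\<eta>. norm \<eta> ^ length is * norm (?\<phi> \<eta>)) ` ?K)"
    by (intro compact_imp_bounded compact_continuous_image) auto
  then obtain C where C: "\<forall>y\<in>(\<lambda>\<eta>. norm \<eta> ^ length is * norm (?\<phi> \<eta>)) ` ?K. norm y \<le> C"
    unfolding bounded_iff by blast
  have one: "norm \<eta> ^ length is * norm (?\<phi> \<eta>) \<le> max C 0" for \<eta>
  proof (cases "\<eta> \<in> ?K")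
    case True
    then show ?thesis using bspec[OF C imageI[OF True]] by simp
  next
    case False
    have "\<exists>s. \<bar>\<eta> $ s\<bar> > 2"
    proof (rule ccontr)
      assume "\<not> ?thesis"
      then have "(\<Sum>s\<in>UNIV. \<bar>\<eta> $ s\<bar>) \<le> (\<Sum>s\<in>(UNIV::'n set). 2)" by (intro sum_mono) (auto simp: not_less)
      then show False using False norm_le_l1_cart[of \<eta>] by simp
    qed
    then obtain s where "\<bar>\<eta> $ s\<bar> > 2" ..
    then have "\<bar>\<eta> $ s\<bar> > 1/4" "\<bar>\<eta> $ s - 1\<bar> > 1/4" by linarith+
    then have "\<bar>\<eta> $ s - (if s = a then 1 else 0)\<bar> > 1/4" by (cases "s = a") simp_all
    then have "?\<phi> \<eta> = 0" by (rule tens_cutoff_eq_0[OF w])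
    then show ?thesis by simp
  qed
  have "norm \<xi> ^ length is * norm (lacunary_pd w a L is \<xi>) \<le> max C 0" if L: "finite L" for L \<xi>
  proof -
    let ?t = "\<lambda>l. complex_of_real (((1/2) ^ l) ^ length is) * ?\<phi> ((1/2) ^ l *\<^sub>R \<xi>)"
    have uniq: "l = l'" if "?t l \<noteq> 0" "?t l' \<noteq> 0" for l l'
    proof -
      have *: "3/4 \<le> (1/2) ^ l * \<xi> $ a \<and> (1/2) ^ l * \<xi> $ a \<le> 5/4" if "?t l \<noteq> 0" for l
      proof -
        have "\<not> \<bar>((1/2) ^ l *\<^sub>R \<xi>) $ a - (if a = a then 1 else 0)\<bar> > 1/4"
          using tens_cutoff_eq_0[OF w] that by fastforce
        then have "\<not> \<bar>(1/2) ^ l * \<xi> $ a - 1\<bar> > 1/4" by simp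
        then show ?thesis by linarith
      qed
      \<comment> \<open>At least one halving would send a value at most 5/4 to at most 5/8, which is
        below 3/4.\<close>
      have "\<not> l < l'" if "3/4 \<le> (1/2) ^ l' * \<xi> $ a" "(1/2) ^ l * \<xi> $ a \<le> 5/4" for l l'
      proof
        assume "l < l'"
        from less_imp_Suc_add[OF this] obtain d where d: "l' = l + Suc d" by auto
        have "0 < (1/2) ^ l' * \<xi> $ a" using that by linarith
        then have p: "\<xi> $ a > 0" by (simp add: zero_less_mult_iff)
        have "(1/2) ^ l' * \<xi> $ a = (1/2) ^ Suc d * ((1/2) ^ l * \<xi> $ a)"
          by (simp add: d power_add)
        also have "\<dots> \<le> (1/2) * ((1/2) ^ l * \<xi> $ a)"
          using p by (intro mult_right_mono) (auto simp: power_le_one)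
        finally show False using that by linarith
      qed
      then show ?thesis using *[OF that(1)] *[OF that(2)] by (meson linorder_neqE_nat)
    qed
    show ?thesis
    proof (cases "\<exists>l\<in>L. ?t l \<noteq> 0")
      case False
      then have "lacunary_pd w a L is \<xi> = 0" unfolding lacunary_pd_def by (intro sum.neutral) blast
      then show ?thesis by simp
    next
      case True
      then obtain l where l: "l \<in> L" "?t l \<noteq> 0" by blast
      have "lacunary_pd w a L is \<xi> = ?t l"
      proof -
        have "lacunary_pd w a L is \<xi> = ?t l + sum ?t (L - {l})"
          unfolding lacunary_pd_def by (rule sum.remove[OF L l(1)])
        moreover have "sum ?t (L - {l}) = 0"
          by (rule sum.neutral) (use uniq l in blast)
        ultimately show ?thesis by simp
      qed
      \<comment> \<open>The chain rule factor is absorbed by the weight: this is the dilation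
        invariance.\<close>
      then have "norm \<xi> ^ length is * norm (lacunary_pd w a L is \<xi>)
          = norm ((1/2) ^ l *\<^sub>R \<xi>) ^ length is * norm (?\<phi> ((1/2) ^ l *\<^sub>R \<xi>))"
        by (simp add: norm_mult norm_power power_mult_distrib del: of_real_power)
      also have "\<dots> \<le> max C 0" by (rule one)
      finally show ?thesis .
    qed
  qed
  then show ?thesis by (intro exI[of _ "max C 0"]) auto
qed

text \<open>The order of the quantifiers matters: the constant depends on j but not on L, so the
  amplitude of a perturbation can be fixed before its frequencies.\<close>

lemma lacunary_bounds:
  fixes a :: "'n::finite"
  assumes w: "tower (vanishes_off (1/4)) w"
  shows "finite L \<Longrightarrow> lacunary w a L \<in> mult_space"
    and "\<exists>C\<ge>0. \<forall>L. finite L \<longrightarrow> (\<forall>is \<xi>. length is \<le> j \<longrightarrow> weighted is (lacunary w a L) \<xi> \<le> C)"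
proof -
  obtain C where C: "\<And>is. C is \<ge> 0" "\<And>is L \<xi>. finite L \<Longrightarrow> norm \<xi> ^ length is * norm (lacunary_pd w a L is \<xi>) \<le> C is"
    using lacunary_pd_bound[OF w, of _ a] by metis
  have eq: "pderivs is (lacunary w a L) \<xi> = lacunary_pd w a L is \<xi>" for "is" L \<xi>
    by (rule pd_family_pderivs[OF pd_family_lac[OF w]]) (auto simp: lacunary_def)
  have cont: "continuous_on S (lacunary_pd w a L is)" for S L "is"
  proof -
    have "continuous_on S (\<lambda>\<xi>. tens (\<lambda>s. cutoff w a s (count_list is s)) ((1/2) ^ l *\<^sub>R \<xi>))" for l
      by (rule continuous_on_compose2[OF continuous_on_tens[of _ UNIV]])
         (auto intro!: continuous_intros tower_continuous[OF cutoff_tower[OF w]])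
    then show ?thesis unfolding lacunary_pd_def[abs_def] by (intro continuous_intros)
  qed
  show "lacunary w a L \<in> mult_space" if "finite L"
    unfolding mult_space_iff
  proof (intro conjI allI)
    have "pd_family (- {0}) (lacunary_pd w a L)" using pd_family_lac[OF w, of a L] by (auto simp: pd_family_def)
    then show "smooth_on (- {0}) (lacunary w a L)" by (rule pd_family_smooth_on) (auto simp: lacunary_def cont)
    have "tens (\<lambda>s. cutoff w a s 0) (0 :: 'n vec) = 0"
      by (rule tens_cutoff_eq_0[OF w, of _ a]) simp
    then show "lacunary w a L 0 = 0" by (simp add: lacunary_alt)
    show "\<exists>C. \<forall>\<xi>. \<xi> \<noteq> 0 \<longrightarrow> weighted is (lacunary w a L) \<xi> \<le> C" for "is"
      unfolding eq using C(2)[OF that] by blast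
  qed
  have fin: "finite {is :: 'n list. length is \<le> j}"
    using finite_lists_length_le[of "UNIV :: 'n set" j] by simp
  have "weighted is (lacunary w a L) \<xi> \<le> Max (C ` {is. length is \<le> j})" if "finite L" "length is \<le> j" for L "is" \<xi>
    unfolding eq by (rule order_trans[OF C(2)[OF that(1)]], rule Max_ge) (use fin that in auto)
  moreover have "0 \<le> Max (C ` {is. length is \<le> j})"
    by (rule order_trans[OF C(1)[of "[]"]], rule Max_ge) (use fin in auto)
  ultimately show "\<exists>C\<ge>0. \<forall>L. finite L \<longrightarrow> (\<forall>is \<xi>. length is \<le> j \<longrightarrow> weighted is (lacunary w a L) \<xi> \<le> C)"
    by blast
qed

text \<open>The hypothesis on \<xi> describes the box carrying the spectrum of the i-th wave.
  Rescaled by 2^-i it stays in the plateau of the bump l = i + j. For other l the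
  \<open>a\<close>-coordinate, in [7/8, 9/8], is multiplied by at most 1/2 or at least 2, giving at
  most 9/16 or at least 7/4, outside [3/4, 5/4].\<close>

lemma lacunary_eval:
  fixes a :: "'n::finite"
  assumes w: "tower (vanishes_off (1/4)) w" "\<And>t. \<bar>t\<bar> \<le> 1/8 \<Longrightarrow> w 0 t = 1" and L: "finite L"
    and \<xi>: "\<And>s. \<bar>\<xi> $ s - (if s = a then 2 ^ i else 0)\<bar> \<le> 1/8"
  shows "lacunary w a L (2 ^ j *\<^sub>R \<xi>) = (if i + j \<in> L then 1 else 0)"
proof -
  let ?\<phi> = "tens (\<lambda>s. cutoff w a s 0)"
  have sc: "(1/2) ^ l *\<^sub>R 2 ^ j *\<^sub>R \<xi> = ((1/2) ^ l * 2 ^ (i + j)) *\<^sub>R (1/2) ^ i *\<^sub>R \<xi>" for l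
    by (simp add: power_add power_divide)
  have nr: "\<bar>((1/2) ^ i *\<^sub>R \<xi>) $ s - (if s = a then 1 else 0)\<bar> \<le> 1/8" for s
  proof -
    have "((1/2) ^ i *\<^sub>R \<xi>) $ s - (if s = a then 1 else 0) = (1/2) ^ i * (\<xi> $ s - (if s = a then 2 ^ i else 0))"
      by (auto simp: algebra_simps power_divide)
    then have "\<bar>((1/2) ^ i *\<^sub>R \<xi>) $ s - (if s = a then 1 else 0)\<bar> = (1/2) ^ i * \<bar>\<xi> $ s - (if s = a then 2 ^ i else 0)\<bar>"
      by (simp add: abs_mult)
    also have "\<dots> \<le> 1 * (1/8)" by (intro mult_mono \<xi>) (auto simp: power_le_one)
    finally show ?thesis by simp
  qed
  have hit: "?\<phi> ((1/2) ^ (i + j) *\<^sub>R 2 ^ j *\<^sub>R \<xi>) = 1"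
  proof -
    have eq: "(1/2) ^ (i + j) *\<^sub>R 2 ^ j *\<^sub>R \<xi> = (1/2) ^ i *\<^sub>R \<xi>"
      unfolding sc by (simp add: power_divide)
    have "cutoff w a s 0 (((1/2) ^ i *\<^sub>R \<xi>) $ s) = 1" for s
      unfolding cutoff_def by (rule w(2)[OF nr])
    then show ?thesis unfolding eq tens_def by (intro prod.neutral) blast
  qed
  have half_pow: "(1/2::real) ^ l * 2 ^ l = 1" for l by (simp flip: power_mult_distrib)
  have miss: "?\<phi> ((1/2) ^ l *\<^sub>R 2 ^ j *\<^sub>R \<xi>) = 0" if "l \<noteq> i + j" for l
  proof -
    define r where "r = (1/2) ^ l * (2::real) ^ (i + j)"
    define z where "z = ((1/2) ^ i *\<^sub>R \<xi>) $ a"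
    have z: "7/8 \<le> z" "z \<le> 9/8" 
    proof -
      have "\<bar>z - 1\<bar> \<le> 1/8" using nr[of a] by (simp add: z_def del: vector_scaleR_component)
      then show "7/8 \<le> z" "z \<le> 9/8" by linarith+
    qed
    have "r \<le> 1/2 \<or> r \<ge> 2"
    proof (cases "l < i + j")
      case True
      from less_imp_Suc_add[OF this] obtain d where d: "i + j = l + Suc d" by auto
      have "r = (1/2) ^ l * (2 ^ l * (2 * 2 ^ d))"
        unfolding r_def d power_add power_Suc ..
      then have "r = ((1/2) ^ l * 2 ^ l) * (2 * 2 ^ d)" by (simp only: mult.assoc)
      then have "r = 2 * 2 ^ d" by (simp only: half_pow mult_1_left)
      moreover have "(1::real) \<le> 2 ^ d" by simp
      ultimately show ?thesis by linarith
    next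
      case False
      then have "i + j < l" using that by linarith
      from less_imp_Suc_add[OF this] obtain d where d: "l = i + j + Suc d" by auto
      have "r = (1/2) ^ (i + j) * (1/2 * (1/2) ^ d) * 2 ^ (i + j)"
        unfolding r_def d power_add[of "1/2" "i + j"] power_Suc ..
      then have "r = ((1/2) ^ (i + j) * 2 ^ (i + j)) * (1/2 * (1/2) ^ d)"
        by (metis mult.assoc mult.commute)
      then have "r = 1/2 * (1/2) ^ d" by (simp only: half_pow mult_1_left)
      moreover have "(1/2::real) ^ d \<le> 1" by (simp add: power_le_one)
      ultimately show ?thesis by linarith
    qed
    then have "r * z \<le> 1/2 * (9/8) \<or> r * z \<ge> 2 * (7/8)"
    proof
      assume "r \<le> 1/2"
      then have "r * z \<le> 1/2 * (9/8)" using z by (intro mult_mono) auto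
      then show ?thesis ..
    next
      assume "r \<ge> 2"
      then have "2 * (7/8) \<le> r * z" using z by (intro mult_mono) auto
      then show ?thesis ..
    qed
    then have "\<bar>((1/2) ^ l *\<^sub>R 2 ^ j *\<^sub>R \<xi>) $ a - 1\<bar> > 1/4"
      unfolding sc r_def[symmetric] by (auto simp: z_def)
    then show ?thesis by (intro tens_cutoff_eq_0[OF w(1), of _ a]) simp
  qed
  show ?thesis
  proof (cases "i + j \<in> L")
    case True
    have "lacunary w a L (2 ^ j *\<^sub>R \<xi>) = 1 + (\<Sum>l\<in>L - {i + j}. ?\<phi> ((1/2) ^ l *\<^sub>R 2 ^ j *\<^sub>R \<xi>))"
      unfolding lacunary_alt by (subst sum.remove[OF L True]) (simp only: hit)
    also have "(\<Sum>l\<in>L - {i + j}. ?\<phi> ((1/2) ^ l *\<^sub>R 2 ^ j *\<^sub>R \<xi>)) = 0"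
      by (rule sum.neutral) (use miss in blast)
    finally show ?thesis using True by simp
  next
    case False
    have "lacunary w a L (2 ^ j *\<^sub>R \<xi>) = 0"
      unfolding lacunary_alt
    proof (intro sum.neutral ballI)
      fix l assume "l \<in> L"
      then have "l \<noteq> i + j" using False by auto
      then show "?\<phi> ((1/2) ^ l *\<^sub>R 2 ^ j *\<^sub>R \<xi>) = 0" by (rule miss)
    qed
    then show ?thesis using False by simp
  qed
qed

section \<open>Lacunary wave trains\<close>

abbreviation phase :: "'n::finite vec \<Rightarrow> 'n vec \<Rightarrow> complex" where
  "phase x \<xi> \<equiv> cis (2 * pi * (x \<bullet> \<xi>))"

lemma lborel_integral_shift:
  fixes f :: "'a::euclidean_space \<Rightarrow> 'b::{banach, second_countable_topology}"
  assumes "f \<in> borel_measurable borel"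
  shows "(LINT x|lborel. f (x - c)) = (LINT x|lborel. f x)"
    and "integrable lborel (\<lambda>x. f (x - c)) \<longleftrightarrow> integrable lborel f"
proof -
  have m: "(+) (- c) \<in> measurable lborel borel" by simp
  have d: "distr lborel borel ((+) (- c)) = (lborel :: 'a measure)" by (rule lborel_distr_plus)
  show "(LINT x|lborel. f (x - c)) = (LINT x|lborel. f x)"
    using integral_distr[OF m assms] unfolding d by simp
  show "integrable lborel (\<lambda>x. f (x - c)) \<longleftrightarrow> integrable lborel f"
    using integrable_distr_eq[OF m assms] unfolding d by simp
qed

lemma fourier_modulate: "fourier (\<lambda>x. f x * phase x c) \<xi> = fourier f (\<xi> - c)"
  unfolding fourier_def
proof (rule Bochner_Integration.integral_cong[OF refl])
  fix x
  have "phase x c * cis (- 2 * pi * (x \<bullet> \<xi>)) = cis (- 2 * pi * (x \<bullet> (\<xi> - c)))"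
    by (simp add: cis_mult inner_diff_right algebra_simps)
  then show "f x * phase x c * cis (- 2 * pi * (x \<bullet> \<xi>)) = f x * cis (- 2 * pi * (x \<bullet> (\<xi> - c)))"
    by (simp only: mult.assoc)
qed

lemma inv_fourier_shift:
  assumes [measurable]: "f \<in> borel_measurable borel"
  shows "inv_fourier (\<lambda>\<xi>. f (\<xi> - c)) x = inv_fourier f x * phase x c"
proof -
  have "inv_fourier (\<lambda>\<xi>. f (\<xi> - c)) x = (LINT \<xi>|lborel. (\<lambda>\<eta>. f \<eta> * phase x (\<eta> + c)) (\<xi> - c))"
    by (simp add: inv_fourier_def)
  also have "\<dots> = (LINT \<eta>|lborel. f \<eta> * phase x (\<eta> + c))"
    by (rule lborel_integral_shift) measurable
  also have "\<dots> = (LINT \<eta>|lborel. f \<eta> * phase x \<eta> * phase x c)"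
    by (rule Bochner_Integration.integral_cong) (auto simp: mult.assoc cis_mult inner_add_right distrib_left)
  also have "\<dots> = inv_fourier f x * phase x c"
    unfolding inv_fourier_def by (rule integral_mult_left_zero)
  finally show ?thesis .
qed

locale window =
  fixes D :: "nat \<Rightarrow> real \<Rightarrow> complex" and a :: "'n::finite"
  assumes D: "band_window D"
begin

definition g :: "'n vec \<Rightarrow> complex" where "g = tens (\<lambda>_. D 0)"

definition e :: "nat \<Rightarrow> 'n vec" where "e i = 2 ^ i *\<^sub>R axis a 1"

definition wave :: "nat \<Rightarrow> 'n vec \<Rightarrow> complex" where "wave i x = g x * phase x (e i)"

definition I :: real where "I = (LINT x|lborel. norm (g x))"

text \<open>The second equation expresses nonnegativity in the form in which the complex weight is
  exchanged for its modulus.\<close>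

lemma g_real: "norm (g x) \<le> 1" "g x = complex_of_real (norm (g x))"
proof -
  obtain r where r: "\<And>t. 0 \<le> r t \<and> r t \<le> 1 \<and> D 0 t = complex_of_real (r t)"
    using D unfolding band_window_def by metis
  have "g x = complex_of_real (\<Prod>s\<in>UNIV. r (x $ s))"
    by (simp add: g_def tens_def r)
  moreover have "0 \<le> (\<Prod>s\<in>UNIV. r (x $ s))" using r by (intro prod_nonneg) auto
  moreover have "(\<Prod>s\<in>UNIV. r (x $ s)) \<le> 1" using r by (intro prod_le_1) auto
  ultimately obtain R where "g x = complex_of_real R" "0 \<le> R" "R \<le> 1" by blast
  then show "norm (g x) \<le> 1" "g x = complex_of_real (norm (g x))" by auto
qed

lemma g_integrable: "integrable lborel g"
  unfolding g_def by (intro tens_integral band_window_integrable[OF D])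

lemma g_measurable [measurable]: "g \<in> borel_measurable borel"
  using g_integrable by auto

lemma g_continuous: "continuous_on UNIV g"
  unfolding g_def using D by (intro continuous_on_tens) (auto simp: band_window_def intro: tower_continuous)

lemma g_near_0: "\<exists>\<rho>>0. \<forall>x\<in>cball 0 \<rho>. norm (g x) \<ge> 1/2"
proof -
  have "g 0 = 1" using D by (simp add: g_def tens_def band_window_def)
  moreover have "isCont g 0" using g_continuous by (simp add: continuous_on_eq_continuous_at)
  ultimately obtain d where d: "d > 0" "\<And>x. dist x 0 < d \<Longrightarrow> dist (g x) 1 < 1/2"
    unfolding continuous_at_eps_delta by (metis half_gt_zero zero_less_one)
  have "norm (g x) \<ge> 1/2" if "x \<in> cball 0 (d/2)" for x
  proof -
    have "dist (g x) 1 < 1/2" using that d by (intro d(2)) auto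
    then show ?thesis using norm_triangle_ineq2[of 1 "g x"] by (simp add: dist_norm norm_minus_commute)
  qed
  then show ?thesis using d(1) by (intro exI[of _ "d/2"]) auto
qed

lemma I_pos: "I > 0"
proof -
  obtain \<rho> where r: "\<rho> > 0" "\<And>x. x \<in> cball 0 \<rho> \<Longrightarrow> norm (g x) \<ge> 1/2" using g_near_0 by blast
  have fin: "emeasure lborel (cball (0 :: 'n vec) \<rho>) < \<infinity>" by (rule emeasure_lborel_cball_finite)
  have "0 < measure lborel (cball (0 :: 'n vec) \<rho>) * (1/2)"
    using content_cball_pos[OF r(1), of "0 :: 'n vec"] by simp
  also have "\<dots> = (LINT x|lborel. indicator (cball (0 :: 'n vec) \<rho>) x * (1/2))"
    using fin by simp
  also have "\<dots> \<le> I"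
    unfolding I_def
  proof (rule integral_mono)
    show "integrable lborel (\<lambda>x. indicator (cball (0 :: 'n vec) \<rho>) x * (1/2::real))" using fin by simp
    show "integrable lborel (\<lambda>x. norm (g x))" using g_integrable by simp
    show "indicator (cball 0 \<rho>) x * (1/2) \<le> norm (g x)" for x
      using r(2)[of x] by (auto simp: indicator_def)
  qed
  finally show ?thesis .
qed

lemma inv_fourier_g: "inv_fourier g \<xi> = tens (\<lambda>_. ift (D 0)) \<xi>"
  unfolding g_def by (rule inv_fourier_tens[OF band_window_integrable[OF D]])

lemma fourier_g: "fourier g \<xi> = tens (\<lambda>_ t. ift (D 0) (- t)) \<xi>"
  unfolding fourier_eq_inv_fourier inv_fourier_g by (simp add: tens_def)

lemma spec_integrable: "integrable lborel (\<lambda>t. ift (D 0) (- t))"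
  using lborel_integrable_real_affine[of "ift (D 0)" "-1" 0] band_window_spectrum_integrable[OF D] by simp

lemma fourier_g_integrable: "integrable lborel (fourier g)"
proof -
  have "fourier g = tens (\<lambda>_ t. ift (D 0) (- t))" by (auto simp: fourier_g)
  then show ?thesis using tens_integral(1)[OF spec_integrable] by simp
qed

lemma fourier_g_measurable [measurable]: "fourier g \<in> borel_measurable borel"
  using fourier_g_integrable by auto

lemma fourier_g_eq_0: "\<bar>\<xi> $ s\<bar> > 1/8 \<Longrightarrow> fourier g \<xi> = 0"
  using D unfolding fourier_g by (intro tens_eq_0[of _ s]) (auto simp: band_window_def vanishes_off_def)

lemma inv_fourier_fourier_g: "inv_fourier (fourier g) x = g x"
proof -
  have "fourier g = tens (\<lambda>_ t. ift (D 0) (- t))" by (auto simp: fourier_g)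
  then have "inv_fourier (fourier g) x = tens (\<lambda>_. ift (\<lambda>t. ift (D 0) (- t))) x"
    using inv_fourier_tens[OF spec_integrable] by simp
  moreover have "ift (\<lambda>t. ift (D 0) (- t)) y = D 0 y" for y
  proof -
    have "ift (\<lambda>t. ift (D 0) (- t)) y = ift (ift (D 0)) (- y)"
      unfolding ift_def[of _ y] ift_def[of _ "- y"]
      by (subst lborel_integral_real_affine[where c="-1" and t=0]) auto
    then show ?thesis by (simp add: band_window_inversion[OF D])
  qed
  ultimately show ?thesis by (simp add: g_def tens_def)
qed

lemma fourier_wave: "fourier (wave i) \<xi> = fourier g (\<xi> - e i)"
  unfolding wave_def[abs_def] by (rule fourier_modulate)

lemma fourier_wave_integrable: "integrable lborel (fourier (wave i))"
  using fourier_g_integrable by (simp add: fourier_wave[abs_def] lborel_integral_shift(2))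

lemma inv_fourier_fourier_wave: "inv_fourier (fourier (wave i)) x = wave i x"
  by (simp add: fourier_wave[abs_def] inv_fourier_shift inv_fourier_fourier_g wave_def)

lemma e_nth: "e i $ s = (if s = a then 2 ^ i else 0)"
  by (simp add: e_def axis_def)

lemma fourier_wave_eq_0:
  assumes "\<bar>\<xi> $ s - (if s = a then 2 ^ i else 0)\<bar> > 1/8"
  shows "fourier (wave i) \<xi> = 0"
  unfolding fourier_wave by (rule fourier_g_eq_0[of _ s]) (use assms in \<open>simp add: e_nth\<close>)

lemma wave_integrable: "integrable lborel (wave i)"
  unfolding wave_def[abs_def]
  by (rule integrable_mult_bounded[OF g_integrable, where C=1]) (auto simp: inner_commute)

text \<open>The exponential depends on the coordinate \<open>a\<close> alone, so the wave is a
  tensor product with one modulated factor.\<close>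

lemma wave_schwartz: "wave i \<in> schwartz"
proof -
  let ?c = "2 * pi * 2 ^ i :: real"
  have cis: "tower (\<lambda>u. \<exists>B. \<forall>t. norm (u t) \<le> B) (\<lambda>k t. (\<i> * ?c) ^ k * cis (?c * t))"
  proof (rule towerI)
    fix k t
    have "\<forall>t. norm ((\<i> * ?c) ^ k * cis (?c * t)) \<le> ?c ^ k" by (simp add: norm_mult norm_power)
    then show "\<exists>B. \<forall>t. norm ((\<i> * ?c) ^ k * cis (?c * t)) \<le> B" by blast
    have "((\<lambda>t. (\<i> * ?c) ^ k * cis (?c * t)) has_vector_derivative (\<i> * ?c) ^ k * (\<i> * ?c * cis (?c * t))) (at t)"
      by (intro has_vector_derivative_mult_right cis_linear_deriv)
    then show "((\<lambda>t. (\<i> * ?c) ^ k * cis (?c * t)) has_vector_derivative (\<i> * ?c) ^ Suc k * cis (?c * t)) (at t)"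
      by (simp add: mult_ac)
  qed
  have Dr: "tower rapid D" using D by (simp add: band_window_def)
  define W where "W = (\<lambda>k. leibniz D (\<lambda>k t. (\<i> * ?c) ^ k * cis (?c * t)) k 0 0)"
  have W: "tower rapid W"
    unfolding W_def by (rule tower_mult[OF Dr cis]) (auto intro: rapid_mult_bounded rapid_add)
  define U where "U s = (if s = a then W else D)" for s
  have "tens (\<lambda>s. U s 0) \<in> schwartz"
    by (rule schwartz_tens) (simp add: U_def Dr W)
  moreover have "tens (\<lambda>s. U s 0) = wave i"
  proof
    fix x
    have "tens (\<lambda>s. U s 0) x = U a 0 (x $ a) * (\<Prod>s\<in>UNIV - {a}. U s 0 (x $ s))"
      unfolding tens_def by (rule prod.remove) auto
    also have "(\<Prod>s\<in>UNIV - {a}. U s 0 (x $ s)) = (\<Prod>s\<in>UNIV - {a}. D 0 (x $ s))"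
      by (rule prod.cong) (auto simp: U_def)
    also have "U a 0 (x $ a) = D 0 (x $ a) * phase x (e i)"
      by (simp add: U_def W_def e_def inner_axis mult_ac)
    also have "D 0 (x $ a) * phase x (e i) * (\<Prod>s\<in>UNIV - {a}. D 0 (x $ s)) = wave i x"
      unfolding wave_def g_def tens_def by (subst prod.remove[of UNIV a]) (auto simp: mult_ac)
    finally show "tens (\<lambda>s. U s 0) x = wave i x" .
  qed
  ultimately show ?thesis by simp
qed

definition S :: "nat \<Rightarrow> 'n vec \<Rightarrow> complex" where "S n x = (\<Sum>i<n. phase x (e i))"

lemma S_measurable [measurable]: "S n \<in> borel_measurable borel"
  unfolding S_def[abs_def] by (auto simp: inner_commute)

lemma S_bound: "norm (S n x) \<le> n"
  using sum_norm_le[of "{..<n}" "\<lambda>i. phase x (e i)" "\<lambda>_. 1"] by (simp add: S_def)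

text \<open>The integral is the Fourier transform of \<open>g\<close> at the difference of two
  frequencies, which leaves the spectrum of \<open>g\<close> as soon as the frequencies
  differ.\<close>

lemma wave_orthogonal:
  "(LINT x|lborel. g x * phase x (e i - e l)) = (if i = l then of_real I else 0)"
proof (cases "i = l")
  case True
  have "(LINT x|lborel. g x) = (LINT x|lborel. complex_of_real (norm (g x)))"
    by (rule Bochner_Integration.integral_cong[OF refl g_real(2)])
  then show ?thesis using True by (simp add: I_def)
next
  case False
  have "(LINT x|lborel. g x * phase x (e i - e l)) = inv_fourier g (e i - e l)"
    unfolding inv_fourier_def by (simp add: inner_commute)
  also have "\<dots> = fourier g (- (e i - e l))" by (simp add: fourier_eq_inv_fourier)
  also have "\<dots> = 0"
  proof (rule fourier_g_eq_0[of _ a])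
    \<comment> \<open>Over the integers, distinct powers differ by at least 1, well above the
      spectral radius 1/8.\<close>
    have "(2::int) ^ i \<noteq> 2 ^ l" using False by simp
    then have "\<bar>(2::int) ^ i - 2 ^ l\<bar> \<ge> 1" by linarith
    then have "real_of_int \<bar>(2::int) ^ i - 2 ^ l\<bar> \<ge> real_of_int 1" by (simp only: of_int_le_iff)
    then have "\<bar>(2::real) ^ i - 2 ^ l\<bar> \<ge> 1" by simp
    then show "1/8 < \<bar>(- (e i - e l)) $ a\<bar>" by (simp add: e_nth abs_minus_commute)
  qed
  finally show ?thesis using False by simp
qed

lemma S_L2: "(LINT x|lborel. norm (g x) * (norm (S n x))\<^sup>2) = n * I"
proof -
  have int: "integrable lborel (\<lambda>x. g x * phase x (e i - e l))" for i l
    by (rule integrable_mult_bounded[OF g_integrable, where C=1]) (auto simp: inner_commute)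
  have "complex_of_real (LINT x|lborel. norm (g x) * (norm (S n x))\<^sup>2)
      = (LINT x|lborel. complex_of_real (norm (g x) * (norm (S n x))\<^sup>2))"
    by (rule integral_complex_of_real[symmetric])
  also have "\<dots> = (LINT x|lborel. (\<Sum>i<n. \<Sum>l<n. g x * phase x (e i - e l)))"
  proof (rule Bochner_Integration.integral_cong[OF refl])
    fix x
    have "complex_of_real ((norm (S n x))\<^sup>2) = S n x * cnj (S n x)" by (rule complex_norm_square)
    also have "\<dots> = (\<Sum>i<n. \<Sum>l<n. phase x (e i) * cnj (phase x (e l)))"
      unfolding S_def by (simp only: cnj_sum sum_product)
    also have "\<dots> = (\<Sum>i<n. \<Sum>l<n. phase x (e i - e l))"
      by (simp add: cis_cnj cis_mult inner_diff_right right_diff_distrib)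
    finally show "complex_of_real (norm (g x) * (norm (S n x))\<^sup>2) = (\<Sum>i<n. \<Sum>l<n. g x * phase x (e i - e l))"
      using g_real(2)[of x] by (simp add: sum_distrib_left)
  qed
  also have "\<dots> = (\<Sum>i<n. \<Sum>l<n. LINT x|lborel. g x * phase x (e i - e l))"
    using int by (subst Bochner_Integration.integral_sum, force intro!: Bochner_Integration.integrable_sum)
                 (intro sum.cong refl Bochner_Integration.integral_sum)
  also have "\<dots> = (\<Sum>i<n. \<Sum>l<n. if i = l then of_real I else 0)"
    by (simp only: wave_orthogonal)
  also have "\<dots> = complex_of_real (n * I)" by simp
  finally show ?thesis by (simp only: of_real_eq_iff)
qed

lemma gS_integrable: "integrable lborel (\<lambda>x. norm (g x) * norm (S n x))"
  "integrable lborel (\<lambda>x. norm (g x) * (norm (S n x))\<^sup>2)"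
proof -
  have gi: "integrable lborel (\<lambda>x. norm (g x))" using g_integrable by simp
  show "integrable lborel (\<lambda>x. norm (g x) * norm (S n x))"
    by (rule integrable_mult_bounded[OF gi, where C=n]) (auto simp: S_bound)
  show "integrable lborel (\<lambda>x. norm (g x) * (norm (S n x))\<^sup>2)"
    by (rule integrable_mult_bounded[OF gi, where C="(real n)\<^sup>2"]) (auto simp: S_bound power_mono)
qed

text \<open>Integrate the pointwise inequality s <= \<rho>/2 + s^2 / (2 \<rho>) against the weight
  and insert \<open>S_L2\<close>; the choice \<rho> = \<open>sqrt n\<close> makes the two halves
  equal.\<close>

lemma S_L1: 
  assumes "n > 0"
  shows "(LINT x|lborel. norm (g x) * norm (S n x)) \<le> sqrt n * I"
proof -
  define \<rho> where "\<rho> = sqrt (real n)"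
  have r: "\<rho> > 0" "\<rho> * \<rho> = n" using assms by (auto simp: \<rho>_def)
  have "(LINT x|lborel. norm (g x) * norm (S n x))
      \<le> (LINT x|lborel. \<rho> / 2 * norm (g x) + 1 / (2 * \<rho>) * (norm (g x) * (norm (S n x))\<^sup>2))"
  proof (rule integral_mono)
    fix x
    have "0 \<le> (\<rho> - norm (S n x))\<^sup>2 / (2 * \<rho>)" using r by simp
    also have "\<dots> = (\<rho> * \<rho> - 2 * \<rho> * norm (S n x) + (norm (S n x))\<^sup>2) / (2 * \<rho>)"
    proof -
      have "(\<rho> - norm (S n x))\<^sup>2 = \<rho> * \<rho> - 2 * \<rho> * norm (S n x) + (norm (S n x))\<^sup>2"
        by (simp add: power2_eq_square algebra_simps)
      then show ?thesis by (rule arg_cong)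
    qed
    also have "\<dots> = \<rho> / 2 - norm (S n x) + (norm (S n x))\<^sup>2 / (2 * \<rho>)"
      using r(1) by (simp add: field_simps)
    finally have "norm (S n x) \<le> \<rho> / 2 + 1 / (2 * \<rho>) * (norm (S n x))\<^sup>2" by simp
    then have "norm (g x) * norm (S n x) \<le> norm (g x) * (\<rho> / 2 + 1 / (2 * \<rho>) * (norm (S n x))\<^sup>2)"
      by (rule mult_left_mono) simp
    then show "norm (g x) * norm (S n x) \<le> \<rho> / 2 * norm (g x) + 1 / (2 * \<rho>) * (norm (g x) * (norm (S n x))\<^sup>2)"
      by (simp add: algebra_simps)
  qed (use gS_integrable g_integrable in auto)
  also have "\<dots> = \<rho> / 2 * I + 1 / (2 * \<rho>) * (n * I)"
    using gS_integrable[of n] g_integrable S_L2[of n] by (simp add: I_def)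
  also have "\<dots> = \<rho> * I"
  proof -
    have "1 / (2 * \<rho>) * (n * I) = \<rho> / 2 * I"
      using r(1) unfolding r(2)[symmetric] by (simp add: field_simps)
    then show ?thesis unfolding \<open>1 / (2 * \<rho>) * (n * I) = \<rho> / 2 * I\<close> by simp
  qed
  finally show ?thesis by (simp add: \<rho>_def)
qed

end

section \<open>Dilated multipliers\<close>

lemma mult_space_measurable:
  assumes "m \<in> mult_space" shows "m \<in> borel_measurable borel"
proof -
  have "continuous_on (- {0}) (pderivs [] m)" using assms unfolding mult_space_iff smooth_on_def by blast
  then have "(\<lambda>\<xi>. indicator (- {0}) \<xi> *\<^sub>R m \<xi>) \<in> borel_measurable borel"
    by (intro borel_measurable_continuous_on_indicator) auto
  moreover have "(\<lambda>\<xi>. indicator (- {0}) \<xi> *\<^sub>R m \<xi>) = m"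
    using assms by (auto simp: fun_eq_iff indicator_def mult_space_iff)
  ultimately show ?thesis by simp
qed

text \<open>Nonnegative powers of 2 suffice for lower bounds on the maximal function.\<close>

definition dilate_op :: "('n::finite vec \<Rightarrow> complex) \<Rightarrow> ('n vec \<Rightarrow> complex) \<Rightarrow> nat \<Rightarrow> 'n vec \<Rightarrow> complex" where
  "dilate_op m f j x = inv_fourier (\<lambda>\<xi>. m (2 ^ j *\<^sub>R \<xi>) * fourier f \<xi>) x"

lemma dilate_op_le_dyadic_max: "ennreal (norm (dilate_op m f j x)) \<le> dyadic_max m f x"
  unfolding dyadic_max_def dilate_op_def
  by (rule SUP_upper2[of "int j"]) (auto simp: powr_realpow)

lemma dilate_op_integrable:
  assumes m: "m \<in> mult_space" and F: "integrable lborel (fourier f)"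
  shows "integrable lborel (\<lambda>\<xi>. m (2 ^ j *\<^sub>R \<xi>) * fourier f \<xi> * phase x \<xi>)"
proof -
  note [measurable] = mult_space_measurable[OF m]
  have "integrable lborel (\<lambda>\<xi>. fourier f \<xi> * (m (2 ^ j *\<^sub>R \<xi>) * phase x \<xi>))"
    by (rule integrable_mult_bounded[OF F, where C="snorm 0 m"]) (auto simp: norm_mult norm_le_snorm[OF m])
  then show ?thesis by (simp add: mult_ac)
qed

lemma dilate_op_lincomb:
  assumes "m1 \<in> mult_space" "m2 \<in> mult_space" "integrable lborel (fourier f)"
  shows "dilate_op (\<lambda>\<xi>. m1 \<xi> + c * m2 \<xi>) f j x = dilate_op m1 f j x + c * dilate_op m2 f j x"
proof -
  have "dilate_op (\<lambda>\<xi>. m1 \<xi> + c * m2 \<xi>) f j x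
      = (LINT \<xi>|lborel. m1 (2 ^ j *\<^sub>R \<xi>) * fourier f \<xi> * phase x \<xi> + c * (m2 (2 ^ j *\<^sub>R \<xi>) * fourier f \<xi> * phase x \<xi>))"
    unfolding dilate_op_def inv_fourier_def by (rule Bochner_Integration.integral_cong) (auto simp: algebra_simps)
  also have "\<dots> = dilate_op m1 f j x + c * dilate_op m2 f j x"
    unfolding dilate_op_def inv_fourier_def
    using dilate_op_integrable[OF assms(1,3), of j x] dilate_op_integrable[OF assms(2,3), of j x]
    by (subst Bochner_Integration.integral_add) auto
  finally show ?thesis .
qed

text \<open>The bound is uniform in j, which provides equicontinuity of all dilates; the phase has
  to be controlled only on the spectrum of \<open>f\<close>.\<close>

lemma dilate_op_diff_bound:
  assumes m: "m \<in> mult_space" "\<And>\<xi>. norm (m \<xi>) \<le> B" and F: "integrable lborel (fourier f)"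
    and d: "\<And>\<xi>. fourier f \<xi> \<noteq> 0 \<Longrightarrow> norm (phase x \<xi> - phase y \<xi>) \<le> d"
  shows "norm (dilate_op m f j x - dilate_op m f j y) \<le> B * d * (LINT \<xi>|lborel. norm (fourier f \<xi>))"
proof -
  have "B \<ge> 0" using m(2)[of 0] norm_ge_zero order_trans by blast
  have "dilate_op m f j x - dilate_op m f j y
      = (LINT \<xi>|lborel. m (2 ^ j *\<^sub>R \<xi>) * fourier f \<xi> * phase x \<xi> - m (2 ^ j *\<^sub>R \<xi>) * fourier f \<xi> * phase y \<xi>)"
    unfolding dilate_op_def inv_fourier_def
    by (rule Bochner_Integration.integral_diff[symmetric]) (rule dilate_op_integrable[OF m(1) F])+
  also have "norm \<dots> \<le> (LINT \<xi>|lborel. B * d * norm (fourier f \<xi>))"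
  proof (rule order_trans[OF integral_norm_bound], rule integral_mono)
    show "integrable lborel (\<lambda>\<xi>. norm (m (2 ^ j *\<^sub>R \<xi>) * fourier f \<xi> * phase x \<xi> - m (2 ^ j *\<^sub>R \<xi>) * fourier f \<xi> * phase y \<xi>))"
      by (intro integrable_norm Bochner_Integration.integrable_diff dilate_op_integrable[OF m(1) F])
    show "integrable lborel (\<lambda>\<xi>. B * d * norm (fourier f \<xi>))" using F by simp
    fix \<xi>
    have "norm (m (2 ^ j *\<^sub>R \<xi>) * fourier f \<xi> * phase x \<xi> - m (2 ^ j *\<^sub>R \<xi>) * fourier f \<xi> * phase y \<xi>)
        = norm (m (2 ^ j *\<^sub>R \<xi>)) * (norm (phase x \<xi> - phase y \<xi>) * norm (fourier f \<xi>))"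
      by (simp add: mult_ac flip: norm_mult right_diff_distrib)
    also have "\<dots> \<le> B * (d * norm (fourier f \<xi>))"
    proof (cases "fourier f \<xi> = 0")
      case False
      then show ?thesis using d[of \<xi>] m(2) \<open>B \<ge> 0\<close> by (intro mult_mono mult_right_mono) auto
    qed simp
    finally show "norm (m (2 ^ j *\<^sub>R \<xi>) * fourier f \<xi> * phase x \<xi> - m (2 ^ j *\<^sub>R \<xi>) * fourier f \<xi> * phase y \<xi>) \<le> B * d * norm (fourier f \<xi>)"
      by (simp add: mult.assoc)
  qed
  finally show ?thesis by simp
qed

lemma dilate_op_bound:
  assumes m: "m \<in> mult_space" "\<And>\<xi>. norm (m \<xi>) \<le> B" and F: "integrable lborel (fourier f)"
  shows "norm (dilate_op m f j x) \<le> B * (LINT \<xi>|lborel. norm (fourier f \<xi>))"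
proof -
  have "norm (dilate_op m f j x) \<le> (LINT \<xi>|lborel. norm (m (2 ^ j *\<^sub>R \<xi>) * fourier f \<xi> * phase x \<xi>))"
    unfolding dilate_op_def inv_fourier_def by (rule integral_norm_bound)
  also have "\<dots> \<le> (LINT \<xi>|lborel. B * norm (fourier f \<xi>))"
  proof (rule integral_mono)
    show "integrable lborel (\<lambda>\<xi>. norm (m (2 ^ j *\<^sub>R \<xi>) * fourier f \<xi> * phase x \<xi>))"
      by (intro integrable_norm dilate_op_integrable[OF m(1) F])
    show "integrable lborel (\<lambda>\<xi>. B * norm (fourier f \<xi>))" using F by simp
    show "norm (m (2 ^ j *\<^sub>R \<xi>) * fourier f \<xi> * phase x \<xi>) \<le> B * norm (fourier f \<xi>)" for \<xi>
      using m(2) by (simp add: norm_mult mult_right_mono)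
  qed
  finally show ?thesis by simp
qed

lemma cis_lipschitz: "norm (cis s - cis t) \<le> \<bar>s - t\<bar>"
proof -
  have "cis s = cis t * cis (s - t)" by (simp add: cis_mult)
  then have "norm (cis s - cis t) = norm (cis t * (cis (s - t) - 1))" by (simp add: right_diff_distrib)
  also have "\<dots> = norm (iexp (s - t) - (\<Sum>k\<le>0. (\<i> * (s - t)) ^ k / fact k))"
    by (simp add: norm_mult cis_conv_exp)
  also have "\<dots> \<le> \<bar>s - t\<bar>"
    using iexp_approx1[of "s - t" 0] by simp
  finally show ?thesis .
qed

lemma phase_lipschitz: "norm (phase x \<xi> - phase y \<xi>) \<le> 2 * pi * norm \<xi> * norm (x - y)"
proof -
  have "norm (phase x \<xi> - phase y \<xi>) \<le> \<bar>2 * pi * (x \<bullet> \<xi>) - 2 * pi * (y \<bullet> \<xi>)\<bar>" by (rule cis_lipschitz)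
  also have "\<dots> = 2 * pi * \<bar>(x - y) \<bullet> \<xi>\<bar>"
    by (simp add: inner_diff_left abs_mult flip: right_diff_distrib)
  also have "\<dots> \<le> 2 * pi * (norm (x - y) * norm \<xi>)"
    by (intro mult_left_mono Cauchy_Schwarz_ineq2) auto
  finally show ?thesis by (simp add: mult_ac)
qed

text \<open>Since |z| <= |Re z| + |Im z|, the positive parts of Re z, -Re z, Im z, -Im z sum to at
  least the cardinality. One of the four carries a quarter of it, and projecting the sum over its
  positive terms on that direction loses nothing of that part.\<close>

lemma subset_sum_quarter:
  fixes z :: "'b \<Rightarrow> complex"
  assumes A: "finite A" and z: "\<And>i. i \<in> A \<Longrightarrow> norm (z i) = 1"
  shows "\<exists>E\<subseteq>A. norm (\<Sum>i\<in>E. z i) \<ge> card A / 4"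
proof -
  define P where "P h = (\<Sum>i\<in>{i\<in>A. h i > 0}. h i)" for h :: "'b \<Rightarrow> real"
  have P: "P h = (\<Sum>i\<in>A. max (h i) 0)" for h
    unfolding P_def by (rule sum.mono_neutral_cong_left) (use A in auto)
  have "real (card A) = (\<Sum>i\<in>A. norm (z i))" using z by simp
  also have "\<dots> \<le> (\<Sum>i\<in>A. max (Re (z i)) 0 + max (- Re (z i)) 0 + (max (Im (z i)) 0 + max (- Im (z i)) 0))"
  proof (rule sum_mono)
    fix i
    have "norm (z i) \<le> \<bar>Re (z i)\<bar> + \<bar>Im (z i)\<bar>" by (rule cmod_le)
    then show "norm (z i) \<le> max (Re (z i)) 0 + max (- Re (z i)) 0 + (max (Im (z i)) 0 + max (- Im (z i)) 0)"
      by (simp add: max_def abs_if split: if_splits)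
  qed
  also have "\<dots> = P (\<lambda>i. Re (z i)) + P (\<lambda>i. - Re (z i)) + (P (\<lambda>i. Im (z i)) + P (\<lambda>i. - Im (z i)))"
    by (simp add: P sum.distrib)
  finally have "\<exists>h\<in>{\<lambda>i. Re (z i), \<lambda>i. - Re (z i), \<lambda>i. Im (z i), \<lambda>i. - Im (z i)}. P h \<ge> card A / 4"
    by simp linarith
  then obtain h where h: "h \<in> {\<lambda>i. Re (z i), \<lambda>i. - Re (z i), \<lambda>i. Im (z i), \<lambda>i. - Im (z i)}" "P h \<ge> card A / 4" by blast
  define E where "E = {i\<in>A. h i > 0}"
  have "P h \<le> norm (\<Sum>i\<in>E. z i)"
    using h(1) abs_Re_le_cmod[of "\<Sum>i\<in>E. z i"] abs_Im_le_cmod[of "\<Sum>i\<in>E. z i"]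
    by (auto simp: P_def E_def[symmetric] sum_negf)
  then show ?thesis using h(2) by (intro exI[of _ E]) (auto simp: E_def)
qed

lemma enn_powr_mono_lower:
  assumes "ennreal c \<le> u" "c \<ge> 0" "p \<ge> 0" shows "ennreal (c powr p) \<le> enn_powr u p"
proof (cases "u = top")
  case False
  then have "c \<le> enn2real u" using assms(1,2) by (metis enn2real_ennreal enn2real_mono less_top)
  then show ?thesis using False assms by (auto simp: enn_powr_def intro!: ennreal_leI powr_mono2)
qed (simp add: enn_powr_def)

lemma Lp_pow_lower:
  assumes "\<And>x. x \<in> B \<Longrightarrow> ennreal c \<le> F x" "c \<ge> 0" "p \<ge> 0" "B \<in> sets borel"
  shows "ennreal (c powr p) * emeasure lborel B \<le> Lp_pow p F"
proof -
  have "ennreal (c powr p) * emeasure lborel B = (\<integral>\<^sup>+x. ennreal (c powr p) * indicator B x \<partial>lborel)"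
    using assms(4) by (simp add: nn_integral_cmult_indicator)
  also have "\<dots> \<le> Lp_pow p F"
    unfolding Lp_pow_def
    by (rule nn_integral_mono) (use assms in \<open>auto simp: indicator_def intro: enn_powr_mono_lower\<close>)
  finally show ?thesis .
qed

section \<open>The dilated symbols acting on a wave train\<close>

context window
begin

definition train :: "nat \<Rightarrow> 'n vec \<Rightarrow> complex" where "train n x = (\<Sum>i<n. wave i x)"

lemma train_eq: "train n x = g x * S n x"
  by (simp add: train_def wave_def S_def sum_distrib_left)

lemma fourier_train: "fourier (train n) \<xi> = (\<Sum>i<n. fourier (wave i) \<xi>)"
proof -
  have "integrable lborel (\<lambda>x. wave i x * cis (- 2 * pi * (x \<bullet> \<xi>)))" for i
    by (rule integrable_mult_bounded[OF wave_integrable, where C=1]) (auto simp: inner_commute)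
  then show ?thesis
    unfolding fourier_def train_def sum_distrib_right by (rule Bochner_Integration.integral_sum)
qed

lemma fourier_train_integrable: "integrable lborel (fourier (train n))"
  unfolding fourier_train[abs_def] by (intro Bochner_Integration.integrable_sum fourier_wave_integrable)

text \<open>Here 7/8 = 1 - 1/8, from the lowest frequency 1. Together the bounds put the spectrum in
  a compact set away from 0; the second also controls the Lipschitz constant of the dilates.\<close>

lemma fourier_train_support:
  assumes "fourier (train n) \<xi> \<noteq> 0"
  shows "\<xi> $ a \<ge> 7/8" "norm \<xi> \<le> 2 * 2 ^ n * CARD('n)"
proof -
  obtain i where i: "i < n" "fourier (wave i) \<xi> \<noteq> 0"
    using assms unfolding fourier_train by (rule sum.not_neutral_contains_not_neutral) auto
  have b: "\<bar>\<xi> $ s - (if s = a then 2 ^ i else 0)\<bar> \<le> 1/8" for s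
    using fourier_wave_eq_0 i(2) not_le by blast
  have "(1::real) \<le> 2 ^ i" by simp
  moreover have "\<bar>\<xi> $ a - 2 ^ i\<bar> \<le> 1/8" using b[of a] by simp
  ultimately show "\<xi> $ a \<ge> 7/8" by linarith
  have "\<bar>\<xi> $ s\<bar> \<le> 2 * 2 ^ n" for s
  proof -
    have "(2::real) ^ i \<le> 2 ^ n" "(1::real) \<le> 2 ^ n" using i(1) by auto
    show ?thesis
    proof (cases "s = a")
      case True
      then have "\<bar>\<xi> $ s - 2 ^ i\<bar> \<le> 1/8" using b[of s] by simp
      then show ?thesis using \<open>(2::real) ^ i \<le> 2 ^ n\<close> \<open>(1::real) \<le> 2 ^ n\<close> zero_le_power[of "2::real" i] by linarith
    next
      case False
      then have "\<bar>\<xi> $ s\<bar> \<le> 1/8" using b[of s] by simp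
      then show ?thesis using \<open>(1::real) \<le> 2 ^ n\<close> by linarith
    qed
  qed
  then have "(\<Sum>s\<in>UNIV. \<bar>\<xi> $ s\<bar>) \<le> (\<Sum>s\<in>(UNIV :: 'n set). 2 * 2 ^ n)" by (rule sum_mono)
  then show "norm \<xi> \<le> 2 * 2 ^ n * CARD('n)" using norm_le_l1_cart[of \<xi>] by (simp add: mult_ac)
qed

lemma train_scaled_schwartz0: "(\<lambda>x. c * train n x) \<in> schwartz0"
proof -
  have "(\<lambda>x. \<Sum>i\<in>{..<n}. c * wave i x) \<in> schwartz"
    by (rule schwartz_lincomb) (auto intro: wave_schwartz)
  then have 1: "(\<lambda>x. c * train n x) \<in> schwartz" by (simp add: train_def sum_distrib_left)
  let ?K = "cball 0 (2 * 2 ^ n * CARD('n)) \<inter> {\<xi> :: 'n vec. 7/8 \<le> \<xi> $ a}"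
  have "closed {\<xi> :: 'n vec. 7/8 \<le> \<xi> $ a}"
    by (intro closed_Collect_le continuous_on_const continuous_on_component continuous_on_id)
  then have 2: "compact ?K" by (intro compact_Int_closed) auto
  have 3: "?K \<subseteq> - {0}" by auto
  have "fourier (\<lambda>x. c * train n x) \<xi> = c * fourier (train n) \<xi>" for \<xi>
    unfolding fourier_def by (simp add: mult.assoc)
  then have "fourier (\<lambda>x. c * train n x) \<xi> = 0" if "\<xi> \<notin> ?K" for \<xi>
    using fourier_train_support[of n \<xi>] that by auto
  then show ?thesis using 1 2 3 unfolding schwartz0_def by blast
qed

lemma dilate_op_train_scaled: "dilate_op m (\<lambda>x. c * train n x) j x = c * dilate_op m (train n) j x"
proof -
  have "fourier (\<lambda>x. c * train n x) \<xi> = c * fourier (train n) \<xi>" for \<xi>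
    unfolding fourier_def by (simp add: mult.assoc)
  then show ?thesis
    unfolding dilate_op_def inv_fourier_def by (simp add: mult.assoc mult.left_commute[of _ c])
qed

text \<open>On the spectrum of each wave the dilated symbol is constantly 0 or 1, so it selects
  waves without any error term.\<close>

lemma dilate_op_lac_train:
  assumes w: "tower (vanishes_off (1/4)) w" "\<And>t. \<bar>t\<bar> \<le> 1/8 \<Longrightarrow> w 0 t = 1" and L: "finite L"
  shows "dilate_op (lacunary w a L) (train n) j x = (\<Sum>i<n. if i + j \<in> L then wave i x else 0)"
proof -
  let ?c = "\<lambda>i. if i + j \<in> L then 1 else 0 :: complex"
  have hit: "lacunary w a L (2 ^ j *\<^sub>R \<xi>) * fourier (wave i) \<xi> = ?c i * fourier (wave i) \<xi>" for i \<xi>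
  proof (cases "fourier (wave i) \<xi> = 0")
    case False
    have "lacunary w a L (2 ^ j *\<^sub>R \<xi>) = ?c i"
      by (rule lacunary_eval[OF w L]) (use False fourier_wave_eq_0 not_le in blast)+
    then show ?thesis by simp
  qed simp
  then have "dilate_op (lacunary w a L) (train n) j x = (LINT \<xi>|lborel. (\<Sum>i<n. ?c i * (fourier (wave i) \<xi> * phase x \<xi>)))"
    unfolding dilate_op_def inv_fourier_def fourier_train sum_distrib_left sum_distrib_right
    by (simp only: hit mult.assoc[symmetric])
  also have "\<dots> = (\<Sum>i<n. LINT \<xi>|lborel. ?c i * (fourier (wave i) \<xi> * phase x \<xi>))"
    by (intro Bochner_Integration.integral_sum integrable_mult_right
          integrable_mult_bounded[OF fourier_wave_integrable, where C=1]) auto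
  also have "\<dots> = (\<Sum>i<n. ?c i * inv_fourier (fourier (wave i)) x)"
    unfolding inv_fourier_def by simp
  also have "\<dots> = (\<Sum>i<n. if i + j \<in> L then wave i x else 0)"
    unfolding inv_fourier_fourier_wave by (rule sum.cong) auto
  finally show ?thesis .
qed

text \<open>After division by n the modulus y of the train is at most 1, so y^p <= y and the
  estimate reduces to \<open>S_L1\<close> for every exponent at once. The integral of y is at most
  \<open>I / sqrt n\<close>, which dictates the normalisation.\<close>

lemma train_Lp:
  assumes "n > 0" "p > 1"
  shows "Lp_pow p (\<lambda>x. ennreal (norm (complex_of_real ((sqrt n / I) powr (1/p) / n) * train n x))) \<le> 1"
proof -
  let ?\<kappa> = "(sqrt n / I) powr (1/p)"
  let ?y = "\<lambda>x. norm (g x) * norm (S n x) / n"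
  have y: "0 \<le> ?y x" "?y x \<le> 1" for x
  proof -
    have "norm (g x) * norm (S n x) \<le> 1 * real n" by (intro mult_mono g_real S_bound) auto
    then show "?y x \<le> 1" using assms(1) by simp
  qed simp
  have pt: "enn_powr (ennreal (norm (complex_of_real (?\<kappa> / n) * train n x))) p \<le> ennreal (sqrt n / I * ?y x)" for x
  proof -
    have "norm (complex_of_real (?\<kappa> / n) * train n x) = ?\<kappa> * ?y x"
      by (simp add: train_eq norm_mult norm_divide)
    then have "enn_powr (ennreal (norm (complex_of_real (?\<kappa> / n) * train n x))) p = ennreal ((?\<kappa> * ?y x) powr p)"
      using y by (simp add: enn_powr_def)
    also have "(?\<kappa> * ?y x) powr p = (sqrt n / I) * ?y x powr p"
    proof -
      have "(?\<kappa> * ?y x) powr p = ?\<kappa> powr p * ?y x powr p" by (rule powr_mult)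
      moreover have "?\<kappa> powr p = sqrt n / I" using I_pos assms by (simp add: powr_powr)
      ultimately show ?thesis by simp
    qed
    also have "\<dots> \<le> (sqrt n / I) * ?y x"
    proof (rule mult_left_mono)
      have "?y x powr p \<le> ?y x powr 1" using y assms by (intro powr_mono') auto
      then show "?y x powr p \<le> ?y x" using y[of x] by simp
      show "0 \<le> sqrt n / I" using I_pos by simp
    qed
    finally show ?thesis by (simp add: ennreal_leI)
  qed
  have int: "integrable lborel (\<lambda>x. sqrt n / I * ?y x)"
    using gS_integrable(1)[of n] by simp
  have "Lp_pow p (\<lambda>x. ennreal (norm (complex_of_real (?\<kappa> / n) * train n x))) \<le> (\<integral>\<^sup>+x. ennreal (sqrt n / I * ?y x) \<partial>lborel)"
    unfolding Lp_pow_def by (intro nn_integral_mono pt)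
  also have "\<dots> = ennreal (LINT x|lborel. sqrt n / I * ?y x)"
    by (rule nn_integral_eq_integral[OF int]) (use y I_pos in \<open>auto intro!: mult_nonneg_nonneg\<close>)
  also have "(LINT x|lborel. sqrt n / I * ?y x) = sqrt n / (I * n) * (LINT x|lborel. norm (g x) * norm (S n x))"
    by simp
  also have "\<dots> \<le> sqrt n / (I * n) * (sqrt n * I)"
    using I_pos by (intro mult_left_mono S_L1 assms) auto
  also have "\<dots> = 1" using I_pos assms(1) by (simp add: field_simps)
  finally show ?thesis by (simp add: ennreal_leI)
qed

text \<open>Comparing the block of a good subset with the empty block gives a main term of size
  \<delta> n / 8, from |g| >= 1/2 and the quarter of \<open>subset_sum_quarter\<close>. Subtract
  \<delta> n / 32 for the variation of \<open>m0\<close> and twice \<delta> n / 64 for the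
  remainder: \<delta> n / 16 is left, and one of the two dilates carries half of it.\<close>

lemma perturbation_unbounded:
  assumes w: "tower (vanishes_off (1/4)) w" "\<And>t. \<bar>t\<bar> \<le> 1/8 \<Longrightarrow> w 0 t = 1"
    and m0: "m0 \<in> mult_space" and \<delta>: "\<delta> > 0" and n: "n > 0"
    and \<rho>: "\<And>x. x \<in> cball 0 \<rho> \<Longrightarrow> norm (g x) \<ge> 1/2"
  shows "\<exists>L \<eta>. finite L \<and> \<eta> > 0 \<and> (\<forall>m x. m \<in> mult_space \<longrightarrow>
      snorm 0 (m - (\<lambda>\<xi>. m0 \<xi> + complex_of_real \<delta> * lacunary w a L \<xi>)) < \<eta> \<longrightarrow> x \<in> cball 0 \<rho> \<longrightarrow>
      (\<exists>j. norm (dilate_op m (train n) j x) \<ge> \<delta> * n / 32))"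
proof -
  let ?B = "cball (0 :: 'n vec) \<rho>"
  let ?f = "train n"
  define IF where "IF = (LINT \<xi>|lborel. norm (fourier ?f \<xi>))"
  have IF: "IF \<ge> 0" unfolding IF_def by simp
  note Fi = fourier_train_integrable[of n]
  let ?M = "snorm 0 m0"
  have M: "norm (m0 \<xi>) \<le> ?M" for \<xi> by (rule norm_le_snorm[OF m0])
  then have M0: "?M \<ge> 0" using norm_ge_zero order_trans by blast
  \<comment> \<open>Only scales divisible by n are used, so that the blocks of n consecutive scales
    starting there do not overlap.\<close>
  define A where "A t = dilate_op m0 ?f (n * t)" for t
  obtain k :: "nat \<Rightarrow> nat" where k: "strict_mono k" and cauchy: "\<And>e. 0 < e \<Longrightarrow> \<exists>N. \<forall>t s x. t \<ge> N \<and> s \<ge> N \<and> x \<in> ?B \<longrightarrow> norm (A (k t) x - A (k s) x) < e"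
  proof -
    obtain h k where hk: "strict_mono (k :: nat \<Rightarrow> nat)"
      "\<And>e. 0 < e \<Longrightarrow> \<exists>N. \<forall>t x. t \<ge> N \<and> x \<in> ?B \<longrightarrow> norm (A (k t) x - h x) < e"
    proof (rule Arzela_Ascoli[of ?B A "?M * IF"])
      show "norm (A t x) \<le> ?M * IF" for t x
        unfolding A_def IF_def by (rule dilate_op_bound[OF m0 M Fi])
      fix x :: "'n vec" and \<epsilon> :: real assume "0 < \<epsilon>"
      define R where "R = 2 * pi * (2 * 2 ^ n * CARD('n))"
      have R: "R > 0" by (simp add: R_def)
      \<comment> \<open>The summand 1 keeps the Lipschitz constant positive, as needed for the
        division by it.\<close>
      define c where "c = ?M * R * IF + 1"
      have c: "c > 0" using M0 R IF by (simp add: c_def add_nonneg_pos)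
      have lip: "norm (A t x - A t y) \<le> c * norm (x - y)" for t y
      proof -
        have "norm (A t x - A t y) \<le> ?M * (R * norm (x - y)) * IF"
          unfolding A_def IF_def
        proof (rule dilate_op_diff_bound[OF m0 M Fi])
          fix \<xi> assume "fourier ?f \<xi> \<noteq> 0"
          then have "2 * pi * norm \<xi> * norm (x - y) \<le> R * norm (x - y)"
            unfolding R_def by (intro mult_right_mono mult_left_mono fourier_train_support(2)) auto
          then show "norm (phase x \<xi> - phase y \<xi>) \<le> R * norm (x - y)"
            using phase_lipschitz[of x \<xi> y] by linarith
        qed
        also have "\<dots> \<le> c * norm (x - y)"
          by (simp add: c_def algebra_simps)
        finally show ?thesis .
      qed
      show "\<exists>d. 0 < d \<and> (\<forall>t y. y \<in> ?B \<and> norm (x - y) < d \<longrightarrow> norm (A t x - A t y) < \<epsilon>)"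
      proof (intro exI[of _ "\<epsilon> / c"] conjI allI impI)
        show "0 < \<epsilon> / c" using \<open>0 < \<epsilon>\<close> c by simp
        fix t y assume "y \<in> ?B \<and> norm (x - y) < \<epsilon> / c"
        then have "c * norm (x - y) < \<epsilon>" using c by (simp add: pos_less_divide_eq mult.commute)
        then show "norm (A t x - A t y) < \<epsilon>" using lip[of t y] by linarith
      qed
    qed auto
    have "\<exists>N. \<forall>t s x. t \<ge> N \<and> s \<ge> N \<and> x \<in> ?B \<longrightarrow> norm (A (k t) x - A (k s) x) < e" if e: "0 < e" for e
    proof -
      obtain N where "\<forall>t x. t \<ge> N \<and> x \<in> ?B \<longrightarrow> norm (A (k t) x - h x) < e / 2"
        using hk(2)[OF half_gt_zero[OF e]] by blast
      then have N: "\<And>t x. t \<ge> N \<Longrightarrow> x \<in> ?B \<Longrightarrow> norm (A (k t) x - h x) < e / 2" by blast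
      have "norm (A (k t) x - A (k s) x) < e" if "t \<ge> N" "s \<ge> N" "x \<in> ?B" for t s x
        using norm_diff_triangle_less[OF N[OF that(1,3)], of "A (k s) x" "e / 2"] N[OF that(2,3)]
        by (simp add: norm_minus_commute)
      then show ?thesis by blast
    qed
    then show thesis by (rule that[OF hk(1)])
  qed
  obtain N where N: "\<And>t s x. t \<ge> N \<Longrightarrow> s \<ge> N \<Longrightarrow> x \<in> ?B \<Longrightarrow> norm (A (k t) x - A (k s) x) < \<delta> * n / 32"
    using cauchy[of "\<delta> * n / 32"] \<delta> n by auto
  \<comment> \<open>There are finitely many patterns; numbering them places their blocks at distinct
    late members of the subsequence.\<close>
  obtain idx :: "nat set \<Rightarrow> nat" where idx: "inj_on idx (Pow {..<n})"
    using finite_imp_inj_to_nat_seg[of "Pow {..<n}"] by auto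
  \<comment> \<open>the block of dyadic scales reserved for the pattern \<open>E\<close>\<close>
  define blk where "blk E = n * k (N + idx E)" for E
  define L where "L = (\<Union>E\<in>Pow {..<n}. (\<lambda>i. i + blk E) ` E)"
  have finL: "finite L" unfolding L_def by (auto intro: finite_subset[of _ "{..<n}"])
  have mem: "i + blk E \<in> L \<longleftrightarrow> i \<in> E" if "i < n" "E \<subseteq> {..<n}" for i E
  proof
    assume "i + blk E \<in> L"
    then obtain E' i' where E': "E' \<subseteq> {..<n}" "i' \<in> E'" "i + blk E = i' + blk E'" unfolding L_def by auto
    have i': "i' < n" using E' by auto
    \<comment> \<open>Block starts are multiples of n and i < n, so the quotient by n determines the
      block, and injectivity then determines the pattern.\<close>
    have "(i + blk E) div n = k (N + idx E)" "(i' + blk E') div n = k (N + idx E')"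
      using that(1) i' by (auto simp: blk_def)
    then have "k (N + idx E) = k (N + idx E')" using E'(3) by simp
    then have "idx E = idx E'" using strict_mono_eq[OF k] by simp
    then have "E = E'" using idx that(2) E'(1) by (auto simp: inj_on_def)
    then show "i \<in> E" using E' by simp
  next
    assume "i \<in> E"
    then show "i + blk E \<in> L" using that unfolding L_def by blast
  qed
  \<comment> \<open>Chosen so that a symbol bounded by \<eta> contributes at most \<delta> n / 64;
    \<open>IF + 1\<close> avoids a zero denominator.\<close>
  define \<eta> where "\<eta> = \<delta> * n / (64 * (IF + 1))"
  have \<eta>: "\<eta> > 0" "\<eta> * IF \<le> \<delta> * n / 64"
  proof -
    show "\<eta> > 0" using \<delta> n IF by (simp add: \<eta>_def)
    have "\<eta> * IF \<le> \<eta> * (IF + 1)" using \<open>\<eta> > 0\<close> by simp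
    also have "\<dots> = \<delta> * n / 64"
      using nonzero_mult_divide_mult_cancel_right[of "IF + 1" "\<delta> * n" 64] IF by (simp add: \<eta>_def)
    finally show "\<eta> * IF \<le> \<delta> * n / 64" .
  qed
  have lacm: "lacunary w a L \<in> mult_space" by (rule lacunary_bounds(1)[OF w(1) finL])
  let ?m' = "\<lambda>\<xi>. m0 \<xi> + complex_of_real \<delta> * lacunary w a L \<xi>"
  have m': "?m' \<in> mult_space" by (rule mult_space_lincomb[OF m0 lacm])
  have main: "\<exists>j. norm (dilate_op m ?f j x) \<ge> \<delta> * n / 32"
    if m: "m \<in> mult_space" "snorm 0 (m - ?m') < \<eta>" and x: "x \<in> ?B" for m x
  proof -
    let ?r = "m - ?m'"
    have r: "?r \<in> mult_space" by (rule mult_space_diff[OF m(1) m'])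
    have rb: "norm (?r \<xi>) \<le> \<eta>" for \<xi> using norm_le_snorm[OF r, of \<xi>] m(2) by simp
    have split: "dilate_op m ?f j x = dilate_op m0 ?f j x + \<delta> * dilate_op (lacunary w a L) ?f j x + dilate_op ?r ?f j x" for j
    proof -
      have "m = (\<lambda>\<xi>. ?m' \<xi> + 1 * ?r \<xi>)" by auto
      then have "dilate_op m ?f j x = dilate_op ?m' ?f j x + 1 * dilate_op ?r ?f j x"
        using dilate_op_lincomb[OF m' r Fi, of 1 j x] by presburger
      then show ?thesis using dilate_op_lincomb[OF m0 lacm Fi, of \<delta> j x] by simp
    qed
    have rd: "norm (dilate_op ?r ?f j x) \<le> \<delta> * n / 64" for j
      by (rule order_trans[OF dilate_op_bound[OF r rb Fi, folded IF_def] \<eta>(2)])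
    obtain E where E: "E \<subseteq> {..<n}" "norm (\<Sum>i\<in>E. phase x (e i)) \<ge> n / 4"
      using subset_sum_quarter[of "{..<n}" "\<lambda>i. phase x (e i)"] by auto
    have lacE: "dilate_op (lacunary w a L) ?f (blk F) x = g x * (\<Sum>i\<in>F. phase x (e i))" if F: "F \<subseteq> {..<n}" for F
    proof -
      have "dilate_op (lacunary w a L) ?f (blk F) x = (\<Sum>i<n. if i + blk F \<in> L then wave i x else 0)"
        by (rule dilate_op_lac_train[OF w(1) _ finL]) (rule w(2))
      also have "\<dots> = (\<Sum>i<n. if i \<in> F then wave i x else 0)"
        by (rule sum.cong) (auto simp: mem F)
      also have "\<dots> = (\<Sum>i\<in>F. wave i x)"
        using F by (subst sum.inter_restrict[symmetric]) (auto simp: Int_absorb1)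
      finally show ?thesis by (simp add: wave_def sum_distrib_left)
    qed
    \<comment> \<open>On the block of the empty pattern the lacunary part acts as zero, so that
      dilate serves as reference for the effect of \<open>m0\<close>.\<close>
    let ?u = "dilate_op m ?f (blk E) x" and ?v = "dilate_op m ?f (blk {}) x"
    let ?a = "dilate_op m0 ?f (blk E) x - dilate_op m0 ?f (blk {}) x"
    have "complex_of_real \<delta> * (g x * (\<Sum>i\<in>E. phase x (e i))) = ?u - ?v - ?a - dilate_op ?r ?f (blk E) x + dilate_op ?r ?f (blk {}) x"
      using split[of "blk E"] split[of "blk {}"] lacE[OF E(1)] lacE[of "{}"] by simp
    then have "norm (complex_of_real \<delta> * (g x * (\<Sum>i\<in>E. phase x (e i))))
        \<le> norm ?u + norm ?v + norm ?a + norm (dilate_op ?r ?f (blk E) x) + norm (dilate_op ?r ?f (blk {}) x)"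
      by (smt (verit) norm_triangle_ineq norm_triangle_ineq4)
    moreover have "norm ?a < \<delta> * n / 32"
      using N[of "N + idx E" "N + idx {}" x] x by (simp add: A_def blk_def)
    moreover have "norm (complex_of_real \<delta> * (g x * (\<Sum>i\<in>E. phase x (e i)))) \<ge> \<delta> * n / 8"
    proof -
      have "1/2 * (n / 4) \<le> norm (g x) * norm (\<Sum>i\<in>E. phase x (e i))"
        using \<rho>[OF x] E(2) by (intro mult_mono) auto
      then have "\<delta> * (1/2 * (n / 4)) \<le> \<delta> * (norm (g x) * norm (\<Sum>i\<in>E. phase x (e i)))"
        using \<delta> by (intro mult_left_mono) auto
      then show ?thesis using \<delta> by (simp add: norm_mult)
    qed
    ultimately have "norm ?u + norm ?v \<ge> \<delta> * n / 16"
      using rd[of "blk E"] rd[of "blk {}"] by linarith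
    then have "norm ?u \<ge> \<delta> * n / 32 \<or> norm ?v \<ge> \<delta> * n / 32" by linarith
    then show ?thesis by blast
  qed
  show ?thesis by (intro exI[of _ L] exI[of _ \<eta>] conjI finL \<eta>(1) allI impI main)
qed

end

section \<open>Meagreness\<close>

text \<open>
  The exponent \<open>p\<close> ranges over an uncountable set, so it is absorbed into the existential quantifier;
  the bound \<open>p \<le> r\<close> keeps the lower estimates uniform.
\<close>
definition bounded_multipliers :: "nat \<Rightarrow> ('n::finite vec \<Rightarrow> complex) set" where
  "bounded_multipliers r = {m \<in> mult_space. \<exists>p. 1 < p \<and> p \<le> real r \<and> (\<forall>f \<in> schwartz0.
      Lp_pow p (\<lambda>x. ennreal (norm (f x))) \<le> 1 \<longrightarrow> Lp_pow p (dyadic_max m f) \<le> ennreal (real r))}"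

text \<open>For the normalised train the p-th power integral of the maximal function is at least
  \<open>sqrt n / I * (\<delta> / 32) powr p * V\<close>, while its own is at most 1. Since \<delta>
  does not depend on n, a large n contradicts the bound r for every exponent p <= r, on a whole
  sup-norm neighbourhood of the perturbation.\<close>

lemma nowhere_dense_bounded_multipliers:
  "nowhere_dense_in mult_topology (bounded_multipliers r :: ('n::finite vec \<Rightarrow> complex) set)"
proof (rule nowhere_dense_in_mult_topologyI)
  show "bounded_multipliers r \<subseteq> mult_space" by (auto simp: bounded_multipliers_def)
next
  fix m0 :: "'n vec \<Rightarrow> complex" and J :: nat and \<epsilon> :: real
  assume m0: "m0 \<in> mult_space" and \<epsilon>: "\<epsilon> > 0"
  \<comment> \<open>Any coordinate direction can carry the lacunary frequencies.\<close>
  fix a :: 'n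
  obtain D where "band_window D" using band_window_exists by blast
  then interpret window D a by unfold_locales
  obtain w :: "nat \<Rightarrow> real \<Rightarrow> complex" where w: "tower (vanishes_off (1/4)) w" "\<And>t. \<bar>t\<bar> \<le> 1/8 \<Longrightarrow> w 0 t = 1"
    using plateau_exists by blast
  obtain \<rho> where \<rho>: "\<rho> > 0" "\<And>x. x \<in> cball 0 \<rho> \<Longrightarrow> norm (g x) \<ge> 1/2" using g_near_0 by blast
  let ?B = "cball (0 :: 'n vec) \<rho>"
  define V where "V = measure lborel ?B"
  have V: "V > 0" "emeasure lborel ?B = ennreal V"
    using content_cball_pos[OF \<rho>(1), of "0 :: 'n vec"] emeasure_lborel_cball_finite[of "0 :: 'n vec" \<rho>]
    by (auto simp: V_def emeasure_eq_ennreal_measure less_top)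
  from lacunary_bounds(2)[OF w(1), of J a] obtain C
    where C0: "C \<ge> 0 \<and> (\<forall>L. finite L \<longrightarrow> (\<forall>is \<xi>. length is \<le> J \<longrightarrow> weighted is (lacunary w a L) \<xi> \<le> C))"
    by (elim exE)
  note C = C0[THEN conjunct1] C0[THEN conjunct2, rule_format]
  \<comment> \<open>The second argument keeps the perturbation inside the ball; the first makes
    powers of \<delta> / 32 decrease in the exponent.\<close>
  define \<delta> where "\<delta> = min 1 (\<epsilon> / (2 * (C + 1)))"
  have \<delta>: "\<delta> > 0" "\<delta> \<le> 1" using \<epsilon> C(1) by (auto simp: \<delta>_def)
  have \<delta>C: "\<delta> * C < \<epsilon>"
  proof -
    have "\<delta> * C \<le> \<delta> * (C + 1)" using \<delta> by simp
    also have "\<dots> \<le> \<epsilon> / (2 * (C + 1)) * (C + 1)" using C(1) by (intro mult_right_mono) (auto simp: \<delta>_def)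
    also have "\<dots> = \<epsilon> / 2"
      using nonzero_mult_divide_mult_cancel_right[of "C + 1" \<epsilon> 2] C(1) by simp
    finally show ?thesis using \<epsilon> by simp
  qed
  \<comment> \<open>The value of \<open>sqrt n\<close> at which the lower bound with exponent r for
    \<delta> / 32 would equal r; n is taken beyond it.\<close>
  define X where "X = real r * I / (V * (\<delta> / 32) ^ r)"
  obtain n :: nat where "X\<^sup>2 < n" using reals_Archimedean2 by blast
  then have n: "n > 0" "X < sqrt n"
    using zero_le_power2[of X] by (auto intro: real_less_rsqrt) (metis of_nat_0_less_iff order_le_less_trans zero_le_power2)
  have "\<exists>L \<eta>. finite L \<and> \<eta> > 0 \<and> (\<forall>m x. m \<in> mult_space \<longrightarrow>
      snorm 0 (m - (\<lambda>\<xi>. m0 \<xi> + complex_of_real \<delta> * lacunary w a L \<xi>)) < \<eta> \<longrightarrow> x \<in> ?B \<longrightarrow>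
      (\<exists>j. norm (dilate_op m (train n) j x) \<ge> \<delta> * n / 32))"
    by (rule perturbation_unbounded[OF w(1) _ m0 \<delta>(1) n(1)]) (use w(2) \<rho>(2) in blast)+
  then obtain L \<eta> where L0: "finite L \<and> \<eta> > 0 \<and> (\<forall>m x. m \<in> mult_space \<longrightarrow>
      snorm 0 (m - (\<lambda>\<xi>. m0 \<xi> + complex_of_real \<delta> * lacunary w a L \<xi>)) < \<eta> \<longrightarrow> x \<in> ?B \<longrightarrow>
      (\<exists>j. norm (dilate_op m (train n) j x) \<ge> \<delta> * n / 32))"
    by (elim exE)
  note L = L0[THEN conjunct1] L0[THEN conjunct2, THEN conjunct1]
    L0[THEN conjunct2, THEN conjunct2, rule_format]
  let ?m' = "\<lambda>\<xi>. m0 \<xi> + complex_of_real \<delta> * lacunary w a L \<xi>"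
  have lacm: "lacunary w a L \<in> mult_space" by (rule lacunary_bounds(1)[OF w(1) L(1)])
  have m': "?m' \<in> mult_space" by (rule mult_space_lincomb[OF m0 lacm])
  have "snorm J (?m' - m0) \<le> \<delta> * C"
  proof (rule snorm_least)
    fix "is" :: "'n list" and \<xi> :: "'n vec" assume *: "length is \<le> J" "\<xi> \<noteq> 0"
    \<comment> \<open>The zero symbol, written this way so that the estimate for linear combinations
      applies to the difference.\<close>
    let ?z = "m0 - m0"
    have z: "?z \<in> mult_space" by (rule mult_space_diff[OF m0 m0])
    have "?m' - m0 = (\<lambda>\<xi>. ?z \<xi> + complex_of_real \<delta> * lacunary w a L \<xi>)" by auto
    then have "weighted is (?m' - m0) \<xi> \<le> weighted is ?z \<xi> + norm (complex_of_real \<delta>) * weighted is (lacunary w a L) \<xi>"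
      using weighted_lincomb[OF z lacm *(2), of "is" "complex_of_real \<delta>"] by presburger
    also have "weighted is ?z \<xi> \<le> 0"
      using snorm_upper[OF z *] snorm_self[of J m0] by linarith
    also have "norm (complex_of_real \<delta>) * weighted is (lacunary w a L) \<xi> \<le> \<delta> * C"
      using \<delta> C(2)[OF L(1) *(1), of \<xi>] by (simp add: mult_left_mono)
    finally show "weighted is (?m' - m0) \<xi> \<le> \<delta> * C" by simp
  qed
  then have close: "snorm J (?m' - m0) < \<epsilon>" using \<delta>C by linarith
  have "m \<notin> bounded_multipliers r" if m: "m \<in> mult_space" "snorm 0 (m - ?m') < \<eta>" for m
  proof
    assume "m \<in> bounded_multipliers r"
    then obtain p where p: "1 < p" "p \<le> real r"
      and bd: "\<And>f. f \<in> schwartz0 \<Longrightarrow> Lp_pow p (\<lambda>x. ennreal (norm (f x))) \<le> 1 \<Longrightarrow> Lp_pow p (dyadic_max m f) \<le> ennreal (real r)"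
      unfolding bounded_multipliers_def by blast
    define \<kappa> where "\<kappa> = (sqrt n / I) powr (1/p)"
    have \<kappa>: "\<kappa> > 0" using n I_pos by (simp add: \<kappa>_def)
    let ?f = "\<lambda>x. complex_of_real (\<kappa> / n) * train n x"
    have "ennreal (\<kappa> * \<delta> / 32) \<le> dyadic_max m ?f x" if x: "x \<in> ?B" for x
    proof -
      obtain j where j: "norm (dilate_op m (train n) j x) \<ge> \<delta> * n / 32" using L(3)[OF m x] by blast
      have "\<kappa> * \<delta> / 32 = \<kappa> / n * (\<delta> * n / 32)" using n by simp
      also have "\<dots> \<le> \<kappa> / n * norm (dilate_op m (train n) j x)" using j \<kappa> by (intro mult_left_mono) auto
      also have "\<dots> = norm (dilate_op m ?f j x)"
        unfolding dilate_op_train_scaled using \<kappa> by (simp add: norm_mult norm_divide)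
      finally have "ennreal (\<kappa> * \<delta> / 32) \<le> ennreal (norm (dilate_op m ?f j x))" by (rule ennreal_leI)
      also have "\<dots> \<le> dyadic_max m ?f x" by (rule dilate_op_le_dyadic_max)
      finally show ?thesis .
    qed
    then have "ennreal ((\<kappa> * \<delta> / 32) powr p) * emeasure lborel ?B \<le> Lp_pow p (dyadic_max m ?f)"
      by (rule Lp_pow_lower) (use \<kappa> \<delta> p in auto)
    also have "\<dots> \<le> ennreal (real r)"
      by (rule bd[OF train_scaled_schwartz0]) (use train_Lp[OF n(1) p(1)] in \<open>simp add: \<kappa>_def\<close>)
    finally have "ennreal ((\<kappa> * \<delta> / 32) powr p * V) \<le> ennreal (real r)"
      unfolding V(2) using V(1) by (simp add: ennreal_mult)
    then have le: "(\<kappa> * \<delta> / 32) powr p * V \<le> real r" by simp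
    have "(\<kappa> * \<delta> / 32) powr p = \<kappa> powr p * (\<delta> / 32) powr p"
      using \<kappa> \<delta> powr_mult[of \<kappa> "\<delta> / 32" p] by simp
    also have "\<kappa> powr p = sqrt n / I" using p I_pos n by (simp add: \<kappa>_def powr_powr)
    finally have eq: "(\<kappa> * \<delta> / 32) powr p = sqrt n / I * (\<delta> / 32) powr p" .
    have "(\<delta> / 32) ^ r = (\<delta> / 32) powr real r" using \<delta> by (simp add: powr_realpow)
    \<comment> \<open>This is where p <= r and \<delta> / 32 <= 1 remove the dependence on
      p.\<close>
    also have "\<dots> \<le> (\<delta> / 32) powr p" using \<delta> p by (intro powr_mono') auto
    finally have "sqrt n / I * (\<delta> / 32) ^ r * V \<le> (\<kappa> * \<delta> / 32) powr p * V"
      unfolding eq using I_pos V(1) by (intro mult_right_mono mult_left_mono) auto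
    then have "sqrt n / I * (\<delta> / 32) ^ r * V \<le> real r" using le by linarith
    moreover have "real r = X * (1 / I * (\<delta> / 32) ^ r * V)"
      using V(1) \<delta> I_pos by (simp add: X_def)
    moreover have "X * (1 / I * (\<delta> / 32) ^ r * V) < sqrt n * (1 / I * (\<delta> / 32) ^ r * V)"
      using n(2) V(1) \<delta> I_pos by (intro mult_strict_right_mono) auto
    ultimately show False by simp
  qed
  then show "\<exists>m'\<in>mult_space. snorm J (m' - m0) < \<epsilon> \<and>
      (\<exists>\<eta>>0. \<forall>m\<in>mult_space. snorm 0 (m - m') < \<eta> \<longrightarrow> m \<notin> bounded_multipliers r)"
    using m' close L(2) by blast
qed

theorem theorem1p1:
  shows "first_category_in (mult_topology :: ('n::finite vec \<Rightarrow> complex) topology) mult_space_M"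
  unfolding first_category_in_def
proof (intro exI[of _ bounded_multipliers] conjI allI)
  show "nowhere_dense_in mult_topology (bounded_multipliers r :: ('n vec \<Rightarrow> complex) set)" for r
    by (rule nowhere_dense_bounded_multipliers)
  show "(mult_space_M :: ('n vec \<Rightarrow> complex) set) \<subseteq> (\<Union>r. bounded_multipliers r)"
  proof
    fix m :: "'n vec \<Rightarrow> complex" assume "m \<in> mult_space_M"
    then obtain p C where m: "m \<in> mult_space" "1 < p"
      and bd: "\<And>f. f \<in> schwartz0 \<Longrightarrow> Lp_pow p (\<lambda>x. ennreal (norm (f x))) \<le> 1 \<Longrightarrow> Lp_pow p (dyadic_max m f) \<le> ennreal C"
      unfolding mult_space_M_def by blast
    \<comment> \<open>A single integer dominates both the exponent and the operator bound, which
      makes the union countable.\<close>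
    obtain r :: nat where r: "max p C \<le> real r" using real_arch_simple by blast
    have Cr: "ennreal C \<le> ennreal (real r)" using r by (intro ennreal_leI) simp
    have "p \<le> real r" using r by simp
    moreover have "Lp_pow p (dyadic_max m f) \<le> ennreal (real r)"
      if "f \<in> schwartz0" "Lp_pow p (\<lambda>x. ennreal (norm (f x))) \<le> 1" for f
      by (rule order_trans[OF bd[OF that] Cr])
    ultimately have "m \<in> bounded_multipliers r"
      unfolding bounded_multipliers_def using m by blast
    then show "m \<in> (\<Union>r. bounded_multipliers r)" by blast
  qed
qed

end
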